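(* Let $d\in\mathbb N$, $n\in\mathbb N$ with $n\ge2$, $B>0$ and $k\in\{0,1\}$. Then there is a constant $c=c(d,n,B,k)>0$ with the following property. If $\varepsilon\in(0,1/2)$ and $\mathcal A_\varepsilon=\mathcal A_\varepsilon(d,n,B,k,\varepsilon)$ is a neural network architecture such that for every $f\in W^{n,\infty}((0,1)^d)$ with $\|f\|_{W^{n,\infty}((0,1)^d)}\le B$ there is a neural network $\Phi_\varepsilon^f$ that has architecture $\mathcal A_\varepsilon$ and satisfies $$\big\|R_\varrho(\Phi_\varepsilon^f)-f\big\|_{W^{k,\infty}((0,1)^d)}\le\varepsilon,$$ then $\mathcal A_\varepsilon$ has at least $$M(\mathcal A_\varepsilon)\ge c\,\varepsilon^{-d/(2(n-k))}$$ weights.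
   Context: $\mathbb N=\{1,2,\dots\}$. The activation function is the ReLU $\varrho(x)=\max\{0,x\}$, acting componentwise on vectors. Neural networks (skip connections allowed). For $d,L\in\mathbb N$, a neural network $\Phi$ with input dimension $d$ and $L$ layers is a sequence $\Phi=((A_1,b_1),\dots,(A_L,b_L))$, where $N_0=d$, $N_1,\dots,N_L\in\mathbb N$, each $A_l$ is a real $N_l\times\sum_{k=0}^{l-1}N_k$ matrix and $b_l\in\mathbb R^{N_l}$. Its realization $R_\varrho(\Phi):\mathbb R^d\to\mathbb R^{N_L}$ is $R_\varrho(\Phi)(x)=x_L$, where $x_0=x$, $x_l=\varrho\big(A_l[x_0^T|\cdots|x_{l-1}^T]^T+b_l\big)$ for $l=1,\dots,L-1$, and $x_L=A_L[x_0^T|\cdots|x_{L-1}^T]^T+b_L$. $N_L$ is the output dimension. Architectures. A neural network architecture $\mathcal A$ is a neural network all of whose matrix and vector entries lie in $\{0,1\}$ (here with $d$-dimensional input and one-dimensional output). Its number of weights $M(\mathcal A)$ is the total number of nonzero entries of all $A_l$ and $b_l$. A neural network $((A_1',b_1'),\dots,(A_L',b_L'))$ with input dimension $d$ and $L$ layers has architecture $\mathcal A=((A_1,b_1),\dots,(A_L,b_L))$ if the layer sizes $N_1,\dots,N_L$ coincide and an entry of $A_l'$ (resp. $b_l'$) can be nonzero only where the corresponding entry of $A_l$ (resp. $b_l$) is nonzero. Sobolev norms: $\|f\|_{W^{n,\infty}(\Omega)}=\max_{|\alpha|\le n}\|D^\alpha f\|_{L^\infty(\Omega)}$ with weak derivatives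 $D^\alpha f$; $W^{0,\infty}=L^\infty$.
   Formalization: Adds the assumption that ε < B whenever the architecture has no weights; without it, for B ≤ ε < 1/2 the all-zero architecture (M = 0) approximates every f in the ball by 0 and contradicts the bound. *)

theory Defs
  imports
    "HOL-Analysis.Analysis"
    "HOL-Probability.Essential_Supremum"
    "Jordan_Normal_Form.Matrix"
begin

section \<open>Sobolev spaces with exponent infinity\<close>

type_synonym 'd multiindex = "'d \<Rightarrow> nat"

definition order_mi :: "'d::finite multiindex \<Rightarrow> nat" where
  "order_mi \<alpha> = (\<Sum>i\<in>UNIV. \<alpha> i)"

definition partial :: "'d::finite \<Rightarrow> (real^'d \<Rightarrow> real) \<Rightarrow> real^'d \<Rightarrow> real" where
  "partial i f x = deriv (\<lambda>t. f (x + t *\<^sub>R axis i 1)) 0"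

text \<open>Coordinate number \<open>i < CARD('d)\<close>. On \<open>{..<CARD('d)}\<close> this is a bijection onto the index type
  (lemma \<open>bij_betw_from_nat_into_finite\<close>).\<close>

definition coord :: "nat \<Rightarrow> 'd::finite" where
  "coord = from_nat_into UNIV"

text \<open>Classical mixed derivative. It is only applied to smooth functions, for which the order of
  the coordinates is immaterial.\<close>

definition classical_deriv :: "'d::finite multiindex \<Rightarrow> (real^'d \<Rightarrow> real) \<Rightarrow> real^'d \<Rightarrow> real" where
  "classical_deriv \<alpha> f =
     foldr (\<lambda>i g. (partial i ^^ \<alpha> i) g) (map coord [0..<CARD('d)]) f"

text \<open>All iterated partial derivatives (in any order) are differentiable, and hence continuous.\<close>

definition smooth :: "(real^'d::finite \<Rightarrow> real) \<Rightarrow> bool" where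
  "smooth f \<longleftrightarrow> (\<forall>is. foldr partial is f differentiable_on UNIV)"

text \<open>\<open>C\<^sub>c\<^sup>\<infinity>(\<Omega>)\<close>, each function being extended by zero to the whole space.\<close>

definition test_functions :: "(real^'d::finite) set \<Rightarrow> (real^'d \<Rightarrow> real) set" where
  "test_functions \<Omega> =
     {\<phi>. smooth \<phi> \<and> compact (closure {x. \<phi> x \<noteq> 0}) \<and> closure {x. \<phi> x \<noteq> 0} \<subseteq> \<Omega>}"

definition locally_integrable :: "(real^'d::finite) set \<Rightarrow> (real^'d \<Rightarrow> real) \<Rightarrow> bool" where
  "locally_integrable \<Omega> f \<longleftrightarrow> (\<forall>K. compact K \<and> K \<subseteq> \<Omega> \<longrightarrow> f absolutely_integrable_on K)"

definition has_weak_deriv ::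
    "(real^'d::finite) set \<Rightarrow> 'd multiindex \<Rightarrow> (real^'d \<Rightarrow> real) \<Rightarrow> (real^'d \<Rightarrow> real) \<Rightarrow> bool" where
  "has_weak_deriv \<Omega> \<alpha> f g \<longleftrightarrow>
     locally_integrable \<Omega> f \<and> locally_integrable \<Omega> g \<and>
     (\<forall>\<phi>\<in>test_functions \<Omega>.
        (LINT x:\<Omega>|lebesgue. f x * classical_deriv \<alpha> \<phi> x) =
        (-1) ^ order_mi \<alpha> * (LINT x:\<Omega>|lebesgue. g x * \<phi> x))"

text \<open>A representative of \<open>D\<^sup>\<alpha>f\<close>, which is determined up to null sets if it exists.\<close>

definition weak_deriv ::
    "(real^'d::finite) set \<Rightarrow> 'd multiindex \<Rightarrow> (real^'d \<Rightarrow> real) \<Rightarrow> real^'d \<Rightarrow> real" where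
  "weak_deriv \<Omega> \<alpha> f = (SOME g. has_weak_deriv \<Omega> \<alpha> f g)"

text \<open>The value is \<open>\<infinity>\<close> also for functions that are not Lebesgue measurable on \<open>\<Omega>\<close>.\<close>

definition Linf_norm :: "(real^'d::finite) set \<Rightarrow> (real^'d \<Rightarrow> real) \<Rightarrow> ereal" where
  "Linf_norm \<Omega> f = esssup (lebesgue_on \<Omega>) (\<lambda>x. ereal \<bar>f x\<bar>)"

definition sobolev_inf :: "nat \<Rightarrow> (real^'d::finite) set \<Rightarrow> (real^'d \<Rightarrow> real) set" where
  "sobolev_inf n \<Omega> =
     {f. \<forall>\<alpha>. order_mi \<alpha> \<le> n \<longrightarrow> (\<exists>g. has_weak_deriv \<Omega> \<alpha> f g \<and> Linf_norm \<Omega> g < \<infinity>)}"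

text \<open>The norm is \<open>\<infinity>\<close> outside the Sobolev space, so a finite bound on it includes membership.\<close>

definition sobolev_inf_norm :: "nat \<Rightarrow> (real^'d::finite) set \<Rightarrow> (real^'d \<Rightarrow> real) \<Rightarrow> ereal" where
  "sobolev_inf_norm n \<Omega> f =
     (if f \<in> sobolev_inf n \<Omega>
      then MAX \<alpha>\<in>{\<alpha>. order_mi \<alpha> \<le> n}. Linf_norm \<Omega> (weak_deriv \<Omega> \<alpha> f)
      else \<infinity>)"


section \<open>Neural networks with skip connections\<close>

text \<open>The list entry number \<open>l - 1\<close> is the pair \<open>(A\<^sub>l, b\<^sub>l)\<close>.\<close>

type_synonym network = "(real mat \<times> real Matrix.vec) list"

text \<open>The layer size \<open>N\<^sub>l\<close>, for \<open>0 \<le> l \<le> L\<close>.\<close>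

definition layer_size :: "nat \<Rightarrow> network \<Rightarrow> nat \<Rightarrow> nat" where
  "layer_size d \<Phi> l = (if l = 0 then d else dim_vec (snd (\<Phi> ! (l - 1))))"

definition is_network :: "nat \<Rightarrow> network \<Rightarrow> bool" where
  "is_network d \<Phi> \<longleftrightarrow> d \<ge> 1 \<and> length \<Phi> \<ge> 1 \<and>
     (\<forall>l\<in>{1..length \<Phi>}. layer_size d \<Phi> l \<ge> 1 \<and>
        fst (\<Phi> ! (l - 1)) \<in> carrier_mat (layer_size d \<Phi> l) (\<Sum>k<l. layer_size d \<Phi> k))"

definition output_dim :: "network \<Rightarrow> nat" where
  "output_dim \<Phi> = dim_vec (snd (last \<Phi>))"

definition relu :: "real \<Rightarrow> real" where
  "relu x = max 0 x"

text \<open>The argument \<open>z\<close> accumulates \<open>[x\<^sub>0\<^sup>T | \<dots> | x\<^sub>l\<^sub>-\<^sub>1\<^sup>T]\<^sup>T\<close>. The last layer is affine.\<close>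

fun run_layers :: "network \<Rightarrow> real Matrix.vec \<Rightarrow> real Matrix.vec" where
  "run_layers [] z = z"
| "run_layers [(A, b)] z = A *\<^sub>v z + b"
| "run_layers ((A, b) # \<Phi>) z = run_layers \<Phi> (z @\<^sub>v map_vec relu (A *\<^sub>v z + b))"

definition coord_vec :: "real^'d::finite \<Rightarrow> real Matrix.vec" where
  "coord_vec x = Matrix.vec CARD('d) (\<lambda>i. vec_nth x (coord i))"

definition realization :: "network \<Rightarrow> real^'d::finite \<Rightarrow> real Matrix.vec" where
  "realization \<Phi> x = run_layers \<Phi> (coord_vec x)"

text \<open>The realization of a network with one-dimensional output as a real-valued function.\<close>

definition realization1 :: "network \<Rightarrow> real^'d::finite \<Rightarrow> real" where
  "realization1 \<Phi> x = vec_index (realization \<Phi> x) 0"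

definition is_architecture :: "nat \<Rightarrow> network \<Rightarrow> bool" where
  "is_architecture d \<A> \<longleftrightarrow> is_network d \<A> \<and> output_dim \<A> = 1 \<and>
     (\<forall>(A, b)\<in>set \<A>.
        (\<forall>i<dim_row A. \<forall>j<dim_col A. A $$ (i, j) \<in> {0, 1}) \<and>
        (\<forall>i<dim_vec b. vec_index b i \<in> {0, 1}))"

definition num_weights :: "network \<Rightarrow> nat" where
  "num_weights \<Phi> = (\<Sum>(A, b)\<leftarrow>\<Phi>.
     card {(i, j). i < dim_row A \<and> j < dim_col A \<and> A $$ (i, j) \<noteq> 0} +
     card {i. i < dim_vec b \<and> vec_index b i \<noteq> 0})"

definition has_architecture :: "nat \<Rightarrow> network \<Rightarrow> network \<Rightarrow> bool" where
  "has_architecture d \<Phi> \<A> \<longleftrightarrow> is_network d \<Phi> \<and> length \<Phi> = length \<A> \<and>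
     (\<forall>l\<in>{1..length \<A>}. layer_size d \<Phi> l = layer_size d \<A> l) \<and>
     (\<forall>l<length \<A>.
        (\<forall>i<dim_row (fst (\<A> ! l)). \<forall>j<dim_col (fst (\<A> ! l)).
           fst (\<Phi> ! l) $$ (i, j) \<noteq> 0 \<longrightarrow> fst (\<A> ! l) $$ (i, j) \<noteq> 0) \<and>
        (\<forall>i<dim_vec (snd (\<A> ! l)).
           vec_index (snd (\<Phi> ! l)) i \<noteq> 0 \<longrightarrow> vec_index (snd (\<A> ! l)) i \<noteq> 0))"

end

(* A network with skip connections and M weights is a ReLU circuit. Once the set of active neurons is
   prescribed, it computes a polynomial of degree at most M + 1 in its weights, and the signs of
   O(M * 2^M) such polynomials per input decide which neurons are active. Polynomials have few sign
   patterns (Warren): maximizing the square of the product of the polynomials, minus a small multiple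
   of the sum of the (2m)-th powers of the variables, over each sign cell yields a critical point in
   that cell, and by a Bezout-type argument there are at most (2m - 1)^M critical points. Hence an
   architecture with M weights shatters at most 25 * M^2 points.

   On the other hand, the sums of scaled bumps over subsets of a grid with N^d cells, with amplitude
   of order N^(-n), have W^{n,infinity} norm at most B. A W^{k,infinity} error of order N^(k-n) changes
   the increment of the network between the centre of a bump and a nearby point outside its support by
   less than half of the height of the bump, so the networks shatter the N^d cells and N^d <= 25 * M^2. *)

theory Submission
  imports Defs
begin

text \<open>The sign data are circular: the polynomial that a neuron computes depends on the active
  set, and that set depends on the weights. Testing the gated polynomials of every candidate gate
  set resolves this, because only the true active set reproduces itself from the signs. The price is
  a factor exponential in \<open>M\<close> in the number of polynomials; inside a power
  \<open>M\<close> it costs a term of order \<open>M^2\<close> in the exponent of 2. This is the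
  source of the square in \<open>25 * M^2\<close>, and hence of the factor 2 in the exponent of the
  theorem. Depth does not enter, since at most \<open>M\<close> positions can ever be active.

  For \<open>k = 1\<close> the error controls a weak derivative, which has no values at points.
  Increments over a step \<open>h\<close> do have a meaning, their error is at most
  \<open>\<epsilon> * h\<close>, and they serve for \<open>k = 0\<close> as well. Essential bounds
  become pointwise ones by testing against bumps, because realizations are continuous. Since the
  norm is taken of a chosen representative of the weak derivative, even smooth functions require
  uniqueness of weak derivatives.\<close>

section \<open>Counting sign patterns of polynomials\<close>

text \<open>Polynomial functions are generated directly, without a polynomial type behind them:
  \<open>D\<close> is an upper bound for the degree, and induction over the derivation replaces
  arguments about coefficients. The set \<open>I\<close> restricts the variables that may
  occur.\<close>

inductive pdeg :: "'i set \<Rightarrow> nat \<Rightarrow> (('i \<Rightarrow> real) \<Rightarrow> real) \<Rightarrow> bool" for I where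
  const: "pdeg I D (\<lambda>_. c)"
| var: "i \<in> I \<Longrightarrow> pdeg I D f \<Longrightarrow> pdeg I (Suc D) (\<lambda>w. w i * f w)"
| add: "pdeg I D f \<Longrightarrow> pdeg I D g \<Longrightarrow> pdeg I D (\<lambda>w. f w + g w)"

lemma pdeg_mono:
  assumes "pdeg I D f" "D \<le> E"
  shows "pdeg I E f"
  using assms
proof (induction arbitrary: E)
  case (var i D f)
  then obtain E' where "E = Suc E'" "D \<le> E'" by (cases E) auto
  then show ?case using var by (auto intro: pdeg.var)
qed (auto intro: pdeg.intros)

lemma pdeg_mult:
  assumes "pdeg I D f" "pdeg I E g"
  shows "pdeg I (D + E) (\<lambda>w. f w * g w)"
  using assms
proof (induction)
  case (const D c)
  have "pdeg I E (\<lambda>w. c * g w)"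
    using const
  proof (induction)
    case (const D c')
    then show ?case by (rule pdeg.const)
  next
    case (var i D f)
    then have "pdeg I (Suc D) (\<lambda>w. w i * (c * f w))" by (intro pdeg.var)
    then show ?case by (simp add: mult.left_commute)
  next
    case (add D f g)
    then have "pdeg I D (\<lambda>w. c * f w + c * g w)" by (intro pdeg.add)
    then show ?case by (simp add: distrib_left)
  qed
  then show ?case by (rule pdeg_mono) simp
next
  case (var i D f)
  then have "pdeg I (Suc (D + E)) (\<lambda>w. w i * (f w * g w))" by (intro pdeg.var)
  then show ?case by (simp add: mult.assoc)
next
  case (add D f1 f2)
  then have "pdeg I (D + E) (\<lambda>w. f1 w * g w + f2 w * g w)" by (intro pdeg.add)
  then show ?case by (simp add: distrib_right)
qed

lemma pdeg_var: "i \<in> I \<Longrightarrow> pdeg I (Suc D) (\<lambda>w. w i)"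
  using pdeg.var[OF _ pdeg.const[of I D 1], of i] by simp

lemma pdeg_cmult: "pdeg I D f \<Longrightarrow> pdeg I D (\<lambda>w. c * f w)"
  using pdeg_mult[OF pdeg.const[of I 0 c], of D f] by simp

lemma pdeg_diff: "pdeg I D f \<Longrightarrow> pdeg I D g \<Longrightarrow> pdeg I D (\<lambda>w. f w - g w)"
  using pdeg.add[of I D f, OF _ pdeg_cmult[of I D g "-1"]] by simp

lemma pdeg_sum: "(\<And>j. j \<in> J \<Longrightarrow> pdeg I D (f j)) \<Longrightarrow> pdeg I D (\<lambda>w. \<Sum>j\<in>J. f j w)"
  by (induction J rule: infinite_finite_induct) (auto intro: pdeg.intros)

lemma pdeg_prod:
  "finite J \<Longrightarrow> (\<And>j. j \<in> J \<Longrightarrow> pdeg I D (f j)) \<Longrightarrow> pdeg I (card J * D) (\<lambda>w. \<Prod>j\<in>J. f j w)"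
proof (induction J rule: finite_induct)
  case empty
  then show ?case by (simp add: pdeg.const)
next
  case (insert j J)
  then have "pdeg I (D + card J * D) (\<lambda>w. f j w * (\<Prod>j\<in>J. f j w))" by (intro pdeg_mult) auto
  then show ?case using insert by simp
qed

lemma pdeg_cong:
  assumes "pdeg I D f" "\<And>i. i \<in> I \<Longrightarrow> w i = v i"
  shows "f w = f v"
  using assms by induction auto

lemma continuous_pdeg: "pdeg I D f \<Longrightarrow> continuous_on S f"
  by (induction rule: pdeg.induct)
    (auto intro!: continuous_on_mult continuous_on_add
      intro: continuous_on_subset[OF continuous_on_product_coordinates subset_UNIV])

text \<open>Used to see that a square of degree \<open>2 * E\<close> is beaten by a pure power of
  degree \<open>2 * E + 2\<close> on the boundary of a large box.\<close>

lemma pdeg_growth: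
  assumes "pdeg I D f"
  obtains C where "C \<ge> 0" "\<And>t w. t \<ge> 1 \<Longrightarrow> (\<And>i. i \<in> I \<Longrightarrow> \<bar>w i\<bar> \<le> t) \<Longrightarrow> \<bar>f w\<bar> \<le> C * t ^ D"
proof -
  have "\<exists>C\<ge>0. \<forall>t w. t \<ge> 1 \<longrightarrow> (\<forall>i\<in>I. \<bar>w i\<bar> \<le> t) \<longrightarrow> \<bar>f w\<bar> \<le> C * t ^ D"
    using assms
  proof induction
    case (const D c)
    have "\<bar>c\<bar> \<le> \<bar>c\<bar> * t ^ D" if "t \<ge> 1" for t
      using mult_left_mono[of 1 "t ^ D" "\<bar>c\<bar>"] one_le_power[OF that] by simp
    then show ?case by (intro exI[of _ "\<bar>c\<bar>"]) auto
  next
    case (var i D f)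
    then obtain C where C: "C \<ge> 0" "\<forall>t w. t \<ge> 1 \<longrightarrow> (\<forall>i\<in>I. \<bar>w i\<bar> \<le> t) \<longrightarrow> \<bar>f w\<bar> \<le> C * t ^ D"
      by blast
    have "\<bar>w i * f w\<bar> \<le> C * t ^ Suc D" if "t \<ge> 1" "\<forall>i\<in>I. \<bar>w i\<bar> \<le> t" for t w
    proof -
      have "\<bar>w i\<bar> * \<bar>f w\<bar> \<le> t * (C * t ^ D)"
        using that C var.hyps by (intro mult_mono) auto
      then show ?thesis by (simp add: abs_mult mult.left_commute)
    qed
    then show ?case using C by blast
  next
    case (add D f g)
    then obtain C C' where "C \<ge> 0" "\<forall>t w. t \<ge> 1 \<longrightarrow> (\<forall>i\<in>I. \<bar>w i\<bar> \<le> t) \<longrightarrow> \<bar>f w\<bar> \<le> C * t ^ D"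
      "C' \<ge> 0" "\<forall>t w. t \<ge> 1 \<longrightarrow> (\<forall>i\<in>I. \<bar>w i\<bar> \<le> t) \<longrightarrow> \<bar>g w\<bar> \<le> C' * t ^ D"
      by blast
    then show ?case
      by (intro exI[of _ "C + C'"]) (auto simp: distrib_right intro!: order.trans[OF abs_triangle_ineq] add_mono)
  qed
  then show ?thesis using that by blast
qed

text \<open>The bound \<open>D\<close> is not lowered to \<open>D - 1\<close>. In the critical point
  equations the derivative of a function of degree \<open>2 * E\<close> only has to stay below the
  exponent \<open>2 * E + 1\<close>.\<close>

lemma pdeg_partial:
  assumes "pdeg I D f"
  obtains g where "pdeg I D g"
    "\<And>w t. ((\<lambda>t. f (w(i := t))) has_real_derivative g (w(i := t))) (at t)"
proof -
  have "\<exists>g. pdeg I D g \<and> (\<forall>w t. ((\<lambda>t. f (w(i := t))) has_real_derivative g (w(i := t))) (at t))"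
    using assms
  proof induction
    case (const D c)
    show ?case by (intro exI[of _ "\<lambda>_. 0"]) (auto intro: pdeg.const)
  next
    case (var j D f)
    then obtain g where g: "pdeg I D g"
      "\<And>w t. ((\<lambda>t. f (w(i := t))) has_real_derivative g (w(i := t))) (at t)" by blast
    define h where "h = (\<lambda>w. (if i = j then 1 else 0) * f w + w j * g w)"
    have "pdeg I (Suc D) h"
      unfolding h_def using var g
      by (intro pdeg.add pdeg.var pdeg_cmult) (auto intro: pdeg_mono)
    moreover have "((\<lambda>t. (w(i := t)) j * f (w(i := t))) has_real_derivative h (w(i := t))) (at t)" for w t
    proof (cases "i = j")
      case True
      then show ?thesis
        unfolding h_def using DERIV_mult[OF DERIV_ident g(2)[of w t]] by (simp add: algebra_simps)
    next
      case False
      then show ?thesis unfolding h_def using DERIV_cmult[OF g(2)[of w t], of "w j"] by simp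
    qed
    ultimately show ?case by blast
  next
    case (add D f1 f2)
    then obtain g1 g2 where "pdeg I D g1" "pdeg I D g2"
      "\<And>w t. ((\<lambda>t. f1 (w(i := t))) has_real_derivative g1 (w(i := t))) (at t)"
      "\<And>w t. ((\<lambda>t. f2 (w(i := t))) has_real_derivative g2 (w(i := t))) (at t)" by blast
    then show ?case
      by (intro exI[of _ "\<lambda>w. g1 w + g2 w"] conjI allI pdeg.add DERIV_add)
  qed
  then show ?thesis using that by blast
qed

section \<open>A Bezout-type bound on the number of common zeros\<close>

definition mon :: "'i set \<Rightarrow> ('i \<Rightarrow> nat) \<Rightarrow> ('i \<Rightarrow> real) \<Rightarrow> real" where
  "mon I e w = (\<Prod>i\<in>I. w i ^ e i)"

lemma mon_upd:
  "finite I \<Longrightarrow> i \<in> I \<Longrightarrow> mon I (e(i := e i + r)) w = w i ^ r * mon I e w"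
  unfolding mon_def by (simp add: prod.remove[of I i] power_add)

lemma sum_upd_add:
  "finite I \<Longrightarrow> i \<in> I \<Longrightarrow> sum (e(i := e i + r)) I = sum e I + (r::nat)"
  by (simp add: sum.remove[of I i])

text \<open>The weighted sum over \<open>X\<close> is a linear functional. Unwinding the derivation
  of \<open>f\<close> moves each variable into the exponent \<open>e'\<close>, so it suffices that
  the functional kills monomials of bounded total degree.\<close>

lemma sum_pdeg_eq_0:
  assumes "finite I" "pdeg I D f"
    and "\<And>e. sum e I \<le> D + sum e' I \<Longrightarrow> (\<Sum>x\<in>X. c x * mon I e x) = 0"
  shows "(\<Sum>x\<in>X. c x * (mon I e' x * f x)) = 0"
  using assms(2,3)
proof (induction arbitrary: e')
  case (const D a)
  have "(\<Sum>x\<in>X. c x * (mon I e' x * a)) = a * (\<Sum>x\<in>X. c x * mon I e' x)"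
    by (simp add: sum_distrib_left mult_ac)
  then show ?case using const by simp
next
  case (var i D f)
  have "(\<Sum>x\<in>X. c x * (mon I (e'(i := e' i + 1)) x * f x)) = 0"
    using var sum_upd_add[OF assms(1) var(1), of e' 1] by (intro var.IH) auto
  then show ?case
    using mon_upd[OF assms(1) var(1), of e' 1] by (simp add: mult_ac)
next
  case (add D f g)
  then show ?case by (simp add: distrib_left sum.distrib)
qed

text \<open>Gaussian elimination: an equation with a nonzero coefficient at \<open>p\<close> is
  solved for the unknown at \<open>p\<close>, which leaves one equation and one unknown
  less.\<close>

lemma homogeneous_system:
  fixes a :: "'e \<Rightarrow> 'x \<Rightarrow> real"
  assumes "finite E" "finite X" "card E < card X"
  shows "\<exists>c. (\<exists>x\<in>X. c x \<noteq> 0) \<and> (\<forall>e\<in>E. (\<Sum>x\<in>X. c x * a e x) = 0)"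
  using assms
proof (induction E arbitrary: X a rule: finite_induct)
  case empty
  then have "X \<noteq> {}" by auto
  then show ?case by (intro exI[of _ "\<lambda>_. 1"]) auto
next
  case (insert e E)
  show ?case
  proof (cases "\<forall>x\<in>X. a e x = 0")
    case True
    have "\<exists>c. (\<exists>x\<in>X. c x \<noteq> 0) \<and> (\<forall>e\<in>E. (\<Sum>x\<in>X. c x * a e x) = 0)"
      using insert by (intro insert.IH) auto
    then show ?thesis using True by auto
  next
    case False
    then obtain p where p: "p \<in> X" "a e p \<noteq> 0" by auto
    define a' where "a' = (\<lambda>e' x. a e' x - a e x / a e p * a e' p)"
    have "\<exists>c. (\<exists>x\<in>X-{p}. c x \<noteq> 0) \<and> (\<forall>e\<in>E. (\<Sum>x\<in>X-{p}. c x * a' e x) = 0)"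
      using insert p by (intro insert.IH) auto
    then obtain c where c: "\<exists>x\<in>X-{p}. c x \<noteq> 0" "\<And>e. e \<in> E \<Longrightarrow> (\<Sum>x\<in>X-{p}. c x * a' e x) = 0"
      by blast
    define s where "s = (\<Sum>x\<in>X-{p}. c x * a e x) / a e p"
    define c' where "c' = c(p := - s)"
    have eq: "(\<Sum>x\<in>X. c' x * a e' x) = - s * a e' p + (\<Sum>x\<in>X-{p}. c x * a e' x)" for e'
      using p insert.prems unfolding c'_def by (subst sum.remove[of X p]) (auto intro!: sum.cong)
    have "(\<Sum>x\<in>X. c' x * a e' x) = (\<Sum>x\<in>X-{p}. c x * a' e' x)" for e'
      unfolding eq a'_def s_def
      by (simp add: right_diff_distrib sum_subtractf sum_distrib_left sum_distrib_right sum_divide_distrib mult_ac)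
    moreover have "(\<Sum>x\<in>X. c' x * a e x) = 0"
      unfolding eq s_def using p by simp
    moreover have "\<exists>x\<in>X. c' x \<noteq> 0" using c(1) unfolding c'_def by auto
    ultimately show ?thesis using c(2) by (intro exI[of _ c']) auto
  qed
qed

text \<open>A weak form of Bezout's theorem: modulo the equations every polynomial reduces to one with all
  exponents below \<open>r\<close>, so these span the functions on the solution set.\<close>

lemma card_common_zeros_le:
  assumes I: "finite I" and X: "finite X"
    and g: "\<And>i. i \<in> I \<Longrightarrow> pdeg I D (g i)" and "D < r"
    and eq: "\<And>i x. i \<in> I \<Longrightarrow> x \<in> X \<Longrightarrow> x i ^ r = g i x"
    and inj: "\<And>x y. x \<in> X \<Longrightarrow> y \<in> X \<Longrightarrow> (\<And>i. i \<in> I \<Longrightarrow> x i = y i) \<Longrightarrow> x = y"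
  shows "card X \<le> r ^ card I"
proof (rule ccontr)
  assume "\<not> card X \<le> r ^ card I"
  then have "card (PiE I (\<lambda>_. {..<r})) < card X" using I by (simp add: card_PiE)
  \<comment> \<open>There are \<open>r ^ card I\<close> monomials with all exponents below
    \<open>r\<close>. With more points than that, some nonzero functional supported on
    \<open>X\<close> kills all of them.\<close>
  then obtain c x0 where x0: "x0 \<in> X" "c x0 \<noteq> 0"
    and c: "\<And>e. e \<in> PiE I (\<lambda>_. {..<r}) \<Longrightarrow> (\<Sum>x\<in>X. c x * mon I e x) = 0"
    using homogeneous_system[of "PiE I (\<lambda>_. {..<r})" X "mon I"] finite_PiE[OF I, of "\<lambda>_. {..<r}"] X
    by auto
  \<comment> \<open>A factor \<open>x i ^ r\<close> is replaced on \<open>X\<close> by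
    \<open>g i x\<close>, of degree \<open>D < r\<close>, which lowers the total degree. Hence the
    functional kills every monomial.\<close>
  have kill: "(\<Sum>x\<in>X. c x * mon I e x) = 0" for e
  proof (induction "sum e I" arbitrary: e rule: less_induct)
    case less
    show ?case
    proof (cases "\<forall>i\<in>I. e i < r")
      case True
      then have "(\<Sum>x\<in>X. c x * mon I (restrict e I) x) = 0" by (intro c) auto
      then show ?thesis unfolding mon_def by (simp cong: prod.cong)
    next
      case False
      then obtain i where i: "i \<in> I" "e i \<ge> r" by (auto simp: not_less)
      define e' where "e' = e(i := e i - r)"
      have e: "e = e'(i := e' i + r)" using i unfolding e'_def by auto
      have s: "sum e I = sum e' I + r" by (subst e) (rule sum_upd_add[OF I i(1)])
      have m: "mon I e x = x i ^ r * mon I e' x" for x by (subst e) (rule mon_upd[OF I i(1)])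
      have "(\<Sum>x\<in>X. c x * (mon I e' x * g i x)) = 0"
        using s \<open>D < r\<close> less by (intro sum_pdeg_eq_0[OF I g[OF i(1)]]) auto
      moreover have "(\<Sum>x\<in>X. c x * mon I e x) = (\<Sum>x\<in>X. c x * (mon I e' x * g i x))"
        using eq[OF i(1)] by (intro sum.cong) (auto simp: m)
      ultimately show ?thesis by simp
    qed
  qed
  have "\<exists>i\<in>I. x i \<noteq> x0 i" if "x \<in> X - {x0}" for x using inj[of x x0] that x0 by blast
  then obtain i where i: "\<And>x. x \<in> X - {x0} \<Longrightarrow> i x \<in> I \<and> x (i x) \<noteq> x0 (i x)" by metis
  \<comment> \<open>For each other point \<open>x\<close>, one factor vanishes at \<open>x\<close>
    but not at \<open>x0\<close>, because \<open>i x\<close> is a coordinate separating the two. On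
    \<open>p\<close> the functional therefore takes the value \<open>c x0 * p x0\<close>, which is
    nonzero although all monomials are killed.\<close>
  define p where "p = (\<lambda>w. \<Prod>x\<in>X-{x0}. w (i x) - x (i x))"
  have "pdeg I (card (X-{x0}) * 1) p"
    unfolding p_def using X i
    by (intro pdeg_prod pdeg_diff) (auto intro!: pdeg.const pdeg_var[of _ _ 0, simplified])
  then have "(\<Sum>x\<in>X. c x * (mon I (\<lambda>_. 0) x * p x)) = 0"
    using kill by (intro sum_pdeg_eq_0[OF I]) auto
  moreover have "p x = 0" if "x \<in> X - {x0}" for x
    unfolding p_def using that X by (intro prod_zero) auto
  moreover have "p x0 \<noteq> 0"
    unfolding p_def using X i by (metis (no_types, lifting) eq_iff_diff_eq_0 finite_Diff prod_zero_iff)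
  ultimately show False
    using x0 X by (simp add: mon_def sum.remove[of X x0])
qed

section \<open>Counting sign cells by critical points\<close>

lemma compact_coordinate_box:
  fixes I :: "'i set" and R :: real
  shows "compact {w :: 'i \<Rightarrow> real. (\<forall>i\<in>I. \<bar>w i\<bar> \<le> R) \<and> (\<forall>i. i \<notin> I \<longrightarrow> w i = 0)}"
proof -
  \<comment> \<open>The index type may be infinite. Pinning the coordinates outside \<open>I\<close>
    to 0 makes the set a product of compact intervals and singletons.\<close>
  have "compactin (product_topology (\<lambda>i. euclidean) UNIV) (PiE UNIV (\<lambda>i. if i \<in> I then {-R..R} else {0::real}))"
    by (subst compactin_PiE) auto
  moreover have "PiE UNIV (\<lambda>i. if i \<in> I then {-R..R} else {0}) =
      {w. (\<forall>i\<in>I. \<bar>w i\<bar> \<le> R) \<and> (\<forall>i. i \<notin> I \<longrightarrow> w i = 0)}"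
    by (auto simp: PiE_def Pi_def extensional_def abs_le_iff split: if_splits)
  ultimately show ?thesis
    by (simp add: euclidean_product_topology flip: compactin_euclidean_iff)
qed

text \<open>\<open>W S\<close> is a sample point in the cell of \<open>S\<close>. The function
  \<open>Q\<close> is positive there, but nonpositive wherever some \<open>q j\<close> vanishes and
  on the boundary of a large box. Its maximizer over the compact cell is thus an interior point,
  where every partial derivative vanishes.\<close>

lemma card_sign_cells_le:
  fixes q :: "'j \<Rightarrow> ('i \<Rightarrow> real) \<Rightarrow> real"
  assumes I: "finite I" and J: "finite J" and q: "\<And>j. j \<in> J \<Longrightarrow> pdeg I D (q j)"
    and \<F>: "finite \<F>" and W: "\<And>S. S \<in> \<F> \<Longrightarrow> S = {j\<in>J. q j (W S) > 0}"
    and nz: "\<And>S j. S \<in> \<F> \<Longrightarrow> j \<in> J \<Longrightarrow> q j (W S) \<noteq> 0"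
    and W0: "\<And>S i. S \<in> \<F> \<Longrightarrow> i \<notin> I \<Longrightarrow> W S i = 0"
  shows "card \<F> \<le> (2 * card J * D + 1) ^ card I"
proof -
  define E where "E = card J * D"
  define P where "P = (\<lambda>w. \<Prod>j\<in>J. q j w)"
  have P: "pdeg I E P" unfolding E_def P_def using J q by (rule pdeg_prod)
  have P2: "pdeg I (2 * E) (\<lambda>w. P w * P w)"
    using pdeg_mult[OF P P] by (simp add: mult_2)
  \<comment> \<open>The even exponent keeps \<open>h\<close> nonnegative and exceeds the degree of
    \<open>P^2\<close>. Its derivative contributes the pure power \<open>w i ^ (2 * E + 1)\<close>,
    for which the critical point equation can be solved.\<close>
  define h where "h = (\<lambda>w::'i\<Rightarrow>real. \<Sum>i\<in>I. w i ^ (2 * E + 2))"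
  have h0: "h w \<ge> 0" for w unfolding h_def by (intro sum_nonneg zero_le_even_power) simp
  have PW: "P (W S) * P (W S) > 0" if "S \<in> \<F>" for S
    using nz[OF that] J unfolding P_def by (simp add: prod_zero_iff flip: power2_eq_square)
  \<comment> \<open>Small enough for \<open>\<delta> * h\<close> to stay strictly below
    \<open>P^2\<close> at every sample point. Adding 1 to the denominator excludes division by 0,
    and inserting 1 covers an empty family.\<close>
  define \<delta> where "\<delta> = Min (insert 1 ((\<lambda>S. P (W S) * P (W S) / (h (W S) + 1)) ` \<F>))"
  have \<delta>: "\<delta> > 0" unfolding \<delta>_def using \<F> PW h0
    by (subst Min_gr_iff) (auto intro!: divide_pos_pos add_nonneg_pos)
  define Q where "Q = (\<lambda>w. P w * P w - \<delta> * h w)"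
  have QW: "Q (W S) > 0" if "S \<in> \<F>" for S
  proof -
    have "\<delta> \<le> P (W S) * P (W S) / (h (W S) + 1)"
      unfolding \<delta>_def using \<F> that by (intro Min_le) auto
    then have "\<delta> * h (W S) + \<delta> \<le> P (W S) * P (W S)"
      using h0[of "W S"] by (simp add: pos_le_divide_eq distrib_left)
    then show ?thesis using \<delta> unfolding Q_def by simp
  qed
  obtain C where C: "C \<ge> 0"
    "\<And>t w. t \<ge> 1 \<Longrightarrow> (\<And>i. i \<in> I \<Longrightarrow> \<bar>w i\<bar> \<le> t) \<Longrightarrow> \<bar>P w * P w\<bar> \<le> C * t ^ (2 * E)"
    using pdeg_growth[OF P2] by metis
  \<comment> \<open>The term \<open>C / \<delta>\<close> makes \<open>\<delta> * h\<close> dominate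
    \<open>P^2\<close> on the faces of the box; the double sum puts all sample points inside the
    box.\<close>
  define R where "R = 1 + C / \<delta> + (\<Sum>S\<in>\<F>. \<Sum>i\<in>I. \<bar>W S i\<bar>)"
  have R: "R \<ge> 1" "R \<ge> 1 + C / \<delta>"
    unfolding R_def using C \<delta> by (auto intro!: add_nonneg_nonneg sum_nonneg)
  have WR: "\<bar>W S i\<bar> \<le> R" if "S \<in> \<F>" "i \<in> I" for S i
  proof -
    have "\<bar>W S i\<bar> \<le> (\<Sum>i\<in>I. \<bar>W S i\<bar>)" using I that by (intro member_le_sum) auto
    also have "\<dots> \<le> (\<Sum>S\<in>\<F>. \<Sum>i\<in>I. \<bar>W S i\<bar>)"
      using \<F> that by (intro member_le_sum[of S \<F> "\<lambda>S. \<Sum>i\<in>I. \<bar>W S i\<bar>"]) (auto intro: sum_nonneg)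
    finally show ?thesis unfolding R_def using C \<delta> by (smt (verit) divide_nonneg_pos)
  qed
  have Qneg: "Q w \<le> 0" if w: "\<And>i. i \<in> I \<Longrightarrow> \<bar>w i\<bar> \<le> R" and i: "i \<in> I" "\<bar>w i\<bar> = R" for w i
  proof -
    have "P w * P w \<le> C * R ^ (2 * E)" using C(2)[of R w] R w by (simp add: abs_le_iff)
    also have "C \<le> \<delta> * (1 + C / \<delta>)" using \<delta> by (simp add: distrib_left)
    also have "\<delta> * (1 + C / \<delta>) \<le> \<delta> * R ^ 2"
      using \<delta> R self_le_power[of R 2] by (intro mult_left_mono) auto
    finally have "P w * P w \<le> \<delta> * R ^ 2 * R ^ (2 * E)" using R by (simp add: mult_right_mono)
    also have "\<dots> = \<delta> * w i ^ (2 * E + 2)"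
    proof -
      have "R ^ 2 = w i ^ 2" using i(2) by (metis power2_abs)
      then show ?thesis by (simp add: power_mult power_add power2_eq_square)
    qed
    also have "\<dots> \<le> \<delta> * h w"
      unfolding h_def using \<delta> i I
      by (intro mult_left_mono member_le_sum[of i I "\<lambda>i. w i ^ (2 * E + 2)"] zero_le_even_power) auto
    finally show ?thesis unfolding Q_def by simp
  qed
  \<comment> \<open>Weak inequalities make the cell compact. They turn out to be strict at the
    maximizer, since \<open>Q > 0\<close> there forces \<open>P \<noteq> 0\<close>.\<close>
  define K where "K = (\<lambda>S. {w. (\<forall>i\<in>I. \<bar>w i\<bar> \<le> R) \<and> (\<forall>i. i \<notin> I \<longrightarrow> w i = 0)} \<inter>
      (\<Inter>j\<in>J. {w. (if j \<in> S then 1 else -1) * q j w \<ge> 0}))"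
  have cq: "continuous_on UNIV (q j)" if "j \<in> J" for j using continuous_pdeg[OF q[OF that]] .
  have cQ: "continuous_on A Q" for A
    unfolding Q_def h_def
    by (intro continuous_on_diff continuous_on_mult continuous_on_const continuous_on_sum
        continuous_on_power continuous_pdeg[OF P]
        continuous_on_subset[OF continuous_on_product_coordinates subset_UNIV])
  have "compact (K S)" for S
    unfolding K_def
    by (intro compact_Int_closed compact_coordinate_box closed_INT ballI closed_Collect_le
        continuous_on_const continuous_on_mult cq)
  moreover have WK: "W S \<in> K S" if "S \<in> \<F>" for S
  proof -
    have "j \<in> S \<longleftrightarrow> q j (W S) > 0" if "j \<in> J" for j using W[OF \<open>S \<in> \<F>\<close>] that by blast
    then show ?thesis unfolding K_def using that WR W0 by (auto simp: not_less)
  qed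
  ultimately have "\<forall>S\<in>\<F>. \<exists>z. z \<in> K S \<and> (\<forall>w\<in>K S. Q w \<le> Q z)"
    using continuous_attains_sup[OF _ _ cQ] by (metis empty_iff)
  then obtain Z where Z': "\<forall>S\<in>\<F>. Z S \<in> K S \<and> (\<forall>w\<in>K S. Q w \<le> Q (Z S))"
    by (rule bchoice[THEN exE])
  then have Z: "\<And>S. S \<in> \<F> \<Longrightarrow> Z S \<in> K S" "\<And>S w. S \<in> \<F> \<Longrightarrow> w \<in> K S \<Longrightarrow> Q w \<le> Q (Z S)"
    by blast+
  have QZ: "Q (Z S) > 0" if "S \<in> \<F>" for S using Z(2)[OF that WK[OF that]] QW[OF that] by simp
  have PZ: "P (Z S) \<noteq> 0" if "S \<in> \<F>" for S
    using QZ[OF that] \<delta> h0[of "Z S"] unfolding Q_def by (auto simp: mult_less_0_iff)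
  have nzZ: "q j (Z S) \<noteq> 0" if "S \<in> \<F>" "j \<in> J" for S j
    using PZ[OF that(1)] that J unfolding P_def by (auto simp: prod_zero_iff)
  have sgnZ: "(if j \<in> S then 1 else -1) * q j (Z S) > 0" if "S \<in> \<F>" "j \<in> J" for S j
    using Z(1)[OF that(1)] nzZ[OF that] that unfolding K_def by (auto simp: less_le split: if_splits)
  have ZR: "\<bar>Z S i\<bar> < R" if "S \<in> \<F>" "i \<in> I" for S i
    using Z(1)[OF that(1)] Qneg[of "Z S" i] QZ[OF that(1)] that unfolding K_def by force
  \<comment> \<open>At the interior maximizer the derivative of \<open>P^2\<close> in direction
    \<open>i\<close> equals that of \<open>\<delta> * h\<close>, and the latter is a multiple of the
    pure power. This is the form of system that the Bezout-type bound counts.\<close>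
  have "\<exists>g. pdeg I (2 * E) g \<and> (\<forall>S\<in>\<F>. Z S i ^ (2 * E + 1) = g (Z S))" if i: "i \<in> I" for i
  proof -
    obtain g where g: "pdeg I (2 * E) g"
      "\<And>w t. ((\<lambda>t. P (w(i := t)) * P (w(i := t))) has_real_derivative g (w(i := t))) (at t)"
      using pdeg_partial[OF P2] by blast
    have "Z S i ^ (2 * E + 1) = 1 / (\<delta> * (2 * E + 2)) * g (Z S)" if S: "S \<in> \<F>" for S
    proof -
      let ?l = "\<lambda>t. (Z S)(i := t)"
      have l: "continuous_on UNIV ?l"
      proof (rule continuous_on_coordinatewise_then_product)
        show "continuous_on UNIV (\<lambda>t. ?l t k)" for k by (cases "k = i") auto
      qed
      have "((\<lambda>t. h (?l t)) has_real_derivative (2 * E + 2) * Z S i ^ (2 * E + 1)) (at (Z S i))"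
      proof -
        have "((\<lambda>t. t ^ (2 * E + 2) + (\<Sum>k\<in>I-{i}. Z S k ^ (2 * E + 2)))
            has_real_derivative (2 * E + 2) * Z S i ^ (2 * E + 1)) (at (Z S i))"
          using DERIV_add[OF DERIV_pow[of "2 * E + 2" "Z S i"] DERIV_const] by simp
        moreover have "h (?l t) = t ^ (2 * E + 2) + (\<Sum>k\<in>I-{i}. Z S k ^ (2 * E + 2))" for t
          unfolding h_def using I i by (subst sum.remove[of I i]) auto
        ultimately show ?thesis by simp
      qed
      then have D: "((\<lambda>t. Q (?l t)) has_real_derivative
          g (Z S) - \<delta> * ((2 * E + 2) * Z S i ^ (2 * E + 1))) (at (Z S i))"
        unfolding Q_def using g(2)[of "Z S" "Z S i"] by (intro DERIV_diff DERIV_cmult) auto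
      have "\<forall>\<^sub>F t in at (Z S i). ?l t \<in> K S"
      proof -
        have 1: "\<forall>\<^sub>F t in at (Z S i). \<bar>t\<bar> < R"
          using ZR[OF S i] by (intro order_tendstoD(2)[of _ "\<bar>Z S i\<bar>"] tendsto_intros)
        have 2: "\<forall>\<^sub>F t in at (Z S i). \<forall>j\<in>J. (if j \<in> S then 1 else -1) * q j (?l t) > 0"
        proof (intro eventually_ball_finite J ballI)
          fix j assume j: "j \<in> J"
          have "continuous_on UNIV (\<lambda>t. (if j \<in> S then 1 else -1) * q j (?l t))"
            by (rule continuous_on_mult[OF continuous_on_const continuous_on_compose2[OF cq[OF j] l]]) auto
          then have "isCont (\<lambda>t. (if j \<in> S then 1 else -1) * q j (?l t)) (Z S i)"
            by (simp only: continuous_on_eq_continuous_at open_UNIV) simp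
          then show "\<forall>\<^sub>F t in at (Z S i). (if j \<in> S then 1 else -1) * q j (?l t) > 0"
            using sgnZ[OF S j] by (intro order_tendstoD(1)[of _ "(if j \<in> S then 1 else -1) * q j (Z S)"])
              (auto simp: isCont_def)
        qed
        show ?thesis
          using eventually_conj[OF 1 2]
        proof eventually_elim
          case (elim t)
          then show ?case using Z(1)[OF S] i unfolding K_def by (auto intro: less_imp_le)
        qed
      qed
      then obtain d where d: "d > 0" "\<And>t. t \<noteq> Z S i \<Longrightarrow> dist t (Z S i) < d \<Longrightarrow> ?l t \<in> K S"
        unfolding eventually_at by auto
      have "Q (?l t) \<le> Q (?l (Z S i))" if "\<bar>Z S i - t\<bar> < d" for t
        using d(2)[of t] Z(2)[OF S] that by (cases "t = Z S i") (auto simp: dist_real_def abs_minus_commute)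
      then have "g (Z S) - \<delta> * ((2 * E + 2) * Z S i ^ (2 * E + 1)) = 0"
        using DERIV_local_max[OF D d(1)] by auto
      then have "g (Z S) = (\<delta> * (2 * E + 2)) * Z S i ^ (2 * E + 1)" by (simp add: mult.assoc)
      moreover have "\<delta> * (2 * E + 2) \<noteq> 0" using \<delta> by simp
      ultimately show ?thesis by simp
    qed
    then show ?thesis using pdeg_cmult[OF g(1), of "1 / (\<delta> * (2 * E + 2))"] by blast
  qed
  then obtain G where G: "\<And>i. i \<in> I \<Longrightarrow> pdeg I (2 * E) (G i)"
    "\<And>i S. i \<in> I \<Longrightarrow> S \<in> \<F> \<Longrightarrow> Z S i ^ (2 * E + 1) = G i (Z S)" by metis
  have SZ: "S = {j\<in>J. q j (Z S) > 0}" if "S \<in> \<F>" for S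
  proof -
    have "S \<subseteq> J" using W[OF that] by auto
    moreover have "j \<in> S \<longleftrightarrow> q j (Z S) > 0" if "j \<in> J" for j
      using sgnZ[OF \<open>S \<in> \<F>\<close> that] by (cases "j \<in> S") auto
    ultimately show ?thesis by blast
  qed
  have "card (Z ` \<F>) \<le> (2 * E + 1) ^ card I"
  proof (rule card_common_zeros_le[OF I _ G(1)])
    fix x y assume xy: "x \<in> Z ` \<F>" "y \<in> Z ` \<F>" and eq: "\<And>i. i \<in> I \<Longrightarrow> x i = y i"
    have "x i = 0 \<and> y i = 0" if "i \<notin> I" for i using xy Z(1) that unfolding K_def by auto
    then show "x = y" using eq by (metis ext)
  qed (use \<F> G in auto)
  moreover have "inj_on Z \<F>"
  proof (rule inj_onI)
    fix S T assume ST: "S \<in> \<F>" "T \<in> \<F>" "Z S = Z T"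
    have "S = {j\<in>J. q j (Z S) > 0}" by (rule SZ[OF ST(1)])
    also have "\<dots> = {j\<in>J. q j (Z T) > 0}" by (simp only: ST(3))
    also have "\<dots> = T" by (rule SZ[OF ST(2), symmetric])
    finally show "S = T" .
  qed
  ultimately show ?thesis unfolding E_def by (simp add: card_image mult.assoc)
qed

text \<open>Here the polynomials may vanish at the sample points. Subtracting a positive
  \<open>\<eta>\<close> below all positive sampled values keeps those positive and makes the others
  negative, so the patterns survive and no value is 0.\<close>

lemma card_pos_patterns_le:
  fixes p :: "'j \<Rightarrow> ('i \<Rightarrow> real) \<Rightarrow> real"
  assumes I: "finite I" and J: "finite J" and p: "\<And>j. j \<in> J \<Longrightarrow> pdeg I D (p j)"
  shows "card {{j\<in>J. p j w > 0} |w. True} \<le> (2 * card J * D + 1) ^ card I"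
proof -
  define \<F> where "\<F> = {{j\<in>J. p j w > 0} |w. True}"
  have \<F>: "finite \<F>" unfolding \<F>_def by (rule finite_subset[of _ "Pow J"]) (use J in auto)
  have "\<exists>w. S = {j\<in>J. p j w > 0} \<and> (\<forall>i. i \<notin> I \<longrightarrow> w i = 0)" if "S \<in> \<F>" for S
  proof -
    obtain w where w: "S = {j\<in>J. p j w > 0}" using \<open>S \<in> \<F>\<close> unfolding \<F>_def by auto
    have "p j (\<lambda>i. if i \<in> I then w i else 0) = p j w" if "j \<in> J" for j
      by (rule pdeg_cong[OF p[OF that]]) auto
    then show ?thesis using w by (intro exI[of _ "\<lambda>i. if i \<in> I then w i else 0"]) auto
  qed
  then obtain W where W: "\<And>S. S \<in> \<F> \<Longrightarrow> S = {j\<in>J. p j (W S) > 0}" "\<And>S i. S \<in> \<F> \<Longrightarrow> i \<notin> I \<Longrightarrow> W S i = 0"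
    by metis
  define V where "V = (\<lambda>(S, j). p j (W S)) ` (\<F> \<times> J) \<inter> {0<..}"
  have V: "finite V" unfolding V_def using \<F> J by auto
  define \<eta> where "\<eta> = Min (insert 1 V) / 2"
  have "Min (insert 1 V) > 0" using V by (subst Min_gr_iff) (auto simp: V_def)
  then have \<eta>: "\<eta> > 0" "\<eta> < Min (insert 1 V)" unfolding \<eta>_def by auto
  have \<eta>V: "\<eta> < v" if "v \<in> V" for v
    using Min_le[of "insert 1 V" v] V that \<eta>(2) by (simp del: Min_insert)
  have pV: "p j (W S) \<in> V" if "S \<in> \<F>" "j \<in> J" "p j (W S) > 0" for S j
    unfolding V_def using that by (auto intro!: image_eqI[of _ _ "(S, j)"])
  have iff: "p j (W S) - \<eta> > 0 \<longleftrightarrow> p j (W S) > 0" if "S \<in> \<F>" "j \<in> J" for S j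
    using \<eta>V[OF pV[OF that]] \<eta>(1) by linarith
  have "card \<F> \<le> (2 * card J * D + 1) ^ card I"
  proof (rule card_sign_cells_le[OF I J _ \<F>])
    show "pdeg I D (\<lambda>w. p j w - \<eta>)" if "j \<in> J" for j
      using p[OF that] by (intro pdeg_diff pdeg.const)
    show "S = {j\<in>J. p j (W S) - \<eta> > 0}" if "S \<in> \<F>" for S
      using iff[OF that] W(1)[OF that] by blast
    show "p j (W S) - \<eta> \<noteq> 0" if "S \<in> \<F>" "j \<in> J" for S j
      using iff[OF that] \<eta>V[OF pV[OF that]] \<eta>(1) by linarith
    show "W S i = 0" if "S \<in> \<F>" "i \<notin> I" for S i using W(2)[OF that] .
  qed
  then show ?thesis unfolding \<F>_def .
qed

section \<open>Sign patterns of ReLU circuits\<close>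

text \<open>A network with skip connections is flattened into a circuit: position \<open>q\<close> of the concatenated
  layers carries \<open>neuron d w x q\<close>, positions below \<open>d\<close> are the inputs, and the diagonal weight
  \<open>w (q, q)\<close> is the bias of position \<open>q\<close>.\<close>

fun neuron :: "nat \<Rightarrow> (nat \<times> nat \<Rightarrow> real) \<Rightarrow> (nat \<Rightarrow> real) \<Rightarrow> nat \<Rightarrow> real" where
  "neuron d w x q = (if q < d then x q
     else relu ((\<Sum>q'\<in>{..<q}. w (q, q') * neuron d w x q') + w (q, q)))"

declare neuron.simps[simp del]

definition preact :: "nat \<Rightarrow> (nat \<times> nat \<Rightarrow> real) \<Rightarrow> (nat \<Rightarrow> real) \<Rightarrow> nat \<Rightarrow> real" where
  "preact d w x q = (\<Sum>q'<q. w (q, q') * neuron d w x q') + w (q, q)"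

lemma neuron_eq: "neuron d w x q = (if q < d then x q else relu (preact d w x q))"
  unfolding preact_def by (rule neuron.simps)

text \<open>The value at \<open>q\<close> when exactly the positions in \<open>s\<close> are taken to be active and all weights outside
  \<open>I\<close> to vanish. Unlike \<open>neuron\<close>, this is a polynomial in the weights.\<close>

fun gated :: "(nat \<times> nat) set \<Rightarrow> nat \<Rightarrow> nat set \<Rightarrow> (nat \<Rightarrow> real) \<Rightarrow> nat \<Rightarrow> (nat \<times> nat \<Rightarrow> real) \<Rightarrow> real" where
  "gated I d s x q = (if q < d then (\<lambda>w. x q) else if q \<in> s then
     (\<lambda>w. (\<Sum>q'\<in>{..<q}. (if (q, q') \<in> I then w (q, q') * gated I d s x q' w else 0))
       + (if (q, q) \<in> I then w (q, q) else 0)) else (\<lambda>w. 0))"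

declare gated.simps[simp del]

definition gated_preact ::
    "(nat \<times> nat) set \<Rightarrow> nat \<Rightarrow> nat set \<Rightarrow> (nat \<Rightarrow> real) \<Rightarrow> nat \<Rightarrow> (nat \<times> nat \<Rightarrow> real) \<Rightarrow> real" where
  "gated_preact I d s x q w =
     (\<Sum>q'<q. (if (q, q') \<in> I then w (q, q') * gated I d s x q' w else 0))
       + (if (q, q) \<in> I then w (q, q) else 0)"

lemma gated_eq:
  "gated I d s x q w = (if q < d then x q else if q \<in> s then gated_preact I d s x q w else 0)"
  unfolding gated_preact_def by (subst gated.simps) simp

lemma pdeg_if_var_mult:
  "pdeg I D f \<Longrightarrow> pdeg I (Suc D) (\<lambda>w. if e \<in> I then w e * f w else 0)"
  by (cases "e \<in> I") (auto intro: pdeg.intros)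

lemma pdeg_gated_preact_aux:
  assumes "\<And>q'. q' < q \<Longrightarrow> pdeg I D (gated I d s x q')"
  shows "pdeg I (Suc D) (gated_preact I d s x q)"
proof -
  have "pdeg I (Suc D) (\<lambda>w. (\<Sum>q'<q. (if (q, q') \<in> I then w (q, q') * gated I d s x q' w else 0))
       + (if (q, q) \<in> I then w (q, q) * 1 else 0))"
    using assms by (intro pdeg.add pdeg_sum pdeg_if_var_mult pdeg.const) auto
  then show ?thesis unfolding gated_preact_def by (simp cong: if_cong)
qed

text \<open>Each active position multiplies earlier values by one more weight, so the degree is
  bounded by the number of gates up to \<open>q\<close>, whatever the depth.\<close>

lemma pdeg_gated:
  assumes "finite s"
  shows "pdeg I (card (s \<inter> {..q})) (gated I d s x q)"
proof (induction q rule: less_induct)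
  case (less q)
  consider "q < d" | "\<not> q < d" "q \<notin> s" | "\<not> q < d" "q \<in> s" by blast
  then show ?case
  proof cases
    case 1
    then show ?thesis by (subst gated.simps) (simp add: pdeg.const)
  next
    case 2
    then show ?thesis by (subst gated.simps) (simp add: pdeg.const)
  next
    case 3
    have "s \<inter> {..q} = insert q (s \<inter> {..<q})" using 3 by auto
    then have c: "card (s \<inter> {..q}) = Suc (card (s \<inter> {..<q}))" using assms by simp
    have "pdeg I (Suc (card (s \<inter> {..<q}))) (gated_preact I d s x q)"
    proof (rule pdeg_gated_preact_aux)
      fix q' assume "q' < q"
      then show "pdeg I (card (s \<inter> {..<q})) (gated I d s x q')"
        using assms by (intro pdeg_mono[OF less] card_mono) auto
    qed
    moreover have "gated I d s x q = gated_preact I d s x q"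
      using 3 by (auto simp: fun_eq_iff gated_eq)
    ultimately show ?thesis by (simp add: c)
  qed
qed

lemma pdeg_gated_preact:
  assumes "finite s"
  shows "pdeg I (Suc (card s)) (gated_preact I d s x q)"
  using assms by (intro pdeg_gated_preact_aux pdeg_mono[OF pdeg_gated] card_mono) auto

lemma gated_preact_eq:
  assumes "\<And>q'. q' < q \<Longrightarrow> gated I d s x q' w = neuron d w x q'"
    and "\<And>e. e \<notin> I \<Longrightarrow> w e = 0"
  shows "gated_preact I d s x q w = preact d w x q"
  unfolding gated_preact_def preact_def using assms by (auto intro!: arg_cong2[of _ _ _ _ "(+)"] sum.cong)

text \<open>The condition on \<open>s\<close> is imposed at \<open>q\<close> only under the equality
  of both preactivations. The induction provides that equality from the smaller positions, so the
  condition applies to gate sets that are known only through their own gated signs.\<close>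

lemma gated_eq_neuron:
  assumes w: "\<And>e. e \<notin> I \<Longrightarrow> w e = 0"
    and s: "\<And>q. q \<ge> d \<Longrightarrow> gated_preact I d s x q w = preact d w x q \<Longrightarrow> q \<in> s \<longleftrightarrow> preact d w x q > 0"
  shows "gated I d s x q w = neuron d w x q"
proof (induction q rule: less_induct)
  case (less q)
  then have "gated_preact I d s x q w = preact d w x q" using w by (intro gated_preact_eq) auto
  then show ?case using s[of q] by (auto simp: gated_eq neuron_eq relu_def)
qed

lemma preact_outside:
  assumes "\<And>e. e \<notin> I \<Longrightarrow> w e = 0" "q \<notin> fst ` I"
  shows "preact d w x q = 0"
proof -
  have "(q, q') \<notin> I" for q' using assms(2) by force
  then show ?thesis unfolding preact_def using assms(1) by simp
qed

text \<open>Restricted to positions that receive at least one weight; all others have preactivation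
  0 and are inactive. This leaves at most \<open>card I\<close> candidates for gates.\<close>

definition active :: "(nat \<times> nat) set \<Rightarrow> nat \<Rightarrow> (nat \<times> nat \<Rightarrow> real) \<Rightarrow> (nat \<Rightarrow> real) \<Rightarrow> nat set" where
  "active I d w x = {q\<in>fst ` I. q \<ge> d \<and> preact d w x q > 0}"

lemma gated_preact_active:
  assumes "\<And>e. e \<notin> I \<Longrightarrow> w e = 0"
  shows "gated_preact I d (active I d w x) x q w = preact d w x q"
proof -
  have "q \<in> active I d w x \<longleftrightarrow> preact d w x q > 0" if "q \<ge> d" for q
    using that preact_outside[of I w q d x, OF assms] unfolding active_def by force
  then show ?thesis using assms by (intro gated_preact_eq gated_eq_neuron) auto
qed

text \<open>Self-consistency characterizes the active set: position by position, the gates of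
  \<open>s\<close> agree with the true signs, because the gated values below are already the true
  ones. Equal signs of gated polynomials hence carry an active set from one weight vector to
  another.\<close>

lemma active_unique:
  assumes w: "\<And>e. e \<notin> I \<Longrightarrow> w e = 0"
    and s: "s = {q\<in>fst ` I. q \<ge> d \<and> gated_preact I d s x q w > 0}"
  shows "s = active I d w x"
proof -
  have iff: "q \<in> s \<longleftrightarrow> q \<in> fst ` I \<and> q \<ge> d \<and> gated_preact I d s x q w > 0" for q
    by (subst (1) s) (rule mem_Collect_eq)
  have "q \<in> s \<longleftrightarrow> preact d w x q > 0"
    if "q \<ge> d" "gated_preact I d s x q w = preact d w x q" for q
    using that preact_outside[of I w q d x, OF w] by (cases "q \<in> fst ` I") (auto simp only: iff)
  then have "gated_preact I d s x q w = preact d w x q" for q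
    using w by (intro gated_preact_eq gated_eq_neuron) auto
  then show ?thesis unfolding active_def using iff by auto
qed

text \<open>The count of polynomials: at most \<open>2 * N\<close> inputs, \<open>M\<close>
  positions and \<open>2 ^ M\<close> gate sets decide the activity, and \<open>N * 4 ^ M\<close>
  differences, one for each pair of gate sets, compare increments with \<open>\<theta>\<close>. All
  of them have degree at most \<open>M + 1\<close>.\<close>

lemma card_circuit_patterns:
  fixes x y :: "'p \<Rightarrow> nat \<Rightarrow> real"
  assumes I: "finite I" and G: "finite G"
  defines "M \<equiv> card I" and "N \<equiv> card G"
  shows "card {{p\<in>G. preact d w (x p) q - preact d w (y p) q > \<theta>} |w. \<forall>e. e \<notin> I \<longrightarrow> w e = 0}
    \<le> (2 * (N * (2 * M * 2 ^ M + 4 ^ M)) * (M + 1) + 1) ^ M"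
proof -
  define Q where "Q = fst ` I"
  have Q: "finite Q" "card Q \<le> M" unfolding Q_def M_def using I by (auto intro: card_image_le)
  have PQ: "card (Pow Q) \<le> 2 ^ M" using Q by (simp add: card_Pow power_increasing)
  define Z where "Z = x ` G \<union> y ` G"
  have Z: "finite Z" "card Z \<le> 2 * N" unfolding Z_def N_def
    using G card_Un_le[of "x ` G" "y ` G"] card_image_le[of G x] card_image_le[of G y] by auto
  define J where "J = (Z \<times> Q \<times> Pow Q) <+> (G \<times> Pow Q \<times> Pow Q)"
  have J: "finite J" unfolding J_def using Q Z G by auto
  have "card J = card Z * (card Q * card (Pow Q)) + N * (card (Pow Q) * card (Pow Q))"
    unfolding J_def N_def using Q Z G by (simp add: card_Plus card_cartesian_product)
  also have "\<dots> \<le> (2 * N) * (M * 2 ^ M) + N * (2 ^ M * 2 ^ M)"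
    using Q Z PQ by (intro add_mono mult_le_mono) auto
  also have "\<dots> = N * (2 * M * 2 ^ M + 4 ^ M)"
    by (simp add: algebra_simps flip: power_mult_distrib)
  finally have cJ: "card J \<le> N * (2 * M * 2 ^ M + 4 ^ M)" .
  define p where "p = (\<lambda>j. case j of
      Inl (z, q', s) \<Rightarrow> gated_preact I d s z q'
    | Inr (p, s, s') \<Rightarrow> (\<lambda>w. gated_preact I d s (x p) q w - gated_preact I d s' (y p) q w - \<theta>))"
  have gp: "pdeg I (M + 1) (gated_preact I d s z q)" if "s \<subseteq> Q" for s z q
    using that Q finite_subset[OF that] card_mono[OF Q(1) that]
    by (intro pdeg_mono[OF pdeg_gated_preact]) auto
  have pd: "pdeg I (M + 1) (p j)" if "j \<in> J" for j
    using that unfolding J_def p_def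
    by (auto intro!: gp[simplified] pdeg_diff pdeg.const split: sum.splits prod.splits)
  define pat where "pat = (\<lambda>w. {j\<in>J. p j w > 0})"
  define out where "out = (\<lambda>w. {p\<in>G. preact d w (x p) q - preact d w (y p) q > \<theta>})"
  define V where "V = {w :: nat \<times> nat \<Rightarrow> real. \<forall>e. e \<notin> I \<longrightarrow> w e = 0}"
  have pat_out: "out v = out w" if "v \<in> V" "w \<in> V" "pat v = pat w" for v w
  proof -
    have v: "\<And>e. e \<notin> I \<Longrightarrow> v e = 0" and w: "\<And>e. e \<notin> I \<Longrightarrow> w e = 0"
      using that unfolding V_def by auto
    have gv: "gated_preact I d (active I d v z) z q v = preact d v z q"
    and gw: "gated_preact I d (active I d w z) z q w = preact d w z q" for z q
      using v w by (auto intro: gated_preact_active)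
    have sgn: "p j v > 0 \<longleftrightarrow> p j w > 0" if "j \<in> J" for j
      using \<open>pat v = pat w\<close> that unfolding pat_def by blast
    have sub: "active I d u z \<subseteq> Q" for u z unfolding active_def Q_def by auto
    \<comment> \<open>The signs say that the active set for \<open>v\<close> satisfies the
      self-consistency equation for \<open>w\<close>, so uniqueness identifies it with the active
      set for \<open>w\<close>.\<close>
    have act: "active I d v z = active I d w z" if "z \<in> Z" for z
    proof (rule active_unique[OF w])
      let ?s = "active I d v z"
      have "gated_preact I d ?s z q v > 0 \<longleftrightarrow> gated_preact I d ?s z q w > 0" if "q \<in> Q" for q
        using sgn[of "Inl (z, q, ?s)"] that \<open>z \<in> Z\<close> sub unfolding J_def p_def by (simp add: InlI)
      then have "{q\<in>fst ` I. q \<ge> d \<and> preact d v z q > 0} =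
          {q\<in>fst ` I. q \<ge> d \<and> gated_preact I d ?s z q w > 0}"
        using gv unfolding Q_def by auto
      then show "?s = {q\<in>fst ` I. q \<ge> d \<and> gated_preact I d ?s z q w > 0}"
        by (subst (1) active_def)
    qed
    have "preact d v (x p) q - preact d v (y p) q > \<theta> \<longleftrightarrow> preact d w (x p) q - preact d w (y p) q > \<theta>"
      if "p \<in> G" for p
    proof -
      have Zp: "x p \<in> Z" "y p \<in> Z" using that unfolding Z_def by auto
      have "Inr (p, active I d v (x p), active I d v (y p)) \<in> J"
        unfolding J_def using that sub by auto
      from sgn[OF this] show ?thesis
        using gv[of "x p" q] gv[of "y p" q] gw act[OF Zp(1)] act[OF Zp(2)]
        unfolding p_def by simp
    qed
    then show ?thesis unfolding out_def by blast
  qed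
  have fin: "finite (range pat)"
    by (rule finite_subset[of _ "Pow J"]) (use J in \<open>auto simp: pat_def\<close>)
  have "out ` V \<subseteq> (\<lambda>R. out (SOME w. w \<in> V \<and> pat w = R)) ` range pat"
  proof (intro image_subsetI)
    fix w assume "w \<in> V"
    then have "(SOME v. v \<in> V \<and> pat v = pat w) \<in> V \<and> pat (SOME v. v \<in> V \<and> pat v = pat w) = pat w"
      by (intro someI[of "\<lambda>v. v \<in> V \<and> pat v = pat w" w]) auto
    then have "out (SOME v. v \<in> V \<and> pat v = pat w) = out w" using \<open>w \<in> V\<close> by (intro pat_out) auto
    then show "out w \<in> (\<lambda>R. out (SOME w. w \<in> V \<and> pat w = R)) ` range pat" by auto
  qed
  then have "card (out ` V) \<le> card ((\<lambda>R. out (SOME w. w \<in> V \<and> pat w = R)) ` range pat)"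
    by (rule card_mono[OF finite_imageI[OF fin]])
  also have "\<dots> \<le> card (range pat)" by (rule card_image_le[OF fin])
  also have "range pat = {{j\<in>J. p j w > 0} |w. True}" unfolding pat_def by auto
  also have "card \<dots> \<le> (2 * card J * (M + 1) + 1) ^ card I"
    using I J pd by (rule card_pos_patterns_le)
  also have "\<dots> \<le> (2 * (N * (2 * M * 2 ^ M + 4 ^ M)) * (M + 1) + 1) ^ M"
    unfolding M_def[symmetric] using cJ by (intro power_mono add_right_mono mult_le_mono) auto
  finally show ?thesis
    unfolding out_def V_def by (simp add: setcompr_eq_image)
qed

text \<open>The base is at most \<open>N * 2 ^ (6 * M)\<close>: the powers \<open>4 ^ M\<close> and
  \<open>2 ^ M\<close> combine to \<open>8 ^ M\<close>, and the remaining constants fit into another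
  \<open>8 ^ M\<close>. Comparing exponents gives \<open>N\<close> at most
  \<open>M * (log N + 6 * M)\<close>, in which the logarithm is the minor term.\<close>

lemma quadratic_shatter_bound:
  fixes M N :: nat
  assumes "2 ^ N \<le> (2 * (N * (2 * M * 2 ^ M + 4 ^ M)) * (M + 1) + 1) ^ M"
  shows "N \<le> 25 * M\<^sup>2"
proof (cases "M = 0 \<or> N = 0")
  case True
  then show ?thesis using assms one_less_power[of "2::nat" N] by (cases "N = 0") auto
next
  case False
  then have M: "M \<ge> 1" and N: "N \<ge> 1" by auto
  have pow: "k + 1 \<le> 2 ^ k" for k :: nat by (induction k) auto
  have "2 * M \<le> 2 ^ M" using pow[of "M - 1"] M by (cases M) auto
  then have "2 * M * 2 ^ M + 4 ^ M \<le> 2 ^ M * 2 ^ M + (4 ^ M :: nat)" by (intro add_mono mult_le_mono) auto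
  also have "\<dots> = 2 * 4 ^ M" by (simp flip: power_mult_distrib)
  finally have "2 * (N * (2 * M * 2 ^ M + 4 ^ M)) * (M + 1) + 1 \<le> 2 * (N * (2 * 4 ^ M)) * 2 ^ M + 1"
    using pow[of M] by (intro add_right_mono mult_le_mono) auto
  also have "2 * (N * (2 * 4 ^ M)) * 2 ^ M = 4 * N * (8 ^ M :: nat)"
    by (simp add: algebra_simps flip: power_mult_distrib)
  also have "4 * N * (8 ^ M :: nat) + 1 \<le> N * 8 ^ M * 8" using N by simp
  also have "\<dots> \<le> N * 8 ^ M * 8 ^ M" using M self_le_power[of "8::nat" M] by (intro mult_le_mono) auto
  also have "\<dots> = N * 2 ^ (6 * M)" by (simp add: power_mult mult.assoc flip: power_mult_distrib)
  finally have base: "2 * (N * (2 * M * 2 ^ M + 4 ^ M)) * (M + 1) + 1 \<le> N * 2 ^ (6 * M)" .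
  \<comment> \<open>The integer root replaces the logarithm via \<open>N \<le> 2 ^ (2 * s)\<close>.
    The resulting quadratic inequality forces \<open>s \<le> 4 * M\<close>, and
    \<open>N < (s + 1)^2 \<le> (5 * M)^2\<close> is the origin of 25.\<close>
  define s where "s = floor_sqrt N"
  have s: "s\<^sup>2 \<le> N" "N < (Suc s)\<^sup>2" unfolding s_def by (auto intro: Suc_floor_sqrt_power2_gt)
  have "(Suc s)\<^sup>2 \<le> (2 ^ s)\<^sup>2" by (rule power_mono) (use pow[of s] in auto)
  then have "N \<le> (2 ^ s)\<^sup>2" using s(2) by linarith
  then have "N * 2 ^ (6 * M) \<le> 2 ^ (2 * s + 6 * M)"
    by (simp add: power_add power_mult mult.commute[of 2 s])
  then have "2 * (N * (2 * M * 2 ^ M + 4 ^ M)) * (M + 1) + 1 \<le> 2 ^ (2 * s + 6 * M)"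
    using base by linarith
  then have "(2::nat) ^ N \<le> (2 ^ (2 * s + 6 * M)) ^ M"
    using assms by (meson le_trans power_mono zero_le)
  then have "(2::nat) ^ N \<le> 2 ^ ((2 * s + 6 * M) * M)" by (simp add: power_mult)
  then have "N \<le> (2 * s + 6 * M) * M" by simp
  then have le: "s * s \<le> 2 * (M * s) + 6 * (M * M)" using s(1) by (simp add: power2_eq_square algebra_simps)
  have "s \<le> 4 * M"
  proof (rule ccontr)
    assume "\<not> s \<le> 4 * M"
    then have "(4 * M) * s < s * s" "M * (4 * M) \<le> M * s"
      by (auto intro: mult_strict_right_mono mult_le_mono2)
    then show False using le by linarith
  qed
  then have "Suc s \<le> 5 * M" using M by simp
  then have "(Suc s)\<^sup>2 \<le> (5 * M)\<^sup>2" by (rule power_mono) simp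
  then show ?thesis using s(2) by (simp add: power_mult_distrib)
qed

section \<open>Flattening networks\<close>

fun wf_layers :: "nat \<Rightarrow> network \<Rightarrow> bool" where
  "wf_layers r [] \<longleftrightarrow> True"
| "wf_layers r ((A, b) # \<Phi>) \<longleftrightarrow> A \<in> carrier_mat (dim_vec b) r \<and> wf_layers (r + dim_vec b) \<Phi>"

text \<open>The offset \<open>r\<close> counts the positions before the current layer. Matrix
  columns address only these, so the diagonal is free for the biases and distinct network entries
  get distinct indices.\<close>

fun flat :: "nat \<Rightarrow> network \<Rightarrow> nat \<times> nat \<Rightarrow> real" where
  "flat r [] e = 0"
| "flat r ((A, b) # \<Phi>) (q, q') =
    (if q < r then 0
     else if q < r + dim_vec b then
       (if q' < r then A $$ (q - r, q') else if q' = q then vec_index b (q - r) else 0)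
     else flat (r + dim_vec b) \<Phi> (q, q'))"

text \<open>The first position of the last layer; with one-dimensional output it is the only
  one.\<close>

definition out_pos :: "nat \<Rightarrow> network \<Rightarrow> nat" where
  "out_pos r \<Phi> = r + (\<Sum>(A, b)\<leftarrow>butlast \<Phi>. dim_vec b)"

lemma wf_layersI:
  assumes "\<And>l. l < length \<Phi> \<Longrightarrow>
    fst (\<Phi> ! l) \<in> carrier_mat (dim_vec (snd (\<Phi> ! l))) (r + (\<Sum>k<l. dim_vec (snd (\<Phi> ! k))))"
  shows "wf_layers r \<Phi>"
  using assms
proof (induction r \<Phi> rule: wf_layers.induct)
  case (2 r A b \<Phi>)
  have "wf_layers (r + dim_vec b) \<Phi>"
  proof (rule 2(1))
    fix l assume "l < length \<Phi>"
    then show "fst (\<Phi> ! l) \<in> carrier_mat (dim_vec (snd (\<Phi> ! l)))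
        (r + dim_vec b + (\<Sum>k<l. dim_vec (snd (\<Phi> ! k))))"
      using 2(2)[of "Suc l"] by (simp add: sum.lessThan_Suc_shift add.assoc del: sum.lessThan_Suc)
  qed
  then show ?case using 2(2)[of 0] by simp
qed simp

lemma wf_layers_network:
  assumes "is_network d \<Phi>"
  shows "wf_layers d \<Phi>"
proof (rule wf_layersI)
  fix l assume l: "l < length \<Phi>"
  have "(\<Sum>k<Suc l. layer_size d \<Phi> k) = d + (\<Sum>k<l. dim_vec (snd (\<Phi> ! k)))"
    by (simp add: sum.lessThan_Suc_shift layer_size_def del: sum.lessThan_Suc)
  moreover have "Suc l \<in> {1..length \<Phi>}" using l by auto
  then have "fst (\<Phi> ! (Suc l - 1)) \<in> carrier_mat (layer_size d \<Phi> (Suc l)) (\<Sum>k<Suc l. layer_size d \<Phi> k)"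
    using assms unfolding is_network_def by blast
  ultimately show "fst (\<Phi> ! l) \<in> carrier_mat (dim_vec (snd (\<Phi> ! l))) (d + (\<Sum>k<l. dim_vec (snd (\<Phi> ! k))))"
    by (simp add: layer_size_def)
qed

lemma card_support_flat:
  assumes "wf_layers r \<Phi>"
  shows "finite {e. flat r \<Phi> e \<noteq> 0} \<and> card {e. flat r \<Phi> e \<noteq> 0} \<le> num_weights \<Phi>"
  using assms
proof (induction r \<Phi> rule: wf_layers.induct)
  case (1 r)
  then show ?case by simp
next
  case (2 r A b \<Phi>)
  define SA where "SA = {(i, j). i < dim_row A \<and> j < dim_col A \<and> A $$ (i, j) \<noteq> 0}"
  define Sb where "Sb = {i. i < dim_vec b \<and> vec_index b i \<noteq> 0}"
  define T where "T = {e. flat (r + dim_vec b) \<Phi> e \<noteq> 0}"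
  have A: "dim_row A = dim_vec b" "dim_col A = r" using 2 by auto
  have fin: "finite SA" "finite Sb"
    unfolding SA_def Sb_def
    by (auto intro: finite_subset[of _ "{..<dim_row A} \<times> {..<dim_col A}"])
  have T: "finite T" "card T \<le> num_weights \<Phi>" unfolding T_def using 2 by auto
  have sub: "{e. flat r ((A, b) # \<Phi>) e \<noteq> 0} \<subseteq>
      (\<lambda>(i, j). (r + i, j)) ` SA \<union> (\<lambda>i. (r + i, r + i)) ` Sb \<union> T" (is "?L \<subseteq> ?U")
  proof
    fix e assume e: "e \<in> ?L"
    obtain q q' where [simp]: "e = (q, q')" by (cases e)
    consider "q < r" | "r \<le> q" "q < r + dim_vec b" "q' < r" | "r \<le> q" "q < r + dim_vec b" "\<not> q' < r"
      | "r + dim_vec b \<le> q" by linarith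
    then show "e \<in> ?U"
    proof cases
      case 1
      then show ?thesis using e by simp
    next
      case 2
      then have "(q - r, q') \<in> SA" using e A unfolding SA_def by (auto split: if_splits)
      then show ?thesis using 2 by (intro UnI1 image_eqI[of _ _ "(q - r, q')"]) auto
    next
      case 3
      then have "q' = q" "q - r \<in> Sb" using e unfolding Sb_def by (auto split: if_splits)
      then show ?thesis using 3 by (intro UnI1 UnI2 image_eqI[of _ _ "q - r"]) auto
    next
      case 4
      then show ?thesis using e unfolding T_def by (auto split: if_splits)
    qed
  qed
  have "card ?L \<le> card ?U" using fin T sub by (intro card_mono) auto
  also have "\<dots> \<le> card ((\<lambda>(i, j). (r + i, j)) ` SA) + card ((\<lambda>i. (r + i, r + i)) ` Sb) + card T"
    by (meson add_right_mono card_Un_le le_trans)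
  also have "\<dots> \<le> card SA + card Sb + num_weights \<Phi>"
    using fin T by (intro add_mono card_image_le) auto
  finally show ?case
    using finite_subset[OF sub] fin T unfolding num_weights_def SA_def Sb_def by auto
qed

text \<open>Stated for an arbitrary offset \<open>r\<close> and accumulated vector \<open>z\<close>
  to match the recursion. The last layer is affine, hence \<open>preact\<close> in place of
  \<open>neuron\<close>.\<close>

lemma run_layers_eq_preact:
  assumes "wf_layers r \<Phi>" "\<Phi> \<noteq> []" "dim_vec (snd (last \<Phi>)) = 1" "dim_vec z = r" "d \<le> r"
    and "\<And>q. q < r \<Longrightarrow> vec_index z q = neuron d w x q"
    and "\<And>q q'. r \<le> q \<Longrightarrow> w (q, q') = flat r \<Phi> (q, q')"
  shows "vec_index (run_layers \<Phi> z) 0 = preact d w x (out_pos r \<Phi>)"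
  using assms
proof (induction \<Phi> z arbitrary: r rule: run_layers.induct)
  case (1 z)
  then show ?case by simp
next
  case (2 A b z)
  have A: "A \<in> carrier_mat 1 r" "dim_vec b = 1" using 2 by auto
  have "vec_index (A *\<^sub>v z + b) 0 = (\<Sum>q'<r. A $$ (0, q') * vec_index z q') + vec_index b 0"
    using A 2 by (simp add: scalar_prod_def lessThan_atLeast0)
  also have "\<dots> = preact d w x r"
    unfolding preact_def using 2 by (auto intro!: sum.cong arg_cong2[of _ _ _ _ "(+)"])
  finally show ?case by (simp add: out_pos_def)
next
  case (3 A b \<Phi>0 \<Phi>' z)
  define \<Phi> where "\<Phi> = \<Phi>0 # \<Phi>'"
  have A: "A \<in> carrier_mat (dim_vec b) r" using 3 by auto
  let ?y = "map_vec relu (A *\<^sub>v z + b)"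
  have y: "vec_index ?y i = neuron d w x (r + i)" if "i < dim_vec b" for i
  proof -
    have "preact d w x (r + i) =
        (\<Sum>q'<r + i. (if q' < r then A $$ (i, q') * neuron d w x q' else 0)) + vec_index b i"
      unfolding preact_def using that "3.prems"(7) by (auto intro!: sum.cong arg_cong2[of _ _ _ _ "(+)"])
    also have "(\<Sum>q'<r + i. (if q' < r then A $$ (i, q') * neuron d w x q' else 0)) =
        (\<Sum>q'<r. A $$ (i, q') * neuron d w x q')"
      by (intro sum.mono_neutral_cong_right) auto
    also have "\<dots> = (\<Sum>q'<r. A $$ (i, q') * vec_index z q')" using "3.prems"(6) by simp
    also have "\<dots> + vec_index b i = vec_index (A *\<^sub>v z + b) i"
      using A that "3.prems"(4) by (simp add: scalar_prod_def lessThan_atLeast0)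
    finally show ?thesis using A that \<open>d \<le> r\<close> by (simp add: neuron_eq)
  qed
  have "vec_index (run_layers \<Phi> (z @\<^sub>v ?y)) 0 = preact d w x (out_pos (r + dim_vec b) \<Phi>)"
    unfolding \<Phi>_def
  proof (rule "3.IH")
    show "vec_index (z @\<^sub>v ?y) q = neuron d w x q" if "q < r + dim_vec b" for q
      using that A y[of "q - r"] "3.prems"(4,6) by (cases "q < r") auto
    show "w (q, q') = flat (r + dim_vec b) (\<Phi>0 # \<Phi>') (q, q')" if "r + dim_vec b \<le> q" for q q'
      using that "3.prems"(7)[of q q'] by simp
  qed (use 3 A in auto)
  then show ?case unfolding \<Phi>_def out_pos_def by (simp add: add.assoc)
qed

lemma flat_has_architecture:
  assumes "length \<Phi> = length \<A>" "wf_layers r \<Phi>" "wf_layers r \<A>"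
    and "\<And>l. l < length \<A> \<Longrightarrow> dim_vec (snd (\<Phi> ! l)) = dim_vec (snd (\<A> ! l))"
    and "\<And>l i j. l < length \<A> \<Longrightarrow> i < dim_row (fst (\<A> ! l)) \<Longrightarrow> j < dim_col (fst (\<A> ! l)) \<Longrightarrow>
      fst (\<Phi> ! l) $$ (i, j) \<noteq> 0 \<Longrightarrow> fst (\<A> ! l) $$ (i, j) \<noteq> 0"
    and "\<And>l i. l < length \<A> \<Longrightarrow> i < dim_vec (snd (\<A> ! l)) \<Longrightarrow>
      vec_index (snd (\<Phi> ! l)) i \<noteq> 0 \<Longrightarrow> vec_index (snd (\<A> ! l)) i \<noteq> 0"
  shows "(\<forall>e. flat r \<Phi> e \<noteq> 0 \<longrightarrow> flat r \<A> e \<noteq> 0) \<and> out_pos r \<Phi> = out_pos r \<A> \<and>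
    (\<A> \<noteq> [] \<longrightarrow> dim_vec (snd (last \<Phi>)) = dim_vec (snd (last \<A>)))"
  using assms
proof (induction \<Phi> \<A> arbitrary: r rule: list_induct2)
  case Nil
  then show ?case by simp
next
  case (Cons l1 \<Phi> l2 \<A>)
  obtain A' b' A b where [simp]: "l1 = (A', b')" "l2 = (A, b)" by (cases l1, cases l2)
  have [simp]: "dim_vec b' = dim_vec b" using Cons.prems(3)[of 0] by simp
  have A: "A' \<in> carrier_mat (dim_vec b) r" "A \<in> carrier_mat (dim_vec b) r" using Cons.prems by auto
  have IH: "(\<forall>e. flat (r + dim_vec b) \<Phi> e \<noteq> 0 \<longrightarrow> flat (r + dim_vec b) \<A> e \<noteq> 0) \<and>
    out_pos (r + dim_vec b) \<Phi> = out_pos (r + dim_vec b) \<A> \<and>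
    (\<A> \<noteq> [] \<longrightarrow> dim_vec (snd (last \<Phi>)) = dim_vec (snd (last \<A>)))"
  proof (rule Cons.IH)
    fix l assume l: "l < length \<A>"
    show "dim_vec (snd (\<Phi> ! l)) = dim_vec (snd (\<A> ! l))"
      using Cons.prems(3)[of "Suc l"] l by simp
    show "fst (\<A> ! l) $$ (i, j) \<noteq> 0"
      if "i < dim_row (fst (\<A> ! l))" "j < dim_col (fst (\<A> ! l))" "fst (\<Phi> ! l) $$ (i, j) \<noteq> 0" for i j
      using Cons.prems(4)[of "Suc l" i j] l that by simp
    show "vec_index (snd (\<A> ! l)) i \<noteq> 0"
      if "i < dim_vec (snd (\<A> ! l))" "vec_index (snd (\<Phi> ! l)) i \<noteq> 0" for i
      using Cons.prems(5)[of "Suc l" i] l that by simp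
  qed (use Cons.prems in auto)
  have "flat r (l2 # \<A>) (q, q') \<noteq> 0" if "flat r (l1 # \<Phi>) (q, q') \<noteq> 0" for q q'
    using that IH A Cons.prems(4)[of 0 "q - r" q'] Cons.prems(5)[of 0 "q - r"]
    by (auto split: if_splits)
  then have 1: "\<forall>e. flat r (l1 # \<Phi>) e \<noteq> 0 \<longrightarrow> flat r (l2 # \<A>) e \<noteq> 0"
    by (metis surj_pair)
  have "\<Phi> = [] \<longleftrightarrow> \<A> = []" using Cons.hyps by auto
  then show ?case using IH 1 unfolding out_pos_def by (auto simp: add.assoc)
qed

lemma realization1_eq_preact:
  assumes \<A>: "is_architecture CARD('d::finite) \<A>" and \<Phi>: "has_architecture CARD('d) \<Phi> \<A>"
  shows "\<exists>w. (\<forall>e. flat CARD('d) \<A> e = 0 \<longrightarrow> w e = 0) \<and> (\<forall>x :: real^'d. realization1 \<Phi> x =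
      preact CARD('d) w (\<lambda>q. vec_nth x (coord q)) (out_pos CARD('d) \<A>))"
proof (intro exI conjI allI impI)
  let ?d = "CARD('d)"
  have net: "is_network ?d \<Phi>" "is_network ?d \<A>" and len: "length \<Phi> = length \<A>"
    and dims: "\<And>l. l \<in> {1..length \<A>} \<Longrightarrow> layer_size ?d \<Phi> l = layer_size ?d \<A> l"
    and out: "output_dim \<A> = 1"
    using assms unfolding is_architecture_def has_architecture_def by auto
  have ne: "\<A> \<noteq> []" "\<Phi> \<noteq> []" using net unfolding is_network_def by auto
  have dims': "dim_vec (snd (\<Phi> ! l)) = dim_vec (snd (\<A> ! l))" if "l < length \<A>" for l
    using dims[of "Suc l"] that by (simp add: layer_size_def)
  have fl: "(\<forall>e. flat ?d \<Phi> e \<noteq> 0 \<longrightarrow> flat ?d \<A> e \<noteq> 0) \<and> out_pos ?d \<Phi> = out_pos ?d \<A> \<and>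
    (\<A> \<noteq> [] \<longrightarrow> dim_vec (snd (last \<Phi>)) = dim_vec (snd (last \<A>)))"
    using \<Phi> unfolding has_architecture_def
    by (intro flat_has_architecture len wf_layers_network net dims') auto
  show "flat ?d \<Phi> e = 0" if "flat ?d \<A> e = 0" for e using fl that by blast
  show "realization1 \<Phi> x =
      preact ?d (flat ?d \<Phi>) (\<lambda>q. vec_nth x (coord q)) (out_pos ?d \<A>)" for x :: "real^'d"
  proof -
    have "realization1 \<Phi> x = preact ?d (flat ?d \<Phi>) (\<lambda>q. vec_nth x (coord q)) (out_pos ?d \<Phi>)"
      unfolding realization1_def realization_def
      using wf_layers_network[OF net(1)] ne fl out
      by (intro run_layers_eq_preact) (auto simp: output_dim_def coord_vec_def neuron_eq)
    then show ?thesis using fl by simp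
  qed
qed

lemma continuous_on_neuron:
  fixes S :: "(real^'d::finite) set"
  shows "continuous_on S (\<lambda>x. neuron d w (\<lambda>q. vec_nth x (coord q)) q)"
proof (induction q rule: less_induct)
  case (less q)
  then show ?case
    by (cases "q < d")
      (auto simp: neuron_eq preact_def relu_def[abs_def] intro!: continuous_intros)
qed

lemma continuous_on_realization1:
  fixes S :: "(real^'d::finite) set"
  assumes "is_architecture CARD('d) \<A>" "has_architecture CARD('d) \<Phi> \<A>"
  shows "continuous_on S (realization1 \<Phi>)"
proof -
  obtain w where "\<And>e. flat CARD('d) \<A> e = 0 \<Longrightarrow> w e = 0"
    and w: "\<And>x :: real^'d. realization1 \<Phi> x =
      preact CARD('d) w (\<lambda>q. vec_nth x (coord q)) (out_pos CARD('d) \<A>)"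
    using realization1_eq_preact[OF assms] by auto
  have "realization1 \<Phi> = (\<lambda>x :: real^'d.
      preact CARD('d) w (\<lambda>q. vec_nth x (coord q)) (out_pos CARD('d) \<A>))"
    by (intro ext w)
  then show ?thesis
    unfolding preact_def by (auto intro!: continuous_intros continuous_on_neuron)
qed

lemma realization1_no_weights:
  fixes x :: "real^'d::finite"
  assumes \<A>: "is_architecture CARD('d) \<A>" and \<Phi>: "has_architecture CARD('d) \<Phi> \<A>"
    and "num_weights \<A> = 0"
  shows "realization1 \<Phi> x = 0"
proof -
  have "wf_layers CARD('d) \<A>" using \<A> unfolding is_architecture_def by (intro wf_layers_network) auto
  then have "flat CARD('d) \<A> e = 0" for e
    using card_support_flat[of "CARD('d)" \<A>] assms(3) by (cases e) auto
  moreover obtain w where "\<And>e. flat CARD('d) \<A> e = 0 \<Longrightarrow> w e = 0"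
    and "\<And>x :: real^'d. realization1 \<Phi> x =
      preact CARD('d) w (\<lambda>q. vec_nth x (coord q)) (out_pos CARD('d) \<A>)"
    using realization1_eq_preact[OF \<A> \<Phi>] by auto
  ultimately show ?thesis using preact_outside[of "{}" w] by simp
qed

lemma shatter_bound:
  fixes x y :: "'p \<Rightarrow> real^'d::finite"
  assumes \<A>: "is_architecture CARD('d) \<A>" and G: "finite G"
    and shatter: "\<And>Y. Y \<subseteq> G \<Longrightarrow> \<exists>\<Phi>. has_architecture CARD('d) \<Phi> \<A> \<and>
      (\<forall>p\<in>G. realization1 \<Phi> (x p) - realization1 \<Phi> (y p) > \<theta> \<longleftrightarrow> p \<in> Y)"
  shows "card G \<le> 25 * (num_weights \<A>)\<^sup>2"
proof -
  let ?d = "CARD('d)"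
  define I where "I = {e. flat ?d \<A> e \<noteq> 0}"
  have "wf_layers ?d \<A>" using \<A> unfolding is_architecture_def by (intro wf_layers_network) auto
  then have I: "finite I" "card I \<le> num_weights \<A>" unfolding I_def using card_support_flat by auto
  define x' y' where "x' = (\<lambda>p q. vec_nth (x p) (coord q))" and "y' = (\<lambda>p q. vec_nth (y p) (coord q))"
  let ?F = "{{p\<in>G. preact ?d w (x' p) (out_pos ?d \<A>) - preact ?d w (y' p) (out_pos ?d \<A>) > \<theta>} |w.
    \<forall>e. e \<notin> I \<longrightarrow> w e = 0}"
  have "Pow G \<subseteq> ?F"
  proof
    fix Y assume "Y \<in> Pow G"
    then obtain \<Phi> where \<Phi>: "has_architecture ?d \<Phi> \<A>"
      "\<And>p. p \<in> G \<Longrightarrow> realization1 \<Phi> (x p) - realization1 \<Phi> (y p) > \<theta> \<longleftrightarrow> p \<in> Y"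
      using shatter[of Y] by auto
    obtain w where w: "\<And>e. flat ?d \<A> e = 0 \<Longrightarrow> w e = 0"
      "\<And>x :: real^'d. realization1 \<Phi> x = preact ?d w (\<lambda>q. vec_nth x (coord q)) (out_pos ?d \<A>)"
      using realization1_eq_preact[OF \<A> \<Phi>(1)] by auto
    have "Y = {p\<in>G. preact ?d w (x' p) (out_pos ?d \<A>) - preact ?d w (y' p) (out_pos ?d \<A>) > \<theta>}"
      using \<open>Y \<in> Pow G\<close> \<Phi>(2) unfolding w(2) x'_def y'_def by blast
    moreover have "\<forall>e. e \<notin> I \<longrightarrow> w e = 0" using w(1) unfolding I_def by auto
    ultimately show "Y \<in> ?F" by blast
  qed
  moreover have "finite ?F" by (rule finite_subset[of _ "Pow G"]) (use G in auto)
  ultimately have "card (Pow G) \<le> card ?F" by (rule card_mono[rotated])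
  then have "2 ^ card G \<le> card ?F" using G by (simp add: card_Pow)
  also have "\<dots> \<le> (2 * (card G * (2 * card I * 2 ^ card I + 4 ^ card I)) * (card I + 1) + 1) ^ card I"
    using I(1) G by (rule card_circuit_patterns)
  finally have "card G \<le> 25 * (card I)\<^sup>2" by (rule quadratic_shatter_bound)
  also have "\<dots> \<le> 25 * (num_weights \<A>)\<^sup>2" using I(2) by (simp add: power_mono)
  finally show ?thesis .
qed

section \<open>Smooth functions of one variable\<close>

text \<open>Asking for some derivative instead of using \<open>deriv\<close> lets closure properties
  follow by induction on \<open>k\<close>. Continuity of the last derivative is not demanded; it is
  automatic once all \<open>k\<close> are required.\<close>

fun cont_diff :: "nat \<Rightarrow> (real \<Rightarrow> real) \<Rightarrow> bool" where
  "cont_diff 0 f \<longleftrightarrow> True"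
| "cont_diff (Suc k) f \<longleftrightarrow> (\<exists>f'. (\<forall>x. (f has_real_derivative f' x) (at x)) \<and> cont_diff k f')"

definition smooth1 :: "(real \<Rightarrow> real) \<Rightarrow> bool" where
  "smooth1 f \<longleftrightarrow> (\<forall>k. cont_diff k f)"

lemma cont_diff_Suc_D: "cont_diff (Suc k) f \<Longrightarrow> cont_diff k f"
  by (induction k arbitrary: f) (simp, metis cont_diff.simps(2))

lemma cont_diff_add: "cont_diff k f \<Longrightarrow> cont_diff k g \<Longrightarrow> cont_diff k (\<lambda>x. f x + g x)"
proof (induction k arbitrary: f g)
  case (Suc k)
  then obtain f' g' where "\<forall>x. (f has_real_derivative f' x) (at x)" "cont_diff k f'"
    "\<forall>x. (g has_real_derivative g' x) (at x)" "cont_diff k g'" by auto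
  then show ?case using Suc.IH by (auto intro!: exI[of _ "\<lambda>x. f' x + g' x"] DERIV_add)
qed simp

lemma cont_diff_mult: "cont_diff k f \<Longrightarrow> cont_diff k g \<Longrightarrow> cont_diff k (\<lambda>x. f x * g x)"
proof (induction k arbitrary: f g)
  case (Suc k)
  then obtain f' g' where "\<forall>x. (f has_real_derivative f' x) (at x)" "cont_diff k f'"
    "\<forall>x. (g has_real_derivative g' x) (at x)" "cont_diff k g'" by auto
  moreover have "cont_diff k (\<lambda>x. f' x * g x + g' x * f x)"
    using calculation Suc.prems[THEN cont_diff_Suc_D] by (intro cont_diff_add Suc.IH)
  ultimately show ?case by (auto intro!: exI[of _ "\<lambda>x. f' x * g x + g' x * f x"] DERIV_mult)
qed simp

lemma cont_diff_const: "cont_diff k (\<lambda>_. c)"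
  by (induction k arbitrary: c) (auto intro!: exI[of _ "\<lambda>_. 0"])

lemma cont_diff_affine: "cont_diff k f \<Longrightarrow> cont_diff k (\<lambda>x. f (m * x + c))"
proof (induction k arbitrary: f)
  case (Suc k)
  then obtain f' where f': "\<forall>x. (f has_real_derivative f' x) (at x)" "cont_diff k f'" by auto
  have "((\<lambda>x. f (m * x + c)) has_real_derivative f' (m * x + c) * m) (at x)" for x
    by (rule DERIV_chain2[OF f'(1)[rule_format]]) (auto intro!: derivative_eq_intros)
  moreover have "cont_diff k (\<lambda>x. f' (m * x + c) * m)"
    by (rule cont_diff_mult[OF Suc.IH[OF f'(2)] cont_diff_const])
  ultimately show ?case unfolding cont_diff.simps
    by (intro exI[of _ "\<lambda>x. f' (m * x + c) * m"]) blast
qed simp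

lemma smooth1_add: "smooth1 f \<Longrightarrow> smooth1 g \<Longrightarrow> smooth1 (\<lambda>x. f x + g x)"
  by (simp add: smooth1_def cont_diff_add)

lemma smooth1_mult: "smooth1 f \<Longrightarrow> smooth1 g \<Longrightarrow> smooth1 (\<lambda>x. f x * g x)"
  by (simp add: smooth1_def cont_diff_mult)

lemma smooth1_const: "smooth1 (\<lambda>_. c)"
  by (simp add: smooth1_def cont_diff_const)

lemma smooth1_affine: "smooth1 f \<Longrightarrow> smooth1 (\<lambda>x. f (m * x + c))"
  by (simp add: smooth1_def cont_diff_affine)

lemma smooth1_diff: "smooth1 f \<Longrightarrow> smooth1 g \<Longrightarrow> smooth1 (\<lambda>x. f x - g x)"
  using smooth1_add[of f "\<lambda>x. -1 * g x"] smooth1_mult[OF smooth1_const[of "-1"], of g] by simp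

lemma smooth1_power: "smooth1 f \<Longrightarrow> smooth1 (\<lambda>x. f x ^ n)"
  by (induction n) (auto intro: smooth1_mult smooth1_const)

lemma smooth1_antideriv:
  assumes "\<And>x. (f has_real_derivative f' x) (at x)" "smooth1 f'"
  shows "smooth1 f"
proof -
  have "cont_diff (Suc k) f" for k using assms unfolding smooth1_def by auto
  then show ?thesis unfolding smooth1_def by (blast intro: cont_diff_Suc_D)
qed

lemma smooth1_deriv:
  assumes "smooth1 f"
  shows "(f has_real_derivative deriv f x) (at x)" "smooth1 (deriv f)"
proof -
  have *: "(\<forall>x. (f has_real_derivative deriv f x) (at x)) \<and> cont_diff k (deriv f)" for k
  proof -
    have "cont_diff (Suc k) f" using assms unfolding smooth1_def by blast
    then obtain f' where f': "\<forall>x. (f has_real_derivative f' x) (at x)" "cont_diff k f'" by auto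
    then have "deriv f = f'" by (intro ext DERIV_imp_deriv) blast
    then show ?thesis using f' by simp
  qed
  show "(f has_real_derivative deriv f x) (at x)" "smooth1 (deriv f)"
    using * unfolding smooth1_def by auto
qed

lemma smooth1_higher_deriv: "smooth1 f \<Longrightarrow> smooth1 ((deriv ^^ k) f)"
  by (induction k) (auto intro: smooth1_deriv)

lemma DERIV_higher_deriv:
  "smooth1 f \<Longrightarrow> ((deriv ^^ k) f has_real_derivative (deriv ^^ Suc k) f x) (at x)"
  using smooth1_deriv(1)[OF smooth1_higher_deriv] by simp

section \<open>Functions vanishing to infinite order at 0, and bumps made from them\<close>

definition flat_exp :: "real poly \<Rightarrow> real \<Rightarrow> real" where
  "flat_exp p t = (if t > 0 then poly p (1 / t) * exp (- (1 / t)) else 0)"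

lemma poly_exp_tendsto_0: "((\<lambda>s. poly q s * exp (- s)) \<longlongrightarrow> 0) at_top" for q :: "real poly"
proof -
  have "((\<lambda>s. \<Sum>i\<le>degree q. coeff q i * (s ^ i / exp s)) \<longlongrightarrow> (\<Sum>i\<le>degree q. coeff q i * 0)) at_top"
    by (intro tendsto_intros tendsto_power_div_exp_0)
  then show ?thesis by (simp add: poly_altdef sum_distrib_right exp_minus divide_inverse mult.assoc)
qed

text \<open>With \<open>s = 1 / t\<close>, the function \<open>p s * exp (- s)\<close> has
  derivative \<open>s^2 * (p s - p' s) * exp (- s)\<close> in \<open>t\<close>. The family is thus
  closed under differentiation, which makes all of its members smooth at once.\<close>

lemma DERIV_flat_exp:
  "(flat_exp p has_real_derivative flat_exp ([:0, 0, 1:] * (p - pderiv p)) x) (at x)"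
proof -
  consider "x > 0" | "x < 0" | "x = 0" by linarith
  then show ?thesis
  proof cases
    case 1
    have "((\<lambda>t. poly p (1 / t) * exp (- (1 / t))) has_real_derivative
        flat_exp ([:0, 0, 1:] * (p - pderiv p)) x) (at x)"
      using 1
      by (auto intro!: derivative_eq_intros DERIV_chain2[OF poly_DERIV]
          simp: flat_exp_def field_simps power2_eq_square)
    then show ?thesis
      by (rule has_field_derivative_transform_within_open[of _ _ _ "{0<..}"]) (use 1 in \<open>auto simp: flat_exp_def\<close>)
  next
    case 2
    have "((\<lambda>t. 0) has_real_derivative flat_exp ([:0, 0, 1:] * (p - pderiv p)) x) (at x)"
      using 2 by (auto simp: flat_exp_def)
    then show ?thesis
      by (rule has_field_derivative_transform_within_open[of _ _ _ "{..<0}"]) (use 2 in \<open>auto simp: flat_exp_def\<close>)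
  next
    case 3
    have "((\<lambda>h. flat_exp p h / h) \<longlongrightarrow> 0) (at_right 0)"
    proof -
      \<comment> \<open>Dividing by \<open>h\<close> is multiplication by
        \<open>s = inverse h\<close>, so the difference quotient at 0 is again a polynomial in
        \<open>s\<close> times \<open>exp (- s)\<close>.\<close>
      have "((\<lambda>h. poly (pCons 0 p) (inverse h) * exp (- inverse h)) \<longlongrightarrow> 0) (at_right (0::real))"
        by (rule filterlim_compose[OF poly_exp_tendsto_0 filterlim_inverse_at_top_right])
      then show ?thesis
        by (rule Lim_transform_eventually)
          (auto simp: flat_exp_def eventually_at_right_less field_simps intro!: eventually_at_rightI[of 0 1])
    qed
    moreover have "((\<lambda>h. flat_exp p h / h) \<longlongrightarrow> 0) (at_left 0)"
      by (rule Lim_transform_eventually[OF tendsto_const])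
        (auto simp: flat_exp_def intro!: eventually_at_leftI[of "-1"])
    ultimately have "((\<lambda>h. flat_exp p h / h) \<longlongrightarrow> 0) (at 0)" by (simp add: filterlim_split_at)
    then show ?thesis using 3 by (simp add: DERIV_def flat_exp_def)
  qed
qed

lemma smooth1_flat_exp: "smooth1 (flat_exp p)"
proof -
  have "cont_diff k (flat_exp p)" for k
  proof (induction k arbitrary: p)
    case (Suc k)
    show ?case
      unfolding cont_diff.simps
      by (rule exI[of _ "flat_exp ([:0, 0, 1:] * (p - pderiv p))"]) (intro conjI allI DERIV_flat_exp Suc)
  qed simp
  then show ?thesis unfolding smooth1_def by blast
qed

text \<open>Not normalized: only positivity exactly on the interval and the bound 1 matter. The
  height at the midpoint stays in later constants as \<open>bump 0 (1/2) (1/4)\<close>.\<close>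

definition bump :: "real \<Rightarrow> real \<Rightarrow> real \<Rightarrow> real" where
  "bump a b t = flat_exp 1 (t - a) * flat_exp 1 (b - t)"

lemma smooth1_bump: "smooth1 (bump a b)"
  using smooth1_mult[OF smooth1_affine[OF smooth1_flat_exp, of 1 1 "-a"] smooth1_affine[OF smooth1_flat_exp, of 1 "-1" b]]
  unfolding bump_def[abs_def] by (simp add: algebra_simps)

lemma bump_pos: "bump a b t > 0 \<longleftrightarrow> a < t \<and> t < b"
  by (auto simp: bump_def flat_exp_def zero_less_mult_iff)

lemma bump_nonneg: "bump a b t \<ge> 0"
  by (auto simp: bump_def flat_exp_def)

lemma bump_eq_0: "t \<le> a \<or> b \<le> t \<Longrightarrow> bump a b t = 0"
  by (auto simp: bump_def flat_exp_def)

lemma bump_le_1: "bump a b t \<le> 1"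
  by (auto simp: bump_def flat_exp_def intro!: mult_le_one)

section \<open>Systems of iterated partial derivatives\<close>

text \<open>\<open>G \<alpha>\<close> plays the role of \<open>D\<^sup>\<alpha> f\<close> with \<open>f = G (\<lambda>_. 0)\<close>. Keeping the whole family avoids
  any discussion of the order of differentiation.\<close>

definition dtower :: "('d multiindex \<Rightarrow> real^'d::finite \<Rightarrow> real) \<Rightarrow> bool" where
  "dtower G \<longleftrightarrow> (\<forall>\<alpha>. G \<alpha> differentiable_on UNIV) \<and>
     (\<forall>\<alpha> i x. ((\<lambda>t. G \<alpha> (x + t *\<^sub>R axis i 1)) has_real_derivative G (\<alpha>(i := Suc (\<alpha> i))) x) (at 0))"

text \<open>In a product of functions of separate coordinates, \<alpha> just differentiates each
  factor \<open>\<alpha> i\<close> times. Test functions and grid bumps below are all obtained this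
  way.\<close>

lemma dtower_prod:
  fixes f :: "'d::finite \<Rightarrow> real \<Rightarrow> real"
  assumes f: "\<And>i. smooth1 (f i)"
  shows "dtower (\<lambda>\<alpha> x. \<Prod>i\<in>UNIV. (deriv ^^ \<alpha> i) (f i) (vec_nth x i))"
  unfolding dtower_def
proof (intro conjI allI)
  fix \<alpha> :: "'d multiindex"
  have "((\<lambda>x. (deriv ^^ \<alpha> i) (f i) (vec_nth x i)) has_derivative
      (\<lambda>h. (deriv ^^ Suc (\<alpha> i)) (f i) (vec_nth x i) * vec_nth h i)) (at x)" for i and x :: "real^'d"
    using has_derivative_compose[OF bounded_linear_imp_has_derivative[OF bounded_linear_vec_nth]
        DERIV_higher_deriv[OF f[of i], of "\<alpha> i", unfolded has_field_derivative_def]]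
    by simp
  then have "((\<lambda>x. (\<Prod>i\<in>UNIV. (deriv ^^ \<alpha> i) (f i) (vec_nth x i))) has_derivative
      (\<lambda>y. \<Sum>i\<in>UNIV. (deriv ^^ Suc (\<alpha> i)) (f i) (vec_nth x i) * vec_nth y i *
        (\<Prod>j\<in>UNIV - {i}. (deriv ^^ \<alpha> j) (f j) (vec_nth x j)))) (at x)" for x :: "real^'d"
    by (intro has_derivative_prod)
  then show "(\<lambda>x. \<Prod>i\<in>UNIV. (deriv ^^ \<alpha> i) (f i) (vec_nth x i)) differentiable_on UNIV"
    unfolding differentiable_on_def differentiable_def by blast
next
  fix \<alpha> :: "'d multiindex" and i and x :: "real^'d"
  let ?R = "\<Prod>j\<in>UNIV - {i}. (deriv ^^ \<alpha> j) (f j) (vec_nth x j)"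
  have "((\<lambda>t. (deriv ^^ \<alpha> i) (f i) (vec_nth x i + t)) has_real_derivative
      (deriv ^^ Suc (\<alpha> i)) (f i) (vec_nth x i)) (at 0)"
    using DERIV_higher_deriv[OF f[of i], of "\<alpha> i" "vec_nth x i"] 
    by (simp add: DERIV_shift[of _ _ 0 "vec_nth x i", simplified] add.commute)
  then have "((\<lambda>t. (deriv ^^ \<alpha> i) (f i) (vec_nth x i + t) * ?R) has_real_derivative
      (deriv ^^ Suc (\<alpha> i)) (f i) (vec_nth x i) * ?R) (at 0)"
    by (rule DERIV_cmult_right)
  moreover have "(\<Prod>j\<in>UNIV. (deriv ^^ \<alpha> j) (f j) (vec_nth (x + t *\<^sub>R axis i 1) j)) =
      (deriv ^^ \<alpha> i) (f i) (vec_nth x i + t) * ?R" for t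
    by (subst prod.remove[of UNIV i]) (auto simp: axis_def intro!: arg_cong2[of _ _ _ _ "(*)"] prod.cong)
  moreover have "(\<Prod>j\<in>UNIV. (deriv ^^ (\<alpha>(i := Suc (\<alpha> i))) j) (f j) (vec_nth x j)) =
      (deriv ^^ Suc (\<alpha> i)) (f i) (vec_nth x i) * ?R"
    by (subst prod.remove[of UNIV i]) (auto intro!: arg_cong2[of _ _ _ _ "(*)"] prod.cong)
  ultimately show "((\<lambda>t. \<Prod>j\<in>UNIV. (deriv ^^ \<alpha> j) (f j) (vec_nth (x + t *\<^sub>R axis i 1) j))
      has_real_derivative (\<Prod>j\<in>UNIV. (deriv ^^ (\<alpha>(i := Suc (\<alpha> i))) j) (f j) (vec_nth x j))) (at 0)"
    by simp
qed

lemma dtower_cmult_sum: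
  assumes "\<And>m. m \<in> Y \<Longrightarrow> dtower (G m)"
  shows "dtower (\<lambda>\<alpha> x. c * (\<Sum>m\<in>Y. G m \<alpha> x))"
proof (cases "finite Y")
  case True
  then show ?thesis
    using assms unfolding dtower_def differentiable_on_def
    by (auto intro!: DERIV_cmult DERIV_sum differentiable_mult differentiable_sum)
next
  case False
  then show ?thesis by (simp add: dtower_def)
qed

lemma dtower_partial: "dtower G \<Longrightarrow> partial i (G \<alpha>) = G (\<alpha>(i := Suc (\<alpha> i)))"
  unfolding dtower_def partial_def by (auto intro!: DERIV_imp_deriv)

lemma dtower_foldr_partial:
  "dtower G \<Longrightarrow> foldr partial is (G \<alpha>) = G (\<lambda>i. \<alpha> i + count_list is i)"
  by (induction "is") (auto simp: dtower_partial intro!: arg_cong[of _ _ G])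

lemma dtower_smooth: "dtower G \<Longrightarrow> smooth (G \<alpha>)"
  unfolding smooth_def by (auto simp: dtower_foldr_partial) (simp add: dtower_def)

lemma dtower_continuous: "dtower G \<Longrightarrow> continuous_on S (G \<alpha>)"
  unfolding dtower_def using differentiable_imp_continuous_on continuous_on_subset by blast

lemma foldr_power_eq:
  "foldr (\<lambda>i. h i ^^ \<alpha> i) xs f = foldr h (concat (map (\<lambda>i. replicate (\<alpha> i) i) xs)) f"
proof -
  have "foldr h (replicate n i) g = (h i ^^ n) g" for n i g by (induction n) auto
  then show ?thesis by (induction xs) auto
qed

text \<open>A list of single directions admits integration by parts one entry at a time:
  \<open>count_list\<close> recovers the multiindex, and the length gives the number of sign
  changes.\<close>

lemma classical_deriv_eq_foldr:
  fixes \<alpha> :: "'d::finite multiindex"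
  obtains "is" where "\<And>f. classical_deriv \<alpha> f = foldr partial is f" "count_list is = \<alpha>"
    "length is = order_mi \<alpha>"
proof
  have bij: "bij_betw (coord :: nat \<Rightarrow> 'd) {..<CARD('d)} UNIV"
    unfolding coord_def by (rule bij_betw_from_nat_into_finite) simp
  let ?c = "map (coord :: nat \<Rightarrow> 'd) [0..<CARD('d)]"
  let ?l = "concat (map (\<lambda>i. replicate (\<alpha> i) i) ?c)"
  have c: "distinct ?c" "set ?c = UNIV"
    using bij by (auto simp: distinct_map bij_betw_def lessThan_atLeast0)
  show "classical_deriv \<alpha> f = foldr partial ?l f" for f
    unfolding classical_deriv_def by (rule foldr_power_eq)
  have rep: "count_list (replicate n j) i = (if i = j then n else 0)" for n and i j :: 'd
    by (induction n) auto
  have "count_list (concat (map (\<lambda>i. replicate (\<alpha> i) i) xs)) i = (if i \<in> set xs then \<alpha> i else 0)"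
    if "distinct xs" for xs i using that by (induction xs) (auto simp: rep)
  from this[OF c(1)] show "count_list ?l = \<alpha>" using c(2) by auto
  have "length (concat (map (\<lambda>i. replicate (\<alpha> i) i) xs)) = sum \<alpha> (set xs)"
    if "distinct xs" for xs using that by (induction xs) auto
  from this[OF c(1)] show "length ?l = order_mi \<alpha>" using c(2) by (simp add: order_mi_def)
qed

section \<open>Integration by parts\<close>

lemma integrable_continuous_compact_support:
  fixes g :: "'a::euclidean_space \<Rightarrow> real"
  assumes "continuous_on UNIV g" "compact K" "\<And>x. x \<notin> K \<Longrightarrow> g x = 0"
  shows "integrable lborel g" "integrable lebesgue g"
proof -
  have "integrable lborel (\<lambda>x. indicator K x *\<^sub>R g x)"
    using assms by (intro borel_integrable_compact) (auto intro: continuous_on_subset)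
  also have "(\<lambda>x. indicator K x *\<^sub>R g x) = g" using assms(3) by (auto simp: indicator_def fun_eq_iff)
  finally show "integrable lborel g" .
  then show "integrable lebesgue g"
    using integrable_completion[of g lborel] borel_measurable_continuous_onI[OF assms(1)] by simp
qed

lemma integral_translate:
  fixes g :: "'a::euclidean_space \<Rightarrow> real"
  assumes "g \<in> borel_measurable borel"
  shows "(LINT x|lborel. g (x + v)) = (LINT x|lborel. g x)"
proof -
  have "(LINT x|lborel. g x) = (LINT x|distr lborel borel ((+) v). g x)"
    by (simp add: lborel_distr_plus)
  also have "\<dots> = (LINT x|lborel. g (v + x))"
    by (rule integral_distr) (use assms in auto)
  finally show ?thesis by (simp add: add.commute)
qed

lemma has_partial_shift:
  fixes g :: "real^'d::finite \<Rightarrow> real"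
  assumes "\<And>x. ((\<lambda>t. g (x + t *\<^sub>R axis i 1)) has_real_derivative g' x) (at 0)"
  shows "((\<lambda>t. g (x + t *\<^sub>R axis i 1)) has_real_derivative g' (x + s *\<^sub>R axis i 1)) (at s)"
proof -
  have "((\<lambda>t. g (x + (t + s) *\<^sub>R axis i 1)) has_real_derivative g' (x + s *\<^sub>R axis i 1)) (at 0)"
    using assms[of "x + s *\<^sub>R axis i 1"] by (simp add: scaleR_add_left add_ac)
  then show ?thesis using DERIV_shift[of "\<lambda>t. g (x + t *\<^sub>R axis i 1)" _ 0 s] by simp
qed

text \<open>By translation invariance every difference quotient of \<open>g\<close> has integral 0,
  and dominated convergence passes to the derivative. No iterated integral is involved.\<close>

lemma integral_partial_eq_0:
  fixes g g' :: "real^'d::finite \<Rightarrow> real"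
  assumes g: "continuous_on UNIV g" and g': "continuous_on UNIV g'"
    and D: "\<And>x. ((\<lambda>t. g (x + t *\<^sub>R axis i 1)) has_real_derivative g' x) (at 0)"
    and K: "compact K" "\<And>x. x \<notin> K \<Longrightarrow> g x = 0" "\<And>x. x \<notin> K \<Longrightarrow> g' x = 0"
  shows "(LINT x|lebesgue. g' x) = 0"
proof -
  let ?e = "axis i 1 :: real^'d"
  have "bounded (g' ` K)"
    using K(1) g' by (intro compact_imp_bounded compact_continuous_image) (auto intro: continuous_on_subset)
  then obtain B0 where B0: "\<And>x. x \<in> K \<Longrightarrow> \<bar>g' x\<bar> \<le> B0" unfolding bounded_real by auto
  define B where "B = \<bar>B0\<bar>"
  have B: "\<bar>g' x\<bar> \<le> B" for x using B0[of x] K(3)[of x] unfolding B_def by (cases "x \<in> K") auto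
  obtain R where R: "\<And>x. x \<in> K \<Longrightarrow> norm x \<le> R" using compact_imp_bounded[OF K(1)] unfolding bounded_iff by auto
  \<comment> \<open>Steps of length at most 1 keep all difference quotients supported in one ball of
    radius \<open>R + 1\<close>; the mean value theorem bounds them there by
    \<open>B\<close>.\<close>
  define h where "h = (\<lambda>n. inverse (real (Suc n)))"
  have h: "0 < h n" "h n \<le> 1" for n unfolding h_def by (auto simp: inverse_le_1_iff)
  define q where "q = (\<lambda>n x. (g (x + h n *\<^sub>R ?e) - g x) / h n)"
  have gb: "g \<in> borel_measurable borel" "g' \<in> borel_measurable borel"
    using g g' by (auto intro: borel_measurable_continuous_onI)
  have int: "integrable lborel g" by (rule integrable_continuous_compact_support(1)[OF g K(1,2)])
  have int_shift: "integrable lborel (\<lambda>x. g (x + v))" for v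
  proof (rule integrable_continuous_compact_support(1))
    show "continuous_on UNIV (\<lambda>x. g (x + v))"
      by (rule continuous_on_compose2[OF g]) (auto intro: continuous_intros)
    show "compact ((\<lambda>x. x - v) ` K)"
      using K(1) by (intro compact_continuous_image continuous_intros)
    show "g (x + v) = 0" if "x \<notin> (\<lambda>x. x - v) ` K" for x
      using that K(2)[of "x + v"] by (metis add_diff_cancel_right' image_eqI)
  qed
  have q0: "(LINT x|lborel. q n x) = 0" for n
    unfolding q_def using integral_translate[OF gb(1)] int int_shift by simp
  have "(\<lambda>n. LINT x|lborel. q n x) \<longlonglongrightarrow> (LINT x|lborel. g' x)"
  proof (rule integral_dominated_convergence)
    show "g' \<in> borel_measurable lborel" using gb by simp
    show "q n \<in> borel_measurable lborel" for n unfolding q_def using gb(1) by measurable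
    have "integrable lborel (\<lambda>x::real^'d. indicator (cball 0 (R + 1)) x *\<^sub>R B)"
      by (intro borel_integrable_compact) auto
    then show "integrable lborel (\<lambda>x::real^'d. B * indicator (cball 0 (R + 1)) x)"
      by (simp add: mult.commute)
    show "AE x in lborel. (\<lambda>n. q n x) \<longlonglongrightarrow> g' x"
    proof (intro AE_I2)
      fix x
      have "((\<lambda>t. (g (x + t *\<^sub>R ?e) - g x) / t) \<longlongrightarrow> g' x) (at 0)"
        using D[of x] by (simp add: DERIV_def)
      moreover have "filterlim h (at 0) sequentially"
        unfolding filterlim_at h_def using LIMSEQ_inverse_real_of_nat by (auto simp: eventually_sequentially)
      ultimately show "(\<lambda>n. q n x) \<longlonglongrightarrow> g' x"
        unfolding q_def by (rule filterlim_compose)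
    qed
    show "AE x in lborel. norm (q n x) \<le> B * indicator (cball 0 (R + 1)) x" for n
    proof (intro AE_I2)
      fix x
      show "norm (q n x) \<le> B * indicator (cball 0 (R + 1)) x"
      proof (cases "norm x \<le> R + 1")
        case True
        obtain s where "g (x + h n *\<^sub>R ?e) - g (x + 0 *\<^sub>R ?e) = (h n - 0) * g' (x + s *\<^sub>R ?e)"
          using MVT2[of 0 "h n" "\<lambda>t. g (x + t *\<^sub>R ?e)" "\<lambda>s. g' (x + s *\<^sub>R ?e)"] has_partial_shift[OF D] h
          by blast
        then have "q n x = g' (x + s *\<^sub>R ?e)" unfolding q_def using h(1)[of n] by simp
        then show ?thesis using B True by simp
      next
        case False
        have "norm (h n *\<^sub>R ?e) \<le> 1" using h[of n] by simp
        then have "norm (x + h n *\<^sub>R ?e) > R" using False norm_triangle_ineq2[of x "- (h n *\<^sub>R ?e)"] by simp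
        then have "g (x + h n *\<^sub>R ?e) = 0" using R[of "x + h n *\<^sub>R ?e"] K(2) by force
        moreover have "g x = 0" using R[of x] K(2) False by force
        ultimately show ?thesis unfolding q_def using False by simp
      qed
    qed
  qed
  then have "(LINT x|lborel. g' x) = 0" using q0 by (simp add: LIMSEQ_const_iff)
  then show ?thesis using integral_completion[of g' lborel] gb by simp
qed

lemma integral_by_parts_partial:
  fixes f f' \<psi> \<psi>' :: "real^'d::finite \<Rightarrow> real"
  assumes cont: "continuous_on UNIV f" "continuous_on UNIV f'" "continuous_on UNIV \<psi>" "continuous_on UNIV \<psi>'"
    and f: "\<And>x. ((\<lambda>t. f (x + t *\<^sub>R axis i 1)) has_real_derivative f' x) (at 0)"
    and \<psi>: "\<And>x. ((\<lambda>t. \<psi> (x + t *\<^sub>R axis i 1)) has_real_derivative \<psi>' x) (at 0)"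
    and K: "compact K" "\<And>x. x \<notin> K \<Longrightarrow> \<psi> x = 0" "\<And>x. x \<notin> K \<Longrightarrow> \<psi>' x = 0"
  shows "(LINT x|lebesgue. f x * \<psi>' x) = - (LINT x|lebesgue. f' x * \<psi> x)"
proof -
  have "(LINT x|lebesgue. f' x * \<psi> x + f x * \<psi>' x) = 0"
  proof (rule integral_partial_eq_0[of "\<lambda>x. f x * \<psi> x" _ i K])
    show "((\<lambda>t. f (x + t *\<^sub>R axis i 1) * \<psi> (x + t *\<^sub>R axis i 1)) has_real_derivative
        f' x * \<psi> x + f x * \<psi>' x) (at 0)" for x
      using DERIV_mult[OF f[of x] \<psi>[of x]] by (simp add: mult.commute)
  qed (use cont K in \<open>auto intro!: continuous_intros\<close>)
  moreover have "integrable lebesgue (\<lambda>x. f' x * \<psi> x)" "integrable lebesgue (\<lambda>x. f x * \<psi>' x)"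
    using cont K by (auto intro!: integrable_continuous_compact_support(2)[of _ K] continuous_intros)
  ultimately show ?thesis by simp
qed

lemma has_partial_differentiable:
  fixes g :: "real^'d::finite \<Rightarrow> real"
  assumes "g differentiable_on UNIV"
  shows "((\<lambda>t. g (x + t *\<^sub>R axis i 1)) has_real_derivative partial i g x) (at 0)"
proof -
  have "g differentiable (at (x + 0 *\<^sub>R axis i 1))" using assms by (simp add: differentiable_on_def)
  moreover have "(\<lambda>t. x + t *\<^sub>R axis i 1) differentiable (at (0::real))" by simp
  ultimately have "(g \<circ> (\<lambda>t. x + t *\<^sub>R axis i 1)) differentiable (at 0)"
    by (intro differentiable_chain_at)
  then show ?thesis unfolding partial_def o_def by (simp add: DERIV_deriv_iff_real_differentiable)
qed

lemma partial_eq_0: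
  fixes g :: "real^'d::finite \<Rightarrow> real"
  assumes "closed K" "\<And>x. x \<notin> K \<Longrightarrow> g x = 0" "x \<notin> K"
  shows "partial i g x = 0"
  unfolding partial_def
proof (rule DERIV_imp_deriv)
  have "open ((\<lambda>t. x + t *\<^sub>R axis i 1) -` (- K))"
    using assms(1) by (intro open_vimage continuous_intros) auto
  then show "((\<lambda>t. g (x + t *\<^sub>R axis i 1)) has_real_derivative 0) (at 0)"
    by (rule has_field_derivative_transform_within_open[OF DERIV_const[of 0]]) (use assms in auto)
qed

lemma test_functionE:
  assumes "\<phi> \<in> test_functions \<Omega>"
  obtains K where "compact K" "K \<subseteq> \<Omega>" "\<And>is. foldr partial is \<phi> differentiable_on UNIV"
    "\<And>is. continuous_on UNIV (foldr partial is \<phi>)" "\<And>is x. x \<notin> K \<Longrightarrow> foldr partial is \<phi> x = 0"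
proof
  let ?K = "closure {x. \<phi> x \<noteq> 0}"
  show "compact ?K" "?K \<subseteq> \<Omega>" using assms unfolding test_functions_def by auto
  show *: "foldr partial is \<phi> differentiable_on UNIV" for "is"
    using assms unfolding test_functions_def smooth_def by auto
  then show "continuous_on UNIV (foldr partial is \<phi>)" for "is"
    by (rule differentiable_imp_continuous_on)
  show "foldr partial is \<phi> x = 0" if "x \<notin> ?K" for "is" x
    using that
  proof (induction "is" arbitrary: x)
    case Nil
    then show ?case using closure_subset[of "{x. \<phi> x \<noteq> 0}"] by auto
  next
    case (Cons i "is")
    then show ?case using partial_eq_0[OF closed_closure, of "{x. \<phi> x \<noteq> 0}" "foldr partial is \<phi>"] by simp
  qed
qed

lemma test_functionI_dtower:
  assumes "dtower G" "compact K" "K \<subseteq> \<Omega>" "\<And>x. x \<notin> K \<Longrightarrow> G \<alpha> x = 0"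
  shows "G \<alpha> \<in> test_functions \<Omega>"
proof -
  have "closure {x. G \<alpha> x \<noteq> 0} \<subseteq> K"
    using assms by (intro closure_minimal compact_imp_closed) auto
  moreover from this have "compact (closure {x. G \<alpha> x \<noteq> 0})"
    using compact_Int_closed[OF assms(2) closed_closure, of "{x. G \<alpha> x \<noteq> 0}"] by (simp add: Int_absorb1)
  ultimately show ?thesis unfolding test_functions_def using dtower_smooth[OF assms(1)] assms(3) by auto
qed

lemma set_integral_eq_integral:
  fixes f :: "'a \<Rightarrow> real"
  assumes "\<And>x. x \<notin> S \<Longrightarrow> f x = 0"
  shows "(LINT x:S|M. f x) = (LINT x|M. f x)"
  unfolding set_lebesgue_integral_def using assms
  by (intro Bochner_Integration.integral_cong) (auto simp: indicator_def)

lemma dtower_integral_by_parts: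
  assumes G: "dtower G" and \<phi>: "\<phi> \<in> test_functions \<Omega>"
  shows "(LINT x:\<Omega>|lebesgue. G \<beta> x * foldr partial is \<phi> x) =
    (-1) ^ length is * (LINT x:\<Omega>|lebesgue. G (\<lambda>i. \<beta> i + count_list is i) x * \<phi> x)"
proof (induction "is" arbitrary: \<beta>)
  case Nil
  then show ?case by simp
next
  case (Cons i "is")
  obtain K where K: "compact K" "K \<subseteq> \<Omega>" "\<And>is. foldr partial is \<phi> differentiable_on UNIV"
    "\<And>is. continuous_on UNIV (foldr partial is \<phi>)" "\<And>is x. x \<notin> K \<Longrightarrow> foldr partial is \<phi> x = 0"
    by (rule test_functionE[OF \<phi>]) blast
  have z: "x \<notin> \<Omega> \<Longrightarrow> foldr partial is \<phi> x = 0" for "is" x using K(2,5) by blast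
  let ?\<beta> = "\<beta>(i := Suc (\<beta> i))"
  have "(LINT x:\<Omega>|lebesgue. G \<beta> x * foldr partial (i # is) \<phi> x) =
      (LINT x|lebesgue. G \<beta> x * foldr partial (i # is) \<phi> x)"
    using z[of _ "i # is"] by (intro set_integral_eq_integral) auto
  also have "\<dots> = - (LINT x|lebesgue. G ?\<beta> x * foldr partial is \<phi> x)"
  proof (rule integral_by_parts_partial[OF _ _ _ _ _ _ K(1)])
    show "((\<lambda>t. G \<beta> (x + t *\<^sub>R axis i 1)) has_real_derivative G ?\<beta> x) (at 0)" for x
      using G unfolding dtower_def by auto
    show "((\<lambda>t. foldr partial is \<phi> (x + t *\<^sub>R axis i 1)) has_real_derivative
        foldr partial (i # is) \<phi> x) (at 0)" for x
      using has_partial_differentiable[OF K(3)[of "is"]] by simp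
  qed (use K(4,5) dtower_continuous[OF G] in blast)+
  also have "(LINT x|lebesgue. G ?\<beta> x * foldr partial is \<phi> x) =
      (LINT x:\<Omega>|lebesgue. G ?\<beta> x * foldr partial is \<phi> x)"
    using z[of _ "is"] by (intro set_integral_eq_integral[symmetric]) auto
  also have "\<dots> = (-1) ^ length is * (LINT x:\<Omega>|lebesgue. G (\<lambda>j. ?\<beta> j + count_list is j) x * \<phi> x)"
    by (rule Cons.IH)
  also have "(\<lambda>j. ?\<beta> j + count_list is j) = (\<lambda>j. \<beta> j + count_list (i # is) j)" by auto
  finally show ?case by simp
qed

lemma locally_integrable_continuous:
  assumes "continuous_on UNIV f"
  shows "locally_integrable \<Omega> f"
  unfolding locally_integrable_def
proof (intro allI impI)
  fix K assume K: "compact K \<and> K \<subseteq> \<Omega>"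
  then obtain a where a: "K \<subseteq> cbox (- a) a" using bounded_subset_cbox_symmetric compact_imp_bounded by blast
  have "f absolutely_integrable_on cbox (- a) a"
    using assms by (intro absolutely_integrable_continuous) (auto intro: continuous_on_subset)
  then show "f absolutely_integrable_on K"
    using K a by (auto intro: set_integrable_subset simp: compact_imp_closed lmeasurable_compact fmeasurableD)
qed

lemma has_weak_deriv_dtower:
  assumes "dtower G"
  shows "has_weak_deriv \<Omega> \<alpha> (G (\<lambda>_. 0)) (G \<alpha>)"
  unfolding has_weak_deriv_def
proof (intro conjI ballI)
  show "locally_integrable \<Omega> (G (\<lambda>_. 0))" "locally_integrable \<Omega> (G \<alpha>)"
    by (intro locally_integrable_continuous dtower_continuous[OF assms])+
  fix \<phi> assume \<phi>: "\<phi> \<in> test_functions \<Omega>"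
  obtain "is" where "\<And>f. classical_deriv \<alpha> f = foldr partial is f" "count_list is = \<alpha>"
    "length is = order_mi \<alpha>"
    using classical_deriv_eq_foldr by blast
  then show "(LINT x:\<Omega>|lebesgue. G (\<lambda>_. 0) x * classical_deriv \<alpha> \<phi> x) =
      (-1) ^ order_mi \<alpha> * (LINT x:\<Omega>|lebesgue. G \<alpha> x * \<phi> x)"
    using dtower_integral_by_parts[OF assms \<phi>, of "\<lambda>_. 0" "is"] by simp
qed

section \<open>Uniqueness of weak derivatives\<close>

text \<open>Open boxes are stable under intersection and generate the Borel sets. The vanishing of
  integrals extends by Dynkin's argument, and \<open>total\<close> handles the complements.\<close>

lemma AE_0_if_box_integrals_0:
  fixes H :: "'a::euclidean_space \<Rightarrow> real"
  assumes H: "integrable lborel H" and total: "(LINT x|lborel. H x) = 0"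
    and box: "\<And>c d. (LINT x:box c d|lborel. H x) = 0"
  shows "AE x in lborel. H x = 0"
proof -
  have set_int: "set_integrable lborel A H" if "A \<in> sets borel" for A
    using integrable_mult_indicator[OF _ H, of A] that unfolding set_integrable_def by simp
  have "(LINT x:A|lborel. H x) = 0" if "A \<in> sets borel" for A :: "'a set"
  proof -
    let ?B = "range (\<lambda>(a, b). box a b :: 'a set)"
    have borel: "sigma_sets UNIV ?B = sets borel"
      by (subst borel_eq_box) simp
    have "Int_stable ?B" by (auto simp: Int_stable_def box_Int_box)
    moreover have "?B \<subseteq> Pow UNIV" by auto
    moreover have "A \<in> sigma_sets UNIV ?B" using that borel by simp
    ultimately show ?thesis
    proof (induction rule: sigma_sets_induct_disjoint)
      case (basic A)
      then show ?case using box by auto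
    next
      case empty
      show ?case by (simp add: set_lebesgue_integral_def)
    next
      case (compl A)
      then have A: "A \<in> sets borel" using borel by simp
      have "(LINT x:A \<union> (UNIV - A)|lborel. H x) = (LINT x:A|lborel. H x) + (LINT x:UNIV - A|lborel. H x)"
        using A by (intro set_integral_Un set_int) auto
      then show ?case using compl total by (simp add: set_lebesgue_integral_def)
    next
      case (union A)
      then have A: "A i \<in> sets borel" for i using borel by auto
      have "(LINT x:(\<Union>i. A i)|lborel. H x) = (\<Sum>i. (LINT x:A i|lborel. H x))"
        using A union by (intro lebesgue_integral_countable_add set_int) (auto simp: disjoint_family_on_def)
      then show ?case using union by simp
    qed
  qed
  then have "AE x in lborel. H x = (\<lambda>_. 0) x"
    using H by (intro density_unique_real) (auto simp: set_lebesgue_integral_def)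
  then show ?thesis by simp
qed

lemma continuous_borel_measurable_lebesgue:
  fixes f :: "'a::euclidean_space \<Rightarrow> real"
  assumes "continuous_on UNIV f"
  shows "f \<in> borel_measurable lebesgue"
proof -
  have "f \<in> borel_measurable lborel" using borel_measurable_continuous_onI[OF assms] by simp
  then show ?thesis by (rule measurable_completion)
qed

lemma test_function_prod:
  fixes f :: "'d::finite \<Rightarrow> real \<Rightarrow> real"
  assumes "\<And>i. smooth1 (f i)" "\<And>i t. t < vec_nth a i \<or> vec_nth b i < t \<Longrightarrow> f i t = 0"
    and "cbox a b \<subseteq> \<Omega>"
  shows "(\<lambda>x. \<Prod>i\<in>UNIV. f i (vec_nth x i)) \<in> test_functions \<Omega>"
proof -
  have "(\<lambda>x. \<Prod>i\<in>UNIV. (deriv ^^ 0) (f i) (vec_nth x i)) \<in> test_functions \<Omega>"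
  proof (rule test_functionI_dtower[OF dtower_prod[OF assms(1)], of "cbox a b"])
    fix x :: "real^'d" assume "x \<notin> cbox a b"
    then obtain i where "vec_nth x i < vec_nth a i \<or> vec_nth b i < vec_nth x i"
      by (auto simp: mem_box_cart not_le)
    then show "(\<Prod>i\<in>UNIV. (deriv ^^ 0) (f i) (vec_nth x i)) = 0"
      using assms(2) by (intro prod_zero) auto
  qed (use assms in auto)
  then show ?thesis by simp
qed

lemma box_integral_eq_0:
  fixes h :: "real^'d::finite \<Rightarrow> real"
  assumes h: "locally_integrable \<Omega> h"
    and 0: "\<And>\<phi>. \<phi> \<in> test_functions \<Omega> \<Longrightarrow> (LINT x:\<Omega>|lebesgue. h x * \<phi> x) = 0"
    and sub: "cbox c d \<subseteq> \<Omega>"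
  shows "(LINT x:box c d|lebesgue. h x) = 0"
proof -
  \<comment> \<open>Since \<open>bump\<close> takes values in the half-open interval from 0
    (excluded) to 1 inside and is 0 outside, these test functions are bounded by 1 and converge
    pointwise to the indicator of the open box.\<close>
  define \<kappa> where "\<kappa> = (\<lambda>j (x::real^'d). \<Prod>i\<in>UNIV. 1 - (1 - bump (vec_nth c i) (vec_nth d i) (vec_nth x i)) ^ j)"
  define h' where "h' = (\<lambda>x. indicator (cbox c d) x * h x)"
  have h': "integrable lebesgue h'"
    using h sub unfolding locally_integrable_def h'_def set_integrable_def by simp
  have test: "\<kappa> j \<in> test_functions \<Omega>" for j
    unfolding \<kappa>_def using sub
    by (intro test_function_prod[of "\<lambda>i t. 1 - (1 - bump (vec_nth c i) (vec_nth d i) t) ^ j" c d \<Omega>])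
      (auto intro!: smooth1_diff smooth1_power smooth1_const smooth1_bump simp: bump_eq_0)
  have range: "0 \<le> \<kappa> j x \<and> \<kappa> j x \<le> 1" for j x
    unfolding \<kappa>_def
    by (intro conjI prod_nonneg prod_le_1) (auto simp: bump_le_1 bump_nonneg intro!: power_le_one)
  have outside: "\<kappa> j x = 0" if "x \<notin> box c d" for j x
  proof -
    obtain i where "vec_nth x i \<le> vec_nth c i \<or> vec_nth d i \<le> vec_nth x i"
      using \<open>x \<notin> box c d\<close> by (auto simp: mem_box_cart not_less)
    then show ?thesis unfolding \<kappa>_def by (intro prod_zero bexI[of _ i]) (auto simp: bump_eq_0)
  qed
  have "(\<lambda>j. LINT x|lebesgue. h' x * \<kappa> j x) \<longlonglongrightarrow> (LINT x|lebesgue. indicator (box c d) x * h x)"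
  proof (rule integral_dominated_convergence[where w = "\<lambda>x. \<bar>h' x\<bar>"])
    show "integrable lebesgue (\<lambda>x. \<bar>h' x\<bar>)" using h' by simp
    have "(\<lambda>x. indicator (box c d) x * h' x) \<in> borel_measurable lebesgue"
      using h' by (intro borel_measurable_times borel_measurable_indicator) auto
    also have "(\<lambda>x. indicator (box c d) x * h' x) = (\<lambda>x. indicator (box c d) x * h x)"
      unfolding h'_def using box_subset_cbox[of c d] by (auto simp: indicator_def fun_eq_iff)
    finally show "(\<lambda>x. indicator (box c d) x * h x) \<in> borel_measurable lebesgue" .
    show "(\<lambda>x. h' x * \<kappa> j x) \<in> borel_measurable lebesgue" for j
    proof -
      have "continuous_on UNIV (\<kappa> j)" using test_functionE[OF test[of j]] by (metis foldr.simps(1) id_apply)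
      then have "\<kappa> j \<in> borel_measurable lebesgue"
        by (rule continuous_borel_measurable_lebesgue)
      then show ?thesis using h' by (intro borel_measurable_times) auto
    qed
    show "AE x in lebesgue. (\<lambda>j. h' x * \<kappa> j x) \<longlonglongrightarrow> indicator (box c d) x * h x"
    proof (intro AE_I2)
      fix x
      show "(\<lambda>j. h' x * \<kappa> j x) \<longlonglongrightarrow> indicator (box c d) x * h x"
      proof (cases "x \<in> box c d")
        case True
        have lim: "(\<lambda>j. (1 - bump (vec_nth c i) (vec_nth d i) (vec_nth x i)) ^ j) \<longlonglongrightarrow> 0" for i
          using True bump_pos[of "vec_nth c i" "vec_nth d i" "vec_nth x i"] bump_le_1[of "vec_nth c i" "vec_nth d i" "vec_nth x i"]
          by (intro LIMSEQ_realpow_zero) (auto simp: mem_box_cart)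
        have "(\<lambda>j. h' x * \<kappa> j x) \<longlonglongrightarrow> h' x * (\<Prod>i\<in>(UNIV::'d set). 1 - 0)"
          unfolding \<kappa>_def by (intro tendsto_mult tendsto_const tendsto_prod tendsto_diff lim)
        then show ?thesis using True box_subset_cbox[of c d] unfolding h'_def by (auto simp: indicator_def)
      next
        case False
        then show ?thesis using outside by simp
      qed
    qed
    show "AE x in lebesgue. norm (h' x * \<kappa> j x) \<le> \<bar>h' x\<bar>" for j
      using range[of j] by (auto simp: abs_mult intro!: AE_I2 mult_left_le)
  qed
  moreover have "(LINT x|lebesgue. h' x * \<kappa> j x) = 0" for j
  proof -
    have "(LINT x|lebesgue. h' x * \<kappa> j x) = (LINT x|lebesgue. h x * \<kappa> j x)"
      unfolding h'_def using outside[of _ j] box_subset_cbox[of c d]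
      by (intro Bochner_Integration.integral_cong) (auto simp: indicator_def)
    also have "\<dots> = (LINT x:\<Omega>|lebesgue. h x * \<kappa> j x)"
      using outside[of _ j] box_subset_cbox[of c d] sub
      by (intro set_integral_eq_integral[symmetric]) auto
    finally show ?thesis using 0[OF test] by simp
  qed
  ultimately show ?thesis by (simp add: set_lebesgue_integral_def LIMSEQ_const_iff)
qed

text \<open>\<open>h\<close> is cut off to the box and replaced by a Borel version, for which
  vanishing integrals over all boxes suffice. A box meeting \<open>box a b\<close> may be
  intersected with it first, since the intersection is again a box inside \<Omega>.\<close>

lemma AE_0_on_box:
  fixes h :: "real^'d::finite \<Rightarrow> real"
  assumes h: "locally_integrable \<Omega> h"
    and 0: "\<And>\<phi>. \<phi> \<in> test_functions \<Omega> \<Longrightarrow> (LINT x:\<Omega>|lebesgue. h x * \<phi> x) = 0"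
    and sub: "cbox a b \<subseteq> \<Omega>"
  shows "AE x in lebesgue. x \<in> box a b \<longrightarrow> h x = 0"
proof -
  define H where "H = (\<lambda>x. indicator (box a b) x * h x)"
  have "set_integrable lebesgue (cbox a b) h"
    using h sub unfolding locally_integrable_def by simp
  then have "set_integrable lebesgue (box a b) h"
    by (rule set_integrable_subset) (auto simp: box_subset_cbox)
  then have H: "integrable lebesgue H" unfolding H_def set_integrable_def by simp
  then obtain H' where H': "H' \<in> borel_measurable lborel" "AE x in lborel. H x = H' x"
    using completion_ex_borel_measurable_real[of H lborel] by auto
  have AE: "AE x in lebesgue. H x = H' x" using H'(2) by (rule AE_completion)
  have H'_meas: "H' \<in> borel_measurable lebesgue" using H'(1) by (rule measurable_completion)
  have "integrable lebesgue H'"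
    using integrable_cong_AE[OF _ H'_meas AE] H by auto
  then have int: "integrable lborel H'" using integrable_completion H'(1) by blast
  have box0: "(LINT x:box c d|lborel. H' x) = 0" for c d
  proof -
    have "(LINT x:box c d|lborel. H' x) = (LINT x:box c d|lebesgue. H' x)"
      unfolding set_lebesgue_integral_def using H'(1) by (intro integral_completion[symmetric]) auto
    also have "\<dots> = (LINT x:box c d|lebesgue. H x)"
      using AE H H'_meas unfolding set_lebesgue_integral_def
      by (intro integral_cong_AE borel_measurable_scaleR borel_measurable_indicator) auto
    also have "\<dots> = (LINT x:box c d \<inter> box a b|lebesgue. h x)"
      unfolding set_lebesgue_integral_def H_def
      by (intro Bochner_Integration.integral_cong) (auto simp: indicator_def)
    also have "\<dots> = 0"
    proof (cases "box c d \<inter> box a b = {}")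
      case False
      then obtain c' d' where cd: "box c d \<inter> box a b = box c' d'" by (simp add: box_Int_box)
      have "box c' d' \<noteq> {}" "box a b \<noteq> {}" using False cd by auto
      then have "closure (box c' d') = cbox c' d'" "closure (box a b) = cbox a b"
        by (auto intro!: closure_box)
      then have "cbox c' d' \<subseteq> cbox a b" using cd by (metis Int_lower2 closure_mono)
      then show ?thesis unfolding cd using box_integral_eq_0[OF h 0] sub by auto
    qed (simp add: set_lebesgue_integral_def)
    finally show ?thesis .
  qed
  have "AE x in lborel. H' x = 0"
  proof (rule AE_0_if_box_integrals_0[OF int _ box0])
    have "(LINT x|lborel. H' x) = (LINT x:box a b|lborel. H' x)"
      unfolding set_lebesgue_integral_def
    proof (rule integral_cong_AE)
      show "AE x in lborel. H' x = indicator (box a b) x *\<^sub>R H' x"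
        using H'(2) by eventually_elim (auto simp: H_def indicator_def split: if_splits)
    qed (use H'(1) in auto)
    then show "(LINT x|lborel. H' x) = 0" using box0 by simp
  qed
  then have "AE x in lebesgue. H' x = 0" by (rule AE_completion)
  then show ?thesis using AE by eventually_elim (auto simp: H_def)
qed

text \<open>An open set is a countable union of closed boxes, and the frontiers of these are null
  sets.\<close>

lemma AE_0_on_open:
  fixes h :: "real^'d::finite \<Rightarrow> real"
  assumes "open \<Omega>" "locally_integrable \<Omega> h"
    and "\<And>\<phi>. \<phi> \<in> test_functions \<Omega> \<Longrightarrow> (LINT x:\<Omega>|lebesgue. h x * \<phi> x) = 0"
  shows "AE x in lebesgue. x \<in> \<Omega> \<longrightarrow> h x = 0"
proof -
  obtain \<D> where \<D>: "countable \<D>" "\<D> \<subseteq> Pow \<Omega>" "\<And>X. X \<in> \<D> \<Longrightarrow> \<exists>a b. X = cbox a b" "\<Union>\<D> = \<Omega>"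
    using open_countable_Union_open_cbox[OF assms(1)] by blast
  have "AE x in lebesgue. x \<in> X \<longrightarrow> h x = 0" if X: "X \<in> \<D>" for X
  proof -
    obtain a b where ab: "X = cbox a b" using \<D>(3)[OF X] by blast
    have "cbox a b - box a b \<in> null_sets lebesgue"
      using negligible_frontier_interval[of a b] by (simp add: negligible_iff_null_sets)
    then have "AE x in lebesgue. x \<notin> cbox a b - box a b" by (rule AE_not_in)
    moreover have "AE x in lebesgue. x \<in> box a b \<longrightarrow> h x = 0"
      using \<D>(2) X ab by (intro AE_0_on_box[OF assms(2,3)]) auto
    ultimately show ?thesis unfolding ab by eventually_elim auto
  qed
  then have "AE x in lebesgue. \<forall>X\<in>\<D>. x \<in> X \<longrightarrow> h x = 0"
    using \<D>(1) by (subst AE_ball_countable) auto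
  then show ?thesis by eventually_elim (use \<D>(4) in blast)
qed

lemma integrable_locally_integrable_mult_test:
  fixes g :: "real^'d::finite \<Rightarrow> real"
  assumes g: "locally_integrable \<Omega> g" and \<phi>: "\<phi> \<in> test_functions \<Omega>"
  shows "integrable lebesgue (\<lambda>x. indicator \<Omega> x * (g x * \<phi> x))"
proof -
  obtain K where K: "compact K" "K \<subseteq> \<Omega>" "\<And>is. foldr partial is \<phi> differentiable_on UNIV"
    "\<And>is. continuous_on UNIV (foldr partial is \<phi>)" "\<And>is x. x \<notin> K \<Longrightarrow> foldr partial is \<phi> x = 0"
    by (rule test_functionE[OF \<phi>]) blast
  have cont: "continuous_on UNIV \<phi>" and out: "\<And>x. x \<notin> K \<Longrightarrow> \<phi> x = 0"
    using K(4)[of "[]"] K(5)[of _ "[]"] by auto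
  have "bounded (\<phi> ` K)"
    using K(1) cont by (intro compact_imp_bounded compact_continuous_image) (auto intro: continuous_on_subset)
  then obtain B0 where B0: "\<And>x. x \<in> K \<Longrightarrow> \<bar>\<phi> x\<bar> \<le> B0" unfolding bounded_real by auto
  have B: "\<bar>\<phi> x\<bar> \<le> \<bar>B0\<bar>" for x using B0[of x] out[of x] by (cases "x \<in> K") auto
  have gK: "integrable lebesgue (\<lambda>x. indicator K x * g x)"
    using g K unfolding locally_integrable_def set_integrable_def by simp
  have "\<phi> \<in> borel_measurable lebesgue"
    using cont by (rule continuous_borel_measurable_lebesgue)
  then have "integrable lebesgue (\<lambda>x. (indicator K x * g x) * \<phi> x)"
    using B gK by (intro Bochner_Integration.integrable_bound[OF integrable_mult_right[OF gK, of "\<bar>B0\<bar>"]])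
      (auto simp: abs_mult mult.commute intro!: AE_I2 mult_right_mono)
  also have "(\<lambda>x. (indicator K x * g x) * \<phi> x) = (\<lambda>x. indicator \<Omega> x * (g x * \<phi> x))"
    using K(2) out by (auto simp: indicator_def fun_eq_iff)
  finally show ?thesis .
qed

lemma has_weak_deriv_unique_AE:
  fixes f :: "real^'d::finite \<Rightarrow> real"
  assumes "open \<Omega>" and g: "has_weak_deriv \<Omega> \<alpha> f g1" "has_weak_deriv \<Omega> \<alpha> f g2"
  shows "AE x in lebesgue_on \<Omega>. g1 x = g2 x"
proof -
  have li: "locally_integrable \<Omega> g1" "locally_integrable \<Omega> g2"
    using g unfolding has_weak_deriv_def by auto
  have "AE x in lebesgue. x \<in> \<Omega> \<longrightarrow> g1 x - g2 x = 0"
  proof (rule AE_0_on_open[OF \<open>open \<Omega>\<close>])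
    show "locally_integrable \<Omega> (\<lambda>x. g1 x - g2 x)"
      using li unfolding locally_integrable_def by (auto intro: set_integral_diff(1))
    fix \<phi> assume \<phi>: "\<phi> \<in> test_functions \<Omega>"
    have "(-1) ^ order_mi \<alpha> * (LINT x:\<Omega>|lebesgue. g1 x * \<phi> x) = (-1) ^ order_mi \<alpha> * (LINT x:\<Omega>|lebesgue. g2 x * \<phi> x)"
    proof -
      have "(LINT x:\<Omega>|lebesgue. f x * classical_deriv \<alpha> \<phi> x) =
          (-1) ^ order_mi \<alpha> * (LINT x:\<Omega>|lebesgue. g1 x * \<phi> x)"
        using g(1) \<phi> unfolding has_weak_deriv_def by blast
      moreover have "(LINT x:\<Omega>|lebesgue. f x * classical_deriv \<alpha> \<phi> x) =
          (-1) ^ order_mi \<alpha> * (LINT x:\<Omega>|lebesgue. g2 x * \<phi> x)"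
        using g(2) \<phi> unfolding has_weak_deriv_def by blast
      ultimately show ?thesis by (rule trans[OF sym])
    qed
    then have "(LINT x:\<Omega>|lebesgue. g1 x * \<phi> x) = (LINT x:\<Omega>|lebesgue. g2 x * \<phi> x)" by simp
    then show "(LINT x:\<Omega>|lebesgue. (g1 x - g2 x) * \<phi> x) = 0"
      using integrable_locally_integrable_mult_test[OF li(1) \<phi>] integrable_locally_integrable_mult_test[OF li(2) \<phi>]
      unfolding set_lebesgue_integral_def by (simp add: left_diff_distrib right_diff_distrib)
  qed
  moreover have "\<Omega> \<in> sets lebesgue" using \<open>open \<Omega>\<close> by simp
  ultimately show ?thesis by (subst AE_restrict_space_iff) auto
qed

section \<open>Sobolev norms of functions with a tower of derivatives\<close>

lemma weak_deriv_dtower_AE: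
  assumes "open \<Omega>" "dtower G"
  shows "AE x in lebesgue_on \<Omega>. weak_deriv \<Omega> \<alpha> (G (\<lambda>_. 0)) x = G \<alpha> x"
proof -
  have "has_weak_deriv \<Omega> \<alpha> (G (\<lambda>_. 0)) (weak_deriv \<Omega> \<alpha> (G (\<lambda>_. 0)))"
    unfolding weak_deriv_def 
    by (rule someI[of "has_weak_deriv \<Omega> \<alpha> (G (\<lambda>_. 0))", OF has_weak_deriv_dtower[OF assms(2)]])
  then show ?thesis using has_weak_deriv_unique_AE[OF assms(1)] has_weak_deriv_dtower[OF assms(2)] by blast
qed

lemma finite_order_mi_le: "finite {\<alpha> :: 'd::finite multiindex. order_mi \<alpha> \<le> n}"
proof (rule finite_subset)
  show "{\<alpha> :: 'd multiindex. order_mi \<alpha> \<le> n} \<subseteq> PiE UNIV (\<lambda>_. {..n})"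
  proof
    fix \<alpha> :: "'d multiindex" assume "\<alpha> \<in> {\<alpha>. order_mi \<alpha> \<le> n}"
    then have "\<alpha> i \<le> n" for i
      using member_le_sum[of i UNIV \<alpha>] unfolding order_mi_def by simp
    then show "\<alpha> \<in> PiE UNIV (\<lambda>_. {..n})" by auto
  qed
qed (auto intro: finite_PiE)

lemma sobolev_inf_norm_dtower_le:
  fixes \<Omega> :: "(real^'d::finite) set"
  assumes \<Omega>: "open \<Omega>" and G: "dtower G"
    and B: "\<And>\<alpha> x. order_mi \<alpha> \<le> n \<Longrightarrow> \<bar>G \<alpha> x\<bar> \<le> B"
  shows "G (\<lambda>_. 0) \<in> sobolev_inf n \<Omega>" "sobolev_inf_norm n \<Omega> (G (\<lambda>_. 0)) \<le> ereal B"
proof -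
  have \<Omega>': "\<Omega> \<in> sets lebesgue" using \<Omega> by simp
  have meas: "G \<alpha> \<in> borel_measurable (lebesgue_on \<Omega>)" for \<alpha>
    using \<Omega>' by (intro continuous_imp_measurable_on_sets_lebesgue dtower_continuous[OF G]) auto
  have le: "Linf_norm \<Omega> g \<le> ereal B" if "order_mi \<alpha> \<le> n" "AE x in lebesgue_on \<Omega>. g x = G \<alpha> x" 
    "g \<in> borel_measurable (lebesgue_on \<Omega>)" for g \<alpha>
    unfolding Linf_norm_def
  proof (rule esssup_I)
    show "(\<lambda>x. ereal \<bar>g x\<bar>) \<in> borel_measurable (lebesgue_on \<Omega>)" using that by measurable
    show "AE x in lebesgue_on \<Omega>. ereal \<bar>g x\<bar> \<le> ereal B"
      using that(2) by eventually_elim (use B[OF that(1)] in auto)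
  qed
  \<comment> \<open>Measurability of the chosen representative is part of a finite
    \<open>Linf_norm\<close>. It is inherited from \<open>G \<alpha>\<close> by completeness of
    Lebesgue measure.\<close>
  have AEmeas: "g \<in> borel_measurable (lebesgue_on \<Omega>)" if "AE x in lebesgue_on \<Omega>. g x = G \<alpha> x" for g \<alpha>
  proof -
    let ?g = "\<lambda>x. if x \<in> \<Omega> then g x else 0" and ?h = "\<lambda>x. if x \<in> \<Omega> then G \<alpha> x else 0"
    have "AE x in lebesgue. x \<in> \<Omega> \<longrightarrow> g x = G \<alpha> x" using that \<Omega>' by (simp add: AE_restrict_space_iff)
    then have AE: "AE x in lebesgue. ?h x = ?g x" by eventually_elim auto
    have h: "?h \<in> borel_measurable lebesgue" using meas[of \<alpha>] \<Omega>' by (simp add: borel_measurable_if)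
    have "?g \<in> borel_measurable lebesgue"
    proof (rule measurableI)
      fix S :: "real set" assume "S \<in> sets borel"
      then have "?h -` S \<inter> space lebesgue \<in> sets lebesgue" using h by (rule measurable_sets[rotated])
      moreover have "AE x in lebesgue. x \<in> ?h -` S \<inter> space lebesgue \<longleftrightarrow> x \<in> ?g -` S \<inter> space lebesgue"
        using AE by eventually_elim simp
      ultimately show "?g -` S \<inter> space lebesgue \<in> sets lebesgue"
        by (intro completion.in_sets_AE[of "?h -` S \<inter> space lebesgue" "?g -` S \<inter> space lebesgue" lborel]) auto
    qed simp
    then show ?thesis using \<Omega>' by (simp add: borel_measurable_if)
  qed
  show mem: "G (\<lambda>_. 0) \<in> sobolev_inf n \<Omega>"
    unfolding sobolev_inf_def
  proof (intro CollectI allI impI exI conjI)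
    fix \<alpha> :: "'d multiindex" assume "order_mi \<alpha> \<le> n"
    show "has_weak_deriv \<Omega> \<alpha> (G (\<lambda>_. 0)) (G \<alpha>)" by (rule has_weak_deriv_dtower[OF G])
    have "Linf_norm \<Omega> (G \<alpha>) \<le> ereal B" by (rule le[OF \<open>order_mi \<alpha> \<le> n\<close> _ meas]) simp
    then show "Linf_norm \<Omega> (G \<alpha>) < \<infinity>" by auto
  qed
  have "Linf_norm \<Omega> (weak_deriv \<Omega> \<alpha> (G (\<lambda>_. 0))) \<le> ereal B" if "order_mi \<alpha> \<le> n" for \<alpha>
    using le[OF that] AEmeas weak_deriv_dtower_AE[OF \<Omega> G] by blast
  moreover have "{\<alpha> :: 'd multiindex. order_mi \<alpha> \<le> n} \<noteq> {}"
    by (auto simp: order_mi_def intro!: exI[of _ "\<lambda>_. 0"])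
  ultimately show "sobolev_inf_norm n \<Omega> (G (\<lambda>_. 0)) \<le> ereal B"
    unfolding sobolev_inf_norm_def using mem finite_order_mi_le[of n]
    by (simp only: if_True, subst Max_le_iff) auto
qed

lemma weak_deriv_bound:
  fixes \<Omega> :: "(real^'d::finite) set"
  assumes "open \<Omega>" and norm: "sobolev_inf_norm n \<Omega> u \<le> ereal e" and \<alpha>: "order_mi \<alpha> \<le> n"
  obtains g where "has_weak_deriv \<Omega> \<alpha> u g" "AE x in lebesgue_on \<Omega>. \<bar>g x\<bar> \<le> e"
proof
  have mem: "u \<in> sobolev_inf n \<Omega>" using norm unfolding sobolev_inf_norm_def by (auto split: if_splits)
  then show "has_weak_deriv \<Omega> \<alpha> u (weak_deriv \<Omega> \<alpha> u)"
    unfolding weak_deriv_def sobolev_inf_def using \<alpha> by (metis (mono_tags, lifting) mem_Collect_eq someI_ex)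
  have "Linf_norm \<Omega> (weak_deriv \<Omega> \<alpha> u) \<le> (MAX \<alpha>\<in>{\<alpha>. order_mi \<alpha> \<le> n}. Linf_norm \<Omega> (weak_deriv \<Omega> \<alpha> u))"
    using finite_order_mi_le \<alpha> by (intro Max_ge) auto
  also have "\<dots> \<le> ereal e" using norm mem unfolding sobolev_inf_norm_def by simp
  finally have le: "Linf_norm \<Omega> (weak_deriv \<Omega> \<alpha> u) \<le> ereal e" .
  have "AE x in lebesgue_on \<Omega>. ereal \<bar>weak_deriv \<Omega> \<alpha> u x\<bar> \<le> Linf_norm \<Omega> (weak_deriv \<Omega> \<alpha> u)"
    unfolding Linf_norm_def by (rule esssup_AE)
  then show "AE x in lebesgue_on \<Omega>. \<bar>weak_deriv \<Omega> \<alpha> u x\<bar> \<le> e"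
  proof eventually_elim
    case (elim x)
    then have "ereal \<bar>weak_deriv \<Omega> \<alpha> u x\<bar> \<le> ereal e" using le by (rule order.trans)
    then show ?case by simp
  qed
qed

section \<open>Pointwise bounds from weak derivatives\<close>

lemma integral_mult_bump_pos:
  fixes w :: "real^'d::finite \<Rightarrow> real"
  assumes w: "continuous_on UNIV w" and pos: "\<And>x. x \<in> cbox a b \<Longrightarrow> w x > 0" and ne: "box a b \<noteq> {}"
    and \<eta>: "continuous_on UNIV \<eta>" "\<And>x. x \<in> box a b \<Longrightarrow> \<eta> x > 0" "\<And>x. x \<notin> box a b \<Longrightarrow> \<eta> x = 0"
  shows "(LINT x|lebesgue. w x * \<eta> x) > 0"
proof -
  have int: "integrable lebesgue (\<lambda>x. w x * \<eta> x)"
    using w \<eta> box_subset_cbox[of a b]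
    by (intro integrable_continuous_compact_support(2)[of _ "cbox a b"]) (auto intro!: continuous_intros)
  have nn: "w x * \<eta> x \<ge> 0" for x
    using pos[of x] \<eta>(2,3)[of x] box_subset_cbox[of a b] by (cases "x \<in> box a b") (auto intro: less_imp_le)
  have "(LINT x|lebesgue. w x * \<eta> x) \<noteq> 0"
  proof
    assume "(LINT x|lebesgue. w x * \<eta> x) = 0"
    then have "AE x in lebesgue. w x * \<eta> x = 0"
      using integral_nonneg_eq_0_iff_AE[OF int] nn by simp
    then have "AE x in lebesgue. x \<notin> box a b"
    proof eventually_elim
      case (elim x)
      then show ?case using pos[of x] \<eta>(2)[of x] box_subset_cbox[of a b] by auto
    qed
    then have "negligible (box a b)"
      by (simp add: negligible_iff_null_sets completion.AE_iff_null_sets[of _ lborel])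
    then show False using ne negligible_interval(2) by blast
  qed
  moreover have "(LINT x|lebesgue. w x * \<eta> x) \<ge> 0" using nn by (intro integral_nonneg_AE) auto
  ultimately show ?thesis by simp
qed

definition box_bump :: "real^'d::finite \<Rightarrow> real^'d \<Rightarrow> real^'d \<Rightarrow> real" where
  "box_bump a b x = (\<Prod>i\<in>UNIV. bump (vec_nth a i) (vec_nth b i) (vec_nth x i))"

lemma box_bump_pos: "x \<in> box a b \<Longrightarrow> box_bump a b x > 0"
  unfolding box_bump_def by (intro prod_pos) (auto simp: mem_box_cart bump_pos)

lemma box_bump_eq_0: "x \<notin> box a b \<Longrightarrow> box_bump a b x = 0"
proof -
  assume "x \<notin> box a b"
  then obtain i where "vec_nth x i \<le> vec_nth a i \<or> vec_nth b i \<le> vec_nth x i"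
    by (auto simp: mem_box_cart not_less)
  then show ?thesis unfolding box_bump_def by (intro prod_zero bexI[of _ i]) (auto simp: bump_eq_0)
qed

lemma box_bump_nonneg: "box_bump a b x \<ge> 0"
  unfolding box_bump_def by (intro prod_nonneg) (auto simp: bump_nonneg)

lemma test_function_box_bump: "cbox a b \<subseteq> \<Omega> \<Longrightarrow> box_bump a b \<in> test_functions \<Omega>"
  unfolding box_bump_def[abs_def]
  by (intro test_function_prod[of "\<lambda>i. bump (vec_nth a i) (vec_nth b i)" a b]) (auto simp: smooth1_bump bump_eq_0)

lemma continuous_test_function: "\<phi> \<in> test_functions \<Omega> \<Longrightarrow> continuous_on S \<phi>"
proof -
  assume "\<phi> \<in> test_functions \<Omega>"
  then have "foldr partial [] \<phi> differentiable_on UNIV" unfolding test_functions_def smooth_def by blast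
  then have "continuous_on UNIV \<phi>" using differentiable_imp_continuous_on by simp
  then show ?thesis by (rule continuous_on_subset) simp
qed

lemma continuous_on_box_bump: "continuous_on S (box_bump a b)"
  using continuous_test_function[OF test_function_box_bump[OF subset_refl]] .

lemma dtower_classical_deriv:
  assumes "dtower G"
  shows "classical_deriv \<alpha> (G (\<lambda>_. 0)) = G \<alpha>"
proof -
  obtain "is" where "\<And>f. classical_deriv \<alpha> f = foldr partial is f" "count_list is = \<alpha>"
    "length is = order_mi \<alpha>"
    using classical_deriv_eq_foldr by blast
  then show ?thesis using dtower_foldr_partial[OF assms, of "is" "\<lambda>_. 0"] by simp
qed

lemma set_integral_le_const:
  fixes g :: "real^'d::finite \<Rightarrow> real"
  assumes \<Omega>: "open \<Omega>" and g: "locally_integrable \<Omega> g" "AE x in lebesgue_on \<Omega>. g x \<le> e"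
    and \<phi>: "\<phi> \<in> test_functions \<Omega>" "\<And>x. \<phi> x \<ge> 0"
  shows "(LINT x:\<Omega>|lebesgue. g x * \<phi> x) \<le> (LINT x:\<Omega>|lebesgue. e * \<phi> x)"
  unfolding set_lebesgue_integral_def
proof (rule integral_mono_AE)
  show "integrable lebesgue (\<lambda>x. indicator \<Omega> x *\<^sub>R (g x * \<phi> x))"
    using integrable_locally_integrable_mult_test[OF g(1) \<phi>(1)] by simp
  show "integrable lebesgue (\<lambda>x. indicator \<Omega> x *\<^sub>R (e * \<phi> x))"
    using integrable_locally_integrable_mult_test[OF locally_integrable_continuous \<phi>(1), of "\<lambda>_. e"] by simp
  have "AE x in lebesgue. x \<in> \<Omega> \<longrightarrow> g x \<le> e" using g(2) \<Omega> by (simp add: AE_restrict_space_iff)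
  then show "AE x in lebesgue. indicator \<Omega> x *\<^sub>R (g x * \<phi> x) \<le> indicator \<Omega> x *\<^sub>R (e * \<phi> x)"
    by eventually_elim (use \<phi>(2) in \<open>auto simp: indicator_def intro: mult_right_mono\<close>)
qed

lemma has_weak_deriv_uminus:
  assumes "has_weak_deriv \<Omega> \<alpha> u g"
  shows "has_weak_deriv \<Omega> \<alpha> (\<lambda>x. - u x) (\<lambda>x. - g x)"
  using assms unfolding has_weak_deriv_def locally_integrable_def
  by (auto simp: set_lebesgue_integral_def set_integrable_def)

text \<open>If \<open>u\<close> exceeded \<open>e\<close> at \<open>x0\<close>, it would do so on a
  small box by continuity, and testing with the bump of that box contradicts the essential bound.
  The one-sided form is applied to \<open>- u\<close> for the other bound.\<close>

lemma weak_deriv_0_upper: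
  fixes u :: "real^'d::finite \<Rightarrow> real"
  assumes \<Omega>: "open \<Omega>" and u: "continuous_on UNIV u" and g: "has_weak_deriv \<Omega> (\<lambda>_. 0) u g"
    "AE x in lebesgue_on \<Omega>. g x \<le> e" and x0: "x0 \<in> \<Omega>"
  shows "u x0 \<le> e"
proof (rule ccontr)
  assume "\<not> u x0 \<le> e"
  have "open (\<Omega> \<inter> {x. e < u x})" using \<Omega> u by (intro open_Int open_Collect_less) (auto intro: continuous_intros)
  moreover have "x0 \<in> \<Omega> \<inter> {x. e < u x}" using x0 \<open>\<not> u x0 \<le> e\<close> by auto
  ultimately obtain a b where ab: "cbox a b \<subseteq> \<Omega> \<inter> {x. e < u x}" "x0 \<in> box a b"
    by (rule open_contains_cbox) blast
  let ?\<eta> = "box_bump a b"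
  have t: "?\<eta> \<in> test_functions \<Omega>" using ab by (intro test_function_box_bump) auto
  have out: "?\<eta> x = 0" if "x \<notin> \<Omega>" for x
    using that ab box_subset_cbox[of a b] by (intro box_bump_eq_0) auto
  have cl: "classical_deriv (\<lambda>_. 0) f = f" for f :: "real^'d \<Rightarrow> real"
    unfolding classical_deriv_def foldr_power_eq by (simp add: concat_eq_Nil_conv[THEN iffD2])
  have "(LINT x:\<Omega>|lebesgue. u x * ?\<eta> x) = (LINT x:\<Omega>|lebesgue. g x * ?\<eta> x)"
    using g(1) t unfolding has_weak_deriv_def by (auto simp: cl order_mi_def)
  also have "\<dots> \<le> (LINT x:\<Omega>|lebesgue. e * ?\<eta> x)"
    using g box_bump_nonneg unfolding has_weak_deriv_def by (intro set_integral_le_const[OF \<Omega> _ _ t]) auto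
  finally have le: "(LINT x|lebesgue. u x * ?\<eta> x) \<le> (LINT x|lebesgue. e * ?\<eta> x)"
    using out by (simp add: set_integral_eq_integral)
  have "0 < (LINT x|lebesgue. (u x - e) * ?\<eta> x)"
    using ab u by (intro integral_mult_bump_pos[of _ a b] continuous_on_box_bump box_bump_pos box_bump_eq_0)
      (auto intro!: continuous_intros)
  also have "\<dots> = (LINT x|lebesgue. u x * ?\<eta> x - e * ?\<eta> x)" by (simp add: left_diff_distrib)
  also have "\<dots> = (LINT x|lebesgue. u x * ?\<eta> x) - (LINT x|lebesgue. e * ?\<eta> x)"
    using u box_subset_cbox[of a b]
    by (intro Bochner_Integration.integral_diff integrable_continuous_compact_support(2)[of _ "cbox a b"])
      (auto intro!: continuous_intros continuous_on_box_bump box_bump_eq_0)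
  finally show False using le by simp
qed

lemma weak_deriv_0_bound:
  fixes u :: "real^'d::finite \<Rightarrow> real"
  assumes "open \<Omega>" "continuous_on UNIV u" "has_weak_deriv \<Omega> (\<lambda>_. 0) u g"
    "AE x in lebesgue_on \<Omega>. \<bar>g x\<bar> \<le> e" "x0 \<in> \<Omega>"
  shows "\<bar>u x0\<bar> \<le> e"
proof -
  have "AE x in lebesgue_on \<Omega>. g x \<le> e" "AE x in lebesgue_on \<Omega>. - g x \<le> e"
    using assms(4) by (eventually_elim; simp)+
  then have "u x0 \<le> e" "- u x0 \<le> e"
    using weak_deriv_0_upper[OF assms(1) _ _ _ assms(5)] assms(2,3)
      has_weak_deriv_uminus[OF assms(3)] continuous_on_minus[OF assms(2)] by blast+
  then show ?thesis by simp
qed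

lemma bump_antideriv:
  obtains F where "\<And>t. (F has_real_derivative bump a b t) (at t)"
proof -
  have "isCont (bump a b) t" for t using smooth1_deriv(1)[OF smooth1_bump] DERIV_isCont by blast
  then have "\<exists>F. \<forall>t::real. -\<infinity> < ereal t \<longrightarrow> ereal t < \<infinity> \<longrightarrow> (F has_vector_derivative bump a b t) (at t)"
    by (intro einterval_antiderivative) auto
  then show ?thesis using that by (auto simp: has_real_derivative_iff_has_vector_derivative)
qed

text \<open>The test function is an antiderivative, in direction \<open>i\<close>, of the difference of a bump and its
  translate by \<open>h\<close>, so the weak derivative controls the averaged difference quotient.\<close>

lemma weak_deriv_1_upper:
  fixes u :: "real^'d::finite \<Rightarrow> real"
  assumes u: "continuous_on UNIV u" and g: "has_weak_deriv (box p q) ((\<lambda>_. 0)(i := Suc 0)) u g"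
    "AE x in lebesgue_on (box p q). g x \<le> e" and x0: "x0 \<in> box p q" "x0 + h *\<^sub>R axis i 1 \<in> box p q" and "h > 0"
  shows "u (x0 + h *\<^sub>R axis i 1) - u x0 \<le> e * h"
proof (rule ccontr)
  let ?e = "axis i 1 :: real^'d"
  define \<Omega> where "\<Omega> = box p q"
  have \<Omega>: "open \<Omega>" unfolding \<Omega>_def by (rule open_box)
  \<comment> \<open>Subtracting the linear function of slope \<open>e\<close> reduces the claim to
    \<open>w x0 \<le> 0\<close>. As \<open>w\<close> is continuous, a violation persists on a small
    box.\<close>
  define v where "v = (\<lambda>x. u x - e * vec_nth x i)"
  define w where "w = (\<lambda>x. v (x + h *\<^sub>R ?e) - v x)"
  have cv: "continuous_on UNIV v" unfolding v_def using u by (intro continuous_intros)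
  have cvh: "continuous_on UNIV (\<lambda>x. v (x + h *\<^sub>R ?e))"
    by (rule continuous_on_compose2[OF cv]) (auto intro: continuous_intros)
  have cw: "continuous_on UNIV w" unfolding w_def using cv cvh by (intro continuous_intros)
  assume "\<not> u (x0 + h *\<^sub>R ?e) - u x0 \<le> e * h"
  then have "w x0 > 0" unfolding w_def v_def by (simp add: algebra_simps)
  then have mem: "x0 \<in> \<Omega> \<inter> ((\<lambda>x. x + h *\<^sub>R ?e) -` \<Omega>) \<inter> {x. 0 < w x}"
    using x0 unfolding \<Omega>_def by auto
  have op: "open (\<Omega> \<inter> ((\<lambda>x. x + h *\<^sub>R ?e) -` \<Omega>) \<inter> {x. 0 < w x})"
    using \<Omega> cw by (intro open_Int open_Collect_less open_vimage continuous_intros) auto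
  obtain a b where ab: "cbox a b \<subseteq> \<Omega> \<inter> ((\<lambda>x. x + h *\<^sub>R ?e) -` \<Omega>) \<inter> {x. 0 < w x}" "x0 \<in> box a b"
    by (rule open_contains_cbox[OF op mem]) blast
  let ?\<eta> = "box_bump a b"
  obtain F where F: "\<And>t. (F has_real_derivative bump (vec_nth a i) (vec_nth b i) t) (at t)"
    using bump_antideriv by blast
  \<comment> \<open>The factor in direction \<open>i\<close> integrates a bump minus its translate
    by \<open>h\<close>; thus the partial derivative of the product is \<open>box_bump a b\<close>
    minus its translate.\<close>
  define f where "f = (\<lambda>j. if j = i then (\<lambda>t. F t - F (t - h)) else bump (vec_nth a j) (vec_nth b j))"
  define G where "G = (\<lambda>\<alpha> (x::real^'d). \<Prod>j\<in>UNIV. (deriv ^^ \<alpha> j) (f j) (vec_nth x j))"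
  have smF: "smooth1 F" using smooth1_antideriv[OF F smooth1_bump] .
  have sm: "smooth1 (f j)" for j
    unfolding f_def using smooth1_diff[OF smF smooth1_affine[OF smF, of 1 "-h"]] smooth1_bump by auto
  have G: "dtower G" unfolding G_def by (rule dtower_prod[OF sm])
  \<comment> \<open>The mean value theorem yields both nonnegativity of this factor and its support,
    which is that of the bump lengthened by \<open>h\<close> on the right.\<close>
  have diff: "\<exists>z. t - h < z \<and> z < t \<and> f i t = h * bump (vec_nth a i) (vec_nth b i) z" for t
    using MVT2[of "t - h" t F, OF _ F] \<open>h > 0\<close> unfolding f_def by auto
  have f_nonneg: "f j t \<ge> 0" for j t
  proof (cases "j = i")
    case True
    obtain z where "f i t = h * bump (vec_nth a i) (vec_nth b i) z" using diff[of t] by blast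
    then show ?thesis using True bump_nonneg \<open>h > 0\<close> by (simp add: mult_nonneg_nonneg)
  next
    case False
    then show ?thesis by (simp add: f_def bump_nonneg)
  qed
  define b' where "b' = b + h *\<^sub>R ?e"
  have f0: "f j t = 0" if "t < vec_nth a j \<or> vec_nth b' j < t" for j t
  proof (cases "j = i")
    case True
    obtain z where "t - h < z" "z < t" "f i t = h * bump (vec_nth a i) (vec_nth b i) z" using diff by blast
    moreover have "z \<le> vec_nth a i \<or> vec_nth b i \<le> z" using that True calculation by (auto simp: b'_def)
    ultimately show ?thesis using True by (simp add: bump_eq_0)
  next
    case False
    then show ?thesis using that by (auto simp: f_def b'_def axis_def intro: bump_eq_0)
  qed
  \<comment> \<open>Only the corners \<open>a\<close> and \<open>b + h * e_i\<close> are known to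
    lie in the domain. That the domain is a box puts everything between them inside as well.\<close>
  have sub: "cbox a b' \<subseteq> \<Omega>"
  proof -
    have "a \<in> cbox a b" "b \<in> cbox a b" using ab(2) by (auto simp: mem_box_cart less_imp_le intro: order.strict_implies_order order.strict_trans)
    then have "a \<in> box p q" "b' \<in> box p q" using ab(1) unfolding \<Omega>_def b'_def by auto
    then show ?thesis
      unfolding \<Omega>_def by (auto simp: mem_box_cart) (meson less_le_trans le_less_trans)+
  qed
  have G0: "G (\<lambda>_. 0) x = (\<Prod>j\<in>UNIV. f j (vec_nth x j))" for x unfolding G_def by simp
  have test: "G (\<lambda>_. 0) \<in> test_functions \<Omega>"
    unfolding G0[abs_def] using test_function_prod[of f, OF sm f0 sub] .
  have phi_nonneg: "G (\<lambda>_. 0) x \<ge> 0" for x unfolding G0 by (intro prod_nonneg) (auto simp: f_nonneg)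
  let ?\<delta> = "(\<lambda>_. 0)(i := Suc 0) :: 'd multiindex"
  have G1: "G ?\<delta> x = ?\<eta> x - ?\<eta> (x - h *\<^sub>R ?e)" for x
  proof -
    let ?P = "\<Prod>j\<in>UNIV - {i}. bump (vec_nth a j) (vec_nth b j) (vec_nth x j)"
    have "(f i has_real_derivative bump (vec_nth a i) (vec_nth b i) t - bump (vec_nth a i) (vec_nth b i) (t - h)) (at t)" for t
      unfolding f_def using F[of t] DERIV_shift[of F _ t "-h"] F[of "t - h"] by (auto intro!: DERIV_diff)
    then have "deriv (f i) t = bump (vec_nth a i) (vec_nth b i) t - bump (vec_nth a i) (vec_nth b i) (t - h)" for t
      by (rule DERIV_imp_deriv)
    moreover have "(\<Prod>j\<in>UNIV - {i}. (deriv ^^ ?\<delta> j) (f j) (vec_nth x j)) = ?P"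
      by (intro prod.cong) (auto simp: f_def)
    ultimately have "G ?\<delta> x = (bump (vec_nth a i) (vec_nth b i) (vec_nth x i) - bump (vec_nth a i) (vec_nth b i) (vec_nth x i - h)) * ?P"
      unfolding G_def by (subst prod.remove[of UNIV i]) auto
    moreover have "?\<eta> x = bump (vec_nth a i) (vec_nth b i) (vec_nth x i) * ?P"
      unfolding box_bump_def by (subst prod.remove[of UNIV i]) auto
    moreover have "?\<eta> (x - h *\<^sub>R ?e) = bump (vec_nth a i) (vec_nth b i) (vec_nth x i - h) * ?P"
      unfolding box_bump_def
      by (subst prod.remove[of UNIV i]) (auto simp: axis_def intro!: arg_cong2[of _ _ _ _ "(*)"] prod.cong)
    ultimately show ?thesis by (simp add: left_diff_distrib)
  qed
  have out: "G \<alpha> x = 0" if "\<alpha> = (\<lambda>_. 0) \<or> \<alpha> = ?\<delta>" "x \<notin> cbox a b'" for \<alpha> x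
  proof -
    have z: "G (\<lambda>_. 0) y = 0" if "y \<notin> cbox a b'" for y
    proof -
      obtain j where "vec_nth y j < vec_nth a j \<or> vec_nth b' j < vec_nth y j"
        using \<open>y \<notin> cbox a b'\<close> by (auto simp: mem_box_cart not_le)
      then show ?thesis unfolding G0 using f0 by (intro prod_zero) auto
    qed
    have "G ?\<delta> x = partial i (G (\<lambda>_. 0)) x" using dtower_partial[OF G] by simp
    then have "G ?\<delta> x = 0" using partial_eq_0[OF closed_cbox z that(2)] by simp
    then show ?thesis using z that by auto
  qed
  have cG: "continuous_on UNIV (G \<alpha>)" for \<alpha> by (rule dtower_continuous[OF G])
  have outO: "G \<alpha> x = 0" if "\<alpha> = (\<lambda>_. 0) \<or> \<alpha> = ?\<delta>" "x \<notin> \<Omega>" for \<alpha> x using out that sub by blast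
  have ibp: "(LINT x|lebesgue. vec_nth x i * G ?\<delta> x) = - (LINT x|lebesgue. 1 * G (\<lambda>_. 0) x)"
  proof (rule integral_by_parts_partial[of _ _ _ _ i "cbox a b'"])
    show "((\<lambda>t. vec_nth (x + t *\<^sub>R ?e) i) has_real_derivative 1) (at 0)" for x
      by (auto intro!: derivative_eq_intros)
    show "((\<lambda>t. G (\<lambda>_. 0) (x + t *\<^sub>R ?e)) has_real_derivative G ?\<delta> x) (at 0)" for x
      using G unfolding dtower_def by auto
  qed (use cG out in \<open>auto intro!: continuous_intros\<close>)
  have wd: "(LINT x|lebesgue. u x * G ?\<delta> x) = - (LINT x|lebesgue. g x * G (\<lambda>_. 0) x)"
  proof -
    have "(LINT x:\<Omega>|lebesgue. u x * classical_deriv ?\<delta> (G (\<lambda>_. 0)) x) =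
        (-1) ^ order_mi ?\<delta> * (LINT x:\<Omega>|lebesgue. g x * G (\<lambda>_. 0) x)"
      using g(1) test unfolding has_weak_deriv_def \<Omega>_def[symmetric] by blast
    moreover have "order_mi ?\<delta> = 1" unfolding order_mi_def by (simp add: sum.remove[of UNIV i])
    ultimately show ?thesis using outO
      by (simp add: dtower_classical_deriv[OF G] set_integral_eq_integral)
  qed
  have "(LINT x:\<Omega>|lebesgue. g x * G (\<lambda>_. 0) x) \<le> (LINT x:\<Omega>|lebesgue. e * G (\<lambda>_. 0) x)"
    using g unfolding has_weak_deriv_def \<Omega>_def[symmetric]
    by (intro set_integral_le_const[OF \<Omega> _ _ test] phi_nonneg) auto
  then have le: "(LINT x|lebesgue. g x * G (\<lambda>_. 0) x) \<le> e * (LINT x|lebesgue. G (\<lambda>_. 0) x)"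
    using outO by (simp add: set_integral_eq_integral)
  have cs: "integrable lebesgue (\<lambda>x. s x * ?\<eta> x)" if "continuous_on UNIV s" for s
    using that box_subset_cbox[of a b]
    by (intro integrable_continuous_compact_support(2)[of _ "cbox a b"])
      (auto intro!: continuous_intros continuous_on_box_bump box_bump_eq_0)
  have csh: "continuous_on UNIV (\<lambda>x. ?\<eta> (x - h *\<^sub>R ?e))"
    by (rule continuous_on_compose2[OF continuous_on_box_bump]) (auto intro: continuous_intros)
  have cG1: "integrable lebesgue (\<lambda>x. s x * G ?\<delta> x)" if "continuous_on UNIV s" for s
    using that cG out by (intro integrable_continuous_compact_support(2)[of _ "cbox a b'"]) (auto intro!: continuous_intros)
  \<comment> \<open>Moving the translation from \<open>v\<close> to the bump turns the average of
    \<open>w\<close> into minus the integral of \<open>v\<close> times the partial derivative of the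
    test function. By the weak derivative and \<open>ibp\<close> this is the integral of
    \<open>g - e\<close> times the test function, which is at most 0.\<close>
  have "0 < (LINT x|lebesgue. w x * ?\<eta> x)"
    using ab cw by (intro integral_mult_bump_pos[of _ a b] continuous_on_box_bump box_bump_pos box_bump_eq_0) auto
  also have "\<dots> = (LINT x|lebesgue. v (x + h *\<^sub>R ?e) * ?\<eta> x) - (LINT x|lebesgue. v x * ?\<eta> x)"
    unfolding w_def using cs[OF cvh] cs[OF cv] by (simp add: left_diff_distrib)
  also have "(LINT x|lebesgue. v (x + h *\<^sub>R ?e) * ?\<eta> x) = (LINT x|lebesgue. v x * ?\<eta> (x - h *\<^sub>R ?e))"
  proof -
    let ?k = "\<lambda>x. v x * ?\<eta> (x - h *\<^sub>R ?e)"
    have k: "?k \<in> borel_measurable borel"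
      using cv csh by (intro borel_measurable_continuous_onI continuous_intros)
    have k': "(\<lambda>x. ?k (x + h *\<^sub>R ?e)) \<in> borel_measurable borel"
      using k by measurable
    have "(LINT x|lborel. ?k (x + h *\<^sub>R ?e)) = (LINT x|lborel. ?k x)" by (rule integral_translate[OF k])
    then have "(LINT x|lebesgue. ?k (x + h *\<^sub>R ?e)) = (LINT x|lebesgue. ?k x)"
      using integral_completion[of ?k lborel] integral_completion[of "\<lambda>x. ?k (x + h *\<^sub>R ?e)" lborel] k k' by simp
    then show ?thesis by simp
  qed
  also have "\<dots> - (LINT x|lebesgue. v x * ?\<eta> x) = - (LINT x|lebesgue. v x * G ?\<delta> x)"
  proof -
    have "(\<lambda>x. v x * ?\<eta> (x - h *\<^sub>R ?e)) = (\<lambda>x. v x * ?\<eta> x - v x * G ?\<delta> x)"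
      unfolding G1 by (auto simp: algebra_simps)
    then show ?thesis using cs[OF cv] cG1[OF cv] by simp
  qed
  also have "(LINT x|lebesgue. v x * G ?\<delta> x) =
      (LINT x|lebesgue. u x * G ?\<delta> x) - e * (LINT x|lebesgue. vec_nth x i * G ?\<delta> x)"
    unfolding v_def using cG1[OF u] cG1[of "\<lambda>x. vec_nth x i"]
    by (simp add: left_diff_distrib mult.assoc continuous_on_component)
  also have "\<dots> = e * (LINT x|lebesgue. G (\<lambda>_. 0) x) - (LINT x|lebesgue. g x * G (\<lambda>_. 0) x)"
    using wd ibp by simp
  finally show False using le by simp
qed

lemma weak_deriv_1_bound:
  fixes u :: "real^'d::finite \<Rightarrow> real"
  assumes u: "continuous_on UNIV u" and g: "has_weak_deriv (box p q) ((\<lambda>_. 0)(i := Suc 0)) u g"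
    "AE x in lebesgue_on (box p q). \<bar>g x\<bar> \<le> e" and x0: "x0 \<in> box p q" "x0 + h *\<^sub>R axis i 1 \<in> box p q" "h > 0"
  shows "\<bar>u (x0 + h *\<^sub>R axis i 1) - u x0\<bar> \<le> e * h"
proof -
  have AE: "AE x in lebesgue_on (box p q). g x \<le> e" "AE x in lebesgue_on (box p q). - g x \<le> e"
    using g(2) by (eventually_elim; simp)+
  have "u (x0 + h *\<^sub>R axis i 1) - u x0 \<le> e * h"
    by (rule weak_deriv_1_upper[OF u g(1) AE(1) x0])
  moreover have "- u (x0 + h *\<^sub>R axis i 1) - - u x0 \<le> e * h"
    by (rule weak_deriv_1_upper[OF continuous_on_minus[OF u] has_weak_deriv_uminus[OF g(1)] AE(2) x0])
  ultimately show ?thesis by simp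
qed

section \<open>Sums of bumps on a grid\<close>

lemma higher_deriv_affine:
  assumes "smooth1 f"
  shows "(deriv ^^ k) (\<lambda>t. f (m * t + c)) = (\<lambda>t. m ^ k * (deriv ^^ k) f (m * t + c))"
proof (induction k)
  case (Suc k)
  have "((\<lambda>t. m ^ k * (deriv ^^ k) f (m * t + c)) has_real_derivative
      m ^ Suc k * (deriv ^^ Suc k) f (m * t + c)) (at t)" for t
  proof -
    have "((\<lambda>t. m * t + c) has_real_derivative m) (at t)" by (auto intro!: derivative_eq_intros)
    from DERIV_cmult[OF DERIV_chain2[OF DERIV_higher_deriv[OF assms, of k] this], of "m ^ k"]
    show ?thesis by (simp add: mult_ac)
  qed
  then have "deriv (\<lambda>t. m ^ k * (deriv ^^ k) f (m * t + c)) = (\<lambda>t. m ^ Suc k * (deriv ^^ Suc k) f (m * t + c))"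
    by (intro ext DERIV_imp_deriv)
  then show ?case using Suc.IH by simp
qed simp

lemma higher_deriv_eq_0:
  assumes "smooth1 f" "\<And>t. t < a \<or> b < t \<Longrightarrow> f t = 0" "t < a \<or> b < t"
  shows "(deriv ^^ k) f t = 0"
  using assms(3)
proof (induction k arbitrary: t)
  case 0
  then show ?case using assms(2) by simp
next
  case (Suc k)
  have "((deriv ^^ k) f has_real_derivative 0) (at t)"
    by (rule has_field_derivative_transform_within_open[OF DERIV_const[of 0], of "{..<a} \<union> {b<..}"])
      (use Suc in auto)
  then show ?case by (simp add: DERIV_imp_deriv)
qed

lemma higher_deriv_bounded:
  assumes "smooth1 f" "\<And>t. t < a \<or> b < t \<Longrightarrow> f t = 0"
  shows "\<exists>C. \<forall>t. \<bar>(deriv ^^ k) f t\<bar> \<le> C"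
proof -
  have "continuous_on {a..b} ((deriv ^^ k) f)"
    using DERIV_higher_deriv[OF assms(1)] by (meson DERIV_isCont continuous_at_imp_continuous_on)
  then have "bounded ((deriv ^^ k) f ` {a..b})" by (intro compact_imp_bounded compact_continuous_image) auto
  then obtain C where C: "\<forall>t\<in>{a..b}. \<bar>(deriv ^^ k) f t\<bar> \<le> C" unfolding bounded_real by auto
  have "\<bar>(deriv ^^ k) f t\<bar> \<le> \<bar>C\<bar>" for t
  proof (cases "t < a \<or> b < t")
    case True
    then show ?thesis using higher_deriv_eq_0[OF assms True, of k] by simp
  next
    case False
    then have "\<bar>(deriv ^^ k) f t\<bar> \<le> C" using C by simp
    then show ?thesis by simp
  qed
  then show ?thesis by blast
qed

text \<open>In the coordinates scaled by \<open>N\<close>, the bump fills only the lower half of its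
  unit cell in each direction. The upper half leaves room for a comparison point outside its
  support.\<close>

definition cell :: "nat \<Rightarrow> ('d \<Rightarrow> nat) \<Rightarrow> 'd multiindex \<Rightarrow> real^'d::finite \<Rightarrow> real" where
  "cell N m \<alpha> x = (\<Prod>i\<in>UNIV. (deriv ^^ \<alpha> i) (\<lambda>t. bump 0 (1/2) (real N * t + - real (m i))) (vec_nth x i))"

lemma dtower_cell: "dtower (cell N m)"
  unfolding cell_def[abs_def] by (intro dtower_prod smooth1_affine smooth1_bump)

lemma cell_eq:
  "cell N m \<alpha> x = real N ^ order_mi \<alpha> *
    (\<Prod>i\<in>UNIV. (deriv ^^ \<alpha> i) (bump 0 (1/2)) (real N * vec_nth x i - real (m i)))"
  unfolding cell_def order_mi_def higher_deriv_affine[OF smooth1_bump]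
  by (simp add: prod.distrib power_sum)

lemma cell_support:
  assumes "cell N m \<alpha> x \<noteq> 0"
  shows "m i = nat \<lfloor>real N * vec_nth x i\<rfloor>"
proof -
  have "(deriv ^^ \<alpha> i) (bump 0 (1/2)) (real N * vec_nth x i - real (m i)) \<noteq> 0"
    using assms unfolding cell_eq by auto
  then have "\<not> (real N * vec_nth x i - real (m i) < 0 \<or> 1/2 < real N * vec_nth x i - real (m i))"
    using higher_deriv_eq_0[OF smooth1_bump[of 0 "1/2"], of 0 "1/2" _ "\<alpha> i"] bump_eq_0[of _ 0 "1/2"] by force
  then have "\<lfloor>real N * vec_nth x i\<rfloor> = int (m i)" by (intro floor_unique) auto
  then show ?thesis by simp
qed

lemma sum_cell_unique:
  assumes "\<And>m'. m' \<in> Y \<Longrightarrow> m' \<noteq> m \<Longrightarrow> cell N m' \<alpha> x = 0" "finite Y"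
  shows "(\<Sum>m'\<in>Y. cell N m' \<alpha> x) = (if m \<in> Y then cell N m \<alpha> x else 0)"
proof -
  have "(\<Sum>m'\<in>Y. cell N m' \<alpha> x) = (\<Sum>m'\<in>Y. if m' = m then cell N m \<alpha> x else 0)"
    using assms(1) by (intro sum.cong) auto
  then show ?thesis using assms(2) by simp
qed

text \<open>The rounded coordinates of \<open>x\<close> determine the only index whose cell can be
  nonzero there, so the bound does not grow with \<open>Y\<close>.\<close>

lemma abs_sum_cell_le:
  assumes "finite Y" "\<And>m. \<bar>cell N m \<alpha> x\<bar> \<le> D"
  shows "\<bar>\<Sum>m\<in>Y. cell N m \<alpha> x\<bar> \<le> D"
proof -
  have "D \<ge> 0" using assms(2) abs_ge_zero order_trans by blast
  have "(\<Sum>m'\<in>Y. cell N m' \<alpha> x) = (if (\<lambda>i. nat \<lfloor>real N * vec_nth x i\<rfloor>) \<in> Y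
      then cell N (\<lambda>i. nat \<lfloor>real N * vec_nth x i\<rfloor>) \<alpha> x else 0)"
    using cell_support[of N _ \<alpha> x] assms(1) by (intro sum_cell_unique) blast+
  then show ?thesis using assms(2) \<open>D \<ge> 0\<close> by simp
qed

lemma cell_bound:
  obtains C where "C \<ge> 1"
    "\<And>N m \<alpha> (x::real^'d::finite). order_mi \<alpha> \<le> n \<Longrightarrow> \<bar>cell N m \<alpha> x\<bar> \<le> real N ^ order_mi \<alpha> * C"
proof -
  have "\<exists>c. \<forall>t. \<bar>(deriv ^^ k) (bump 0 (1/2)) t\<bar> \<le> c" for k
    by (rule higher_deriv_bounded[OF smooth1_bump, of 0 "1/2"]) (rule bump_eq_0, linarith)
  then obtain c where c: "\<And>k t. \<bar>(deriv ^^ k) (bump 0 (1/2)) t\<bar> \<le> c k" by metis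
  define \<beta> where "\<beta> = 1 + (\<Sum>k\<le>n. \<bar>c k\<bar>)"
  have \<beta>: "\<bar>(deriv ^^ k) (bump 0 (1/2)) t\<bar> \<le> \<beta>" if "k \<le> n" for k t
  proof -
    have "\<bar>c k\<bar> \<le> (\<Sum>k\<le>n. \<bar>c k\<bar>)" using that by (intro member_le_sum) auto
    then show ?thesis using c[of k t] unfolding \<beta>_def by linarith
  qed
  have "\<beta> \<ge> 1" unfolding \<beta>_def by (simp add: sum_nonneg)
  have "\<bar>cell N m \<alpha> x\<bar> \<le> real N ^ order_mi \<alpha> * \<beta> ^ CARD('d)" if "order_mi \<alpha> \<le> n" for N m \<alpha> and x :: "real^'d"
  proof -
    have "\<alpha> i \<le> n" for i using that member_le_sum[of i UNIV \<alpha>] unfolding order_mi_def by simp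
    then have "(\<Prod>i\<in>UNIV. \<bar>(deriv ^^ \<alpha> i) (bump 0 (1/2)) (real N * vec_nth x i - real (m i))\<bar>) \<le> (\<Prod>i\<in>(UNIV::'d set). \<beta>)"
      by (intro prod_mono) (auto simp: \<beta>)
    then show ?thesis unfolding cell_eq by (simp add: abs_mult abs_prod mult_left_mono)
  qed
  then show ?thesis using that[of "\<beta> ^ CARD('d)"] \<open>\<beta> \<ge> 1\<close> one_le_power by blast
qed

section \<open>The lower bound\<close>

lemma sobolev_increment_bound:
  fixes u :: "real^'d::finite \<Rightarrow> real"
  assumes u: "continuous_on UNIV u" and norm: "sobolev_inf_norm k (box 0 1) u \<le> ereal e" and "k \<in> {0, 1}"
    and x: "x \<in> box 0 1" "x + h *\<^sub>R axis i 1 \<in> box 0 1" "h > 0"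
  shows "\<bar>u (x + h *\<^sub>R axis i 1) - u x\<bar> \<le> (if k = 0 then 2 * e else e * h)"
proof (cases "k = 0")
  case True
  obtain g where g: "has_weak_deriv (box 0 1) (\<lambda>_. 0) u g" "AE x in lebesgue_on (box 0 1). \<bar>g x\<bar> \<le> e"
    using weak_deriv_bound[OF open_box norm, of "\<lambda>_. 0"] by (auto simp: order_mi_def)
  have "\<bar>u (x + h *\<^sub>R axis i 1)\<bar> \<le> e" "\<bar>u x\<bar> \<le> e"
    using weak_deriv_0_bound[OF open_box u g] x by auto
  then show ?thesis using True by simp
next
  case False
  then have "order_mi ((\<lambda>_. 0)(i := Suc 0)) \<le> k"
    using \<open>k \<in> {0, 1}\<close> unfolding order_mi_def by (simp add: sum.remove[of UNIV i])
  then obtain g where g: "has_weak_deriv (box 0 1) ((\<lambda>_. 0)(i := Suc 0)) u g"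
    "AE x in lebesgue_on (box 0 1). \<bar>g x\<bar> \<le> e"
    using weak_deriv_bound[OF open_box norm] by blast
  show ?thesis using weak_deriv_1_bound[OF u g x] False by simp
qed

text \<open>Without weights only the zero function is realized. Approximating the constant
  \<open>B\<close>, which lies in the ball, then forces \<open>B \<le> \<epsilon>\<close>.\<close>

lemma num_weights_pos:
  fixes \<A> :: network
  assumes \<A>: "is_architecture CARD('d::finite) \<A>" and "B > 0"
    and M0: "num_weights \<A> = 0 \<longrightarrow> \<epsilon> < B"
    and approx: "\<And>f :: real^'d \<Rightarrow> real. f \<in> sobolev_inf n (box 0 1) \<Longrightarrow>
      sobolev_inf_norm n (box 0 1) f \<le> ereal B \<Longrightarrow>
      \<exists>\<Phi>. has_architecture CARD('d) \<Phi> \<A> \<and>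
        sobolev_inf_norm k (box 0 1) (\<lambda>x. realization1 \<Phi> x - f x) \<le> ereal \<epsilon>"
  shows "num_weights \<A> \<noteq> 0"
proof
  assume 0: "num_weights \<A> = 0"
  define G where "G = (\<lambda>(\<alpha>::'d multiindex) (x::real^'d). if \<alpha> = (\<lambda>_. 0) then B else 0)"
  have "dtower G"
    unfolding dtower_def G_def by (auto simp: fun_eq_iff)
  then have "G (\<lambda>_. 0) \<in> sobolev_inf n (box 0 1)" "sobolev_inf_norm n (box 0 1) (G (\<lambda>_. 0)) \<le> ereal B"
    using sobolev_inf_norm_dtower_le[OF open_box, of G n B] \<open>B > 0\<close> by (auto simp: G_def)
  then obtain \<Phi> where \<Phi>: "has_architecture CARD('d) \<Phi> \<A>"
    "sobolev_inf_norm k (box 0 1) (\<lambda>x. realization1 \<Phi> x - G (\<lambda>_. 0) x) \<le> ereal \<epsilon>"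
    using approx by blast
  have "(\<lambda>x. realization1 \<Phi> x - G (\<lambda>_. 0) x) = (\<lambda>x::real^'d. - B)"
    using realization1_no_weights[OF \<A> \<Phi>(1) 0] by (auto simp: G_def)
  then have norm: "sobolev_inf_norm k (box 0 1) (\<lambda>x::real^'d. - B) \<le> ereal \<epsilon>" using \<Phi>(2) by simp
  obtain g where "has_weak_deriv (box 0 1) (\<lambda>_. 0) (\<lambda>x::real^'d. - B) g" "AE x in lebesgue_on (box 0 1). \<bar>g x\<bar> \<le> \<epsilon>"
    using weak_deriv_bound[OF open_box norm, of "\<lambda>_. 0"] by (auto simp: order_mi_def)
  moreover have "(\<chi> i. 1/2) \<in> box 0 (1 :: real^'d)" by (auto simp: mem_box_cart)
  ultimately have "\<bar>- B\<bar> \<le> \<epsilon>" using weak_deriv_0_bound[OF open_box continuous_on_const] by blast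
  then show False using M0 0 by simp
qed

lemma grid_lower_bound:
  fixes \<A> :: network and N :: nat
  assumes \<A>: "is_architecture CARD('d::finite) \<A>" and k: "k \<in> {0, 1}" "k \<le> n" and N: "N \<ge> 1" and "B > 0"
    and C: "C \<ge> 1"
      "\<And>N m \<alpha> (x::real^'d). order_mi \<alpha> \<le> n \<Longrightarrow> \<bar>cell N m \<alpha> x\<bar> \<le> real N ^ order_mi \<alpha> * C"
    and small: "4 * \<epsilon> * real N ^ (n - k) * C < B * bump 0 (1/2) (1/4) ^ CARD('d)" and "\<epsilon> > 0"
    and approx: "\<And>f :: real^'d \<Rightarrow> real. f \<in> sobolev_inf n (box 0 1) \<Longrightarrow>
      sobolev_inf_norm n (box 0 1) f \<le> ereal B \<Longrightarrow>
      \<exists>\<Phi>. has_architecture CARD('d) \<Phi> \<A> \<and>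
        sobolev_inf_norm k (box 0 1) (\<lambda>x. realization1 \<Phi> x - f x) \<le> ereal \<epsilon>"
  shows "N ^ CARD('d) \<le> 25 * (num_weights \<A>)\<^sup>2"
proof -
  define gr where "gr = (PiE UNIV (\<lambda>_. {..<N}) :: ('d \<Rightarrow> nat) set)"
  have gr: "finite gr" "card gr = N ^ CARD('d)" unfolding gr_def by (auto simp: card_PiE intro: finite_PiE)
  \<comment> \<open>The largest amplitude permitted by \<open>C\<close>: derivatives up to order
    \<open>n\<close> are at most \<open>c * N ^ n * C = B\<close>.\<close>
  define c where "c = B / (real N ^ n * C)"
  have "c > 0" unfolding c_def using N C(1) \<open>B > 0\<close> by simp
  define A where "A = c * bump 0 (1/2) (1/4) ^ CARD('d)"
  define i0 where "i0 = (undefined :: 'd)"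
  \<comment> \<open>Half the width of a cell. It moves the relative position from 1/4, the centre of
    the bump, to 3/4 in direction \<open>i0\<close>, outside the bump but still inside the same
    cell.\<close>
  define h where "h = 1 / (2 * real N)"
  have "h > 0" unfolding h_def using N by simp
  define x where "x = (\<lambda>m::'d \<Rightarrow> nat. (\<chi> i. (real (m i) + 1/4) / real N) :: real^'d)"
  define y where "y = (\<lambda>m. x m + h *\<^sub>R axis i0 1)"
  have Nx: "real N * vec_nth (x m) i = real (m i) + 1/4" for m i unfolding x_def using N by simp
  have Ny: "real N * vec_nth (y m) i = real (m i) + (if i = i0 then 3/4 else 1/4)" for m i
    unfolding y_def h_def using N Nx[of m i] by (auto simp: axis_def algebra_simps)
  have in_box: "z \<in> box 0 1" if "m \<in> gr" "\<And>i. real (m i) < real N * vec_nth z i" "\<And>i. real N * vec_nth z i < real (m i) + 1" for m and z :: "real^'d"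
  proof -
    have "0 < vec_nth z i \<and> vec_nth z i < 1" for i
    proof -
      have "m i < N" using \<open>m \<in> gr\<close> unfolding gr_def by auto
      then have "real (m i) + 1 \<le> real N" by linarith
      then have "0 < real N * vec_nth z i" "real N * vec_nth z i < real N * 1"
        using that(2,3)[of i] by linarith+
      moreover have "real N > 0" using N by simp
      ultimately show ?thesis
        by (blast intro: zero_less_mult_pos mult_left_less_imp_less less_imp_le)
    qed
    then show ?thesis by (simp add: mem_box_cart)
  qed
  have box: "x m \<in> box 0 1" "y m \<in> box 0 1" if "m \<in> gr" for m
    using in_box[OF that, of "x m"] in_box[OF that, of "y m"] by (auto simp: Nx Ny)
  have other: "cell N m' (\<lambda>_. 0) z = 0" if "m' \<noteq> m" "\<And>i. real (m i) < real N * vec_nth z i" "\<And>i. real N * vec_nth z i < real (m i) + 1"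
    for m m' and z :: "real^'d"
  proof (rule ccontr)
    assume nz: "cell N m' (\<lambda>_. 0) z \<noteq> 0"
    have "\<lfloor>real N * vec_nth z i\<rfloor> = int (m i)" for i using that(2,3)[of i] by (intro floor_unique) auto
    then have "m' i = m i" for i using cell_support[OF nz, of i] by simp
    then show False using \<open>m' \<noteq> m\<close> by blast
  qed
  have cx: "cell N m (\<lambda>_. 0) (x m) = bump 0 (1/2) (1/4) ^ CARD('d)" for m
    unfolding cell_eq by (simp add: Nx order_mi_def)
  have cy: "cell N m (\<lambda>_. 0) (y m) = 0" for m
    unfolding cell_eq by (auto simp: Ny order_mi_def bump_eq_0 intro!: prod_zero bexI[of _ i0])
  have "card gr \<le> 25 * (num_weights \<A>)\<^sup>2"
  proof (rule shatter_bound[where x = x and y = y and \<theta> = "A / 2", OF \<A> gr(1)])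
    fix Y assume Y: "Y \<subseteq> gr"
    then have finY: "finite Y" using gr(1) finite_subset by blast
    define G where "G = (\<lambda>\<alpha> z. c * (\<Sum>m\<in>Y. cell N m \<alpha> z))"
    define f where "f = G (\<lambda>_. 0)"
    have G: "dtower G" unfolding G_def by (intro dtower_cmult_sum dtower_cell)
    have bound: "\<bar>G \<alpha> z\<bar> \<le> B" if \<alpha>: "order_mi \<alpha> \<le> n" for \<alpha> z
    proof -
      have "\<bar>\<Sum>m\<in>Y. cell N m \<alpha> z\<bar> \<le> real N ^ order_mi \<alpha> * C"
        using finY C(2)[OF \<alpha>] by (intro abs_sum_cell_le)
      also have "\<dots> \<le> real N ^ n * C" using \<alpha> N C(1) by (intro mult_right_mono power_increasing) auto
      finally have "c * \<bar>\<Sum>m\<in>Y. cell N m \<alpha> z\<bar> \<le> c * (real N ^ n * C)"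
        using \<open>c > 0\<close> by (intro mult_left_mono) auto
      also have "\<dots> = B" unfolding c_def using N C(1) by simp
      finally show ?thesis unfolding G_def using \<open>c > 0\<close> by (simp add: abs_mult)
    qed
    have "f \<in> sobolev_inf n (box 0 1)" "sobolev_inf_norm n (box 0 1) f \<le> ereal B"
      unfolding f_def using sobolev_inf_norm_dtower_le[OF open_box G bound] by auto
    then obtain \<Phi> where \<Phi>: "has_architecture CARD('d) \<Phi> \<A>"
      "sobolev_inf_norm k (box 0 1) (\<lambda>z. realization1 \<Phi> z - f z) \<le> ereal \<epsilon>"
      using approx by blast
    define u where "u = (\<lambda>z. realization1 \<Phi> z - f z)"
    have cu: "continuous_on UNIV u"
      unfolding u_def f_def
      by (intro continuous_intros continuous_on_realization1[OF \<A> \<Phi>(1)] dtower_continuous[OF G])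
    \<comment> \<open>\<open>A\<close> is the height of one scaled bump, and the increment of the
      error must stay below half of it. For \<open>k = 0\<close> this is
      \<open>2 * \<epsilon> < A / 2\<close>, whence the 4 in \<open>small\<close>; for
      \<open>k = 1\<close>, \<open>N * h = 1 / 2\<close> supplies the missing power of
      \<open>N\<close>.\<close>
    have small': "(if k = 0 then 2 * \<epsilon> else \<epsilon> * h) < A / 2"
    proof -
      have P: "real N ^ n * C > 0" using N C(1) by simp
      have A: "A * (real N ^ n * C) = B * bump 0 (1/2) (1/4) ^ CARD('d)"
      proof -
        have "B / q * s * q = B * s" if "q > 0" for q s :: real using that by simp
        from this[OF P] show ?thesis unfolding A_def c_def .
      qed
      have "(if k = 0 then 2 * \<epsilon> else \<epsilon> * h) * (real N ^ n * C) \<le> 2 * \<epsilon> * real N ^ (n - k) * C"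
      proof (cases "k = 0")
        case False
        then have "k = 1" using k by auto
        then have "real N ^ n = real N * real N ^ (n - k)" using k by (simp flip: power_Suc)
        then have "\<epsilon> * h * (real N ^ n * C) = 1 / 2 * \<epsilon> * real N ^ (n - k) * C"
          unfolding h_def using N by simp
        also have "\<dots> \<le> 2 * \<epsilon> * real N ^ (n - k) * C"
          using \<open>\<epsilon> > 0\<close> C(1) by (intro mult_right_mono) auto
        finally show ?thesis using False by simp
      qed simp
      also have "\<dots> < A / 2 * (real N ^ n * C)" using small A by simp
      finally show ?thesis using P by (rule mult_right_less_imp_less[OF _ less_imp_le])
    qed
    have "realization1 \<Phi> (x m) - realization1 \<Phi> (y m) > A / 2 \<longleftrightarrow> m \<in> Y" if m: "m \<in> gr" for m
    proof -
      have "\<bar>u (y m) - u (x m)\<bar> \<le> (if k = 0 then 2 * \<epsilon> else \<epsilon> * h)"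
        unfolding y_def
        using sobolev_increment_bound[OF cu _ k(1), of \<epsilon> "x m" h i0] \<Phi>(2) box[OF m] \<open>h > 0\<close>
        unfolding u_def[symmetric] y_def by blast
      then have ub: "\<bar>u (y m) - u (x m)\<bar> < A / 2" using small' by linarith
      have "f (x m) = c * (if m \<in> Y then cell N m (\<lambda>_. 0) (x m) else 0)"
        unfolding f_def G_def using finY
        by (intro arg_cong2[of _ _ _ _ "(*)"] refl sum_cell_unique other[of _ m]) (auto simp: Nx)
      then have fx: "f (x m) = (if m \<in> Y then A else 0)" by (simp add: cx A_def)
      have "f (y m) = c * (if m \<in> Y then cell N m (\<lambda>_. 0) (y m) else 0)"
        unfolding f_def G_def using finY
        by (intro arg_cong2[of _ _ _ _ "(*)"] refl sum_cell_unique other[of _ m]) (auto simp: Ny)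
      then have fy: "f (y m) = 0" by (simp add: cy)
      have "realization1 \<Phi> (x m) - realization1 \<Phi> (y m) = (u (x m) - u (y m)) + f (x m)"
        unfolding u_def using fy by simp
      moreover have "u (y m) - u (x m) < A / 2" "u (x m) - u (y m) < A / 2" using ub by linarith+
      ultimately show ?thesis using fx by (simp split: if_splits; linarith)
    qed
    then show "\<exists>\<Phi>. has_architecture CARD('d) \<Phi> \<A> \<and>
        (\<forall>p\<in>gr. realization1 \<Phi> (x p) - realization1 \<Phi> (y p) > A / 2 \<longleftrightarrow> p \<in> Y)"
      using \<Phi>(1) by blast
  qed
  then show ?thesis using gr(2) by simp
qed

text \<open>For an architecture without weights the condition \<open>\<epsilon> < B\<close> is
  imposed: if \<open>B \<le> \<epsilon>\<close>, its zero realization approximates every admissible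
  \<open>f\<close>, because \<open>k < n\<close>, and no positive lower bound could hold.\<close>

theorem theorem4p3:
  fixes n k :: nat and B :: real
  assumes "n \<ge> 2" and "B > 0" and "k \<in> {0, 1}"
  shows "\<exists>c>0. \<forall>\<epsilon> \<A>.
    0 < \<epsilon> \<longrightarrow> \<epsilon> < 1/2 \<longrightarrow>
    is_architecture CARD('d::finite) \<A> \<longrightarrow>
    (num_weights \<A> = 0 \<longrightarrow> \<epsilon> < B) \<longrightarrow>
    (\<forall>f :: real^'d \<Rightarrow> real.
       f \<in> sobolev_inf n (box 0 1) \<longrightarrow> sobolev_inf_norm n (box 0 1) f \<le> ereal B \<longrightarrow>
       (\<exists>\<Phi>. has_architecture CARD('d) \<Phi> \<A> \<and>
            sobolev_inf_norm k (box 0 1) (\<lambda>x. realization1 \<Phi> x - f x) \<le> ereal \<epsilon>)) \<longrightarrow>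
    real (num_weights \<A>) \<ge> c * \<epsilon> powr (- (real CARD('d) / (2 * (real n - real k))))"
proof -
  let ?d = "real CARD('d)"
  obtain C where C: "C \<ge> 1"
    "\<And>N m \<alpha> (x::real^'d). order_mi \<alpha> \<le> n \<Longrightarrow> \<bar>cell N m \<alpha> x\<bar> \<le> real N ^ order_mi \<alpha> * C"
    using cell_bound by blast
  \<comment> \<open>The 8 leaves a factor 2 over the 4 in the smallness condition of the grid bound,
    which makes that condition strict when
    \<open>\<epsilon> * N ^ (n - k) \<le> \<kappa>\<close>.\<close>
  define \<kappa> where "\<kappa> = B * bump 0 (1/2) (1/4) ^ CARD('d) / (8 * C)"
  have \<kappa>: "\<kappa> > 0" unfolding \<kappa>_def using \<open>B > 0\<close> C(1) bump_pos[of 0 "1/2" "1/4"] by simp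
  have nk: "k < n" "real n - real k > 0" using assms by auto
  define p where "p = ?d / (2 * (real n - real k))"
  \<comment> \<open>The 5 is the root of 25, and the power of 2 pays for rounding \<open>r\<close>
    down to an integer.\<close>
  define c where "c = 2 powr (- ?d / 2) * \<kappa> powr p / 5"
  show ?thesis
  proof (intro exI[of _ c] conjI allI impI)
    show "c > 0" unfolding c_def using \<kappa> by simp
    fix \<epsilon> \<A>
    assume \<epsilon>: "0 < \<epsilon>" "\<epsilon> < 1/2" and \<A>: "is_architecture CARD('d) \<A>" "num_weights \<A> = 0 \<longrightarrow> \<epsilon> < B"
      and "\<forall>f :: real^'d \<Rightarrow> real.
       f \<in> sobolev_inf n (box 0 1) \<longrightarrow> sobolev_inf_norm n (box 0 1) f \<le> ereal B \<longrightarrow>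
       (\<exists>\<Phi>. has_architecture CARD('d) \<Phi> \<A> \<and>
            sobolev_inf_norm k (box 0 1) (\<lambda>x. realization1 \<Phi> x - f x) \<le> ereal \<epsilon>)"
    then have approx: "\<And>f :: real^'d \<Rightarrow> real. f \<in> sobolev_inf n (box 0 1) \<Longrightarrow>
      sobolev_inf_norm n (box 0 1) f \<le> ereal B \<Longrightarrow>
      \<exists>\<Phi>. has_architecture CARD('d) \<Phi> \<A> \<and>
        sobolev_inf_norm k (box 0 1) (\<lambda>x. realization1 \<Phi> x - f x) \<le> ereal \<epsilon>" by blast
    let ?M = "real (num_weights \<A>)"
    have M: "?M \<ge> 1"
      using num_weights_pos[where n = n and k = k, OF \<A>(1) \<open>B > 0\<close> \<A>(2) approx] by simp
    \<comment> \<open>The real solution of \<open>\<epsilon> * r ^ (n - k) = \<kappa>\<close>, that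
      is, the finest admissible grid. If \<open>r < 1\<close> there is no grid, and the existence of
      one weight is enough.\<close>
    define r where "r = (\<kappa> / \<epsilon>) powr (1 / (real n - real k))"
    have r: "r > 0" unfolding r_def using \<kappa> \<epsilon> by simp
    have r_pow: "r powr (?d / 2) = \<kappa> powr p * \<epsilon> powr (- p)"
    proof -
      have "1 / (real n - real k) * (?d / 2) = p" unfolding p_def by simp
      then show ?thesis unfolding r_def powr_powr using \<kappa> \<epsilon> by (simp add: powr_divide powr_minus_divide)
    qed
    have "(r / 2) powr (?d / 2) \<le> 5 * ?M"
    proof (cases "r < 1")
      case True
      have "(r / 2) powr (?d / 2) \<le> 1 powr (?d / 2)" using r True by (intro powr_mono2) auto
      then show ?thesis using M by simp
    next
      case False
      define N where "N = nat \<lfloor>r\<rfloor>"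
      have N: "N \<ge> 1" "real N \<le> r" "r / 2 \<le> real N"
      proof -
        have fl: "1 \<le> \<lfloor>r\<rfloor>" using False by simp
        have "real N = of_int \<lfloor>r\<rfloor>" unfolding N_def using fl by simp
        moreover have "(1::real) \<le> of_int \<lfloor>r\<rfloor>" using fl by linarith
        moreover have "of_int \<lfloor>r\<rfloor> \<le> r" "r < of_int \<lfloor>r\<rfloor> + 1" by linarith+
        ultimately show "N \<ge> 1" "real N \<le> r" "r / 2 \<le> real N" by linarith+
      qed
      have "real N ^ (n - k) \<le> r ^ (n - k)" using N by (intro power_mono) auto
      also have "r ^ (n - k) = \<kappa> / \<epsilon>"
      proof -
        have "r ^ (n - k) = r powr real (n - k)" using r by (simp add: powr_realpow)
        also have "real (n - k) = real n - real k" using nk by simp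
        finally show ?thesis unfolding r_def using \<kappa> \<epsilon> nk by (simp add: powr_powr)
      qed
      finally have "\<epsilon> * real N ^ (n - k) \<le> \<kappa>" using \<epsilon> by (simp add: pos_le_divide_eq mult.commute)
      then have "4 * \<epsilon> * real N ^ (n - k) * C \<le> 4 * \<kappa> * C"
        using C(1) by (intro mult_right_mono) auto
      also have "\<dots> < 8 * C * \<kappa>" using \<kappa> C(1) by simp
      also have "\<dots> = B * bump 0 (1/2) (1/4) ^ CARD('d)" unfolding \<kappa>_def using C(1) by simp
      finally have "N ^ CARD('d) \<le> 25 * (num_weights \<A>)\<^sup>2"
        using nk by (intro grid_lower_bound[OF \<A>(1) assms(3) _ N(1) \<open>B > 0\<close> C _ \<epsilon>(1) approx]) auto
      then have "real N ^ CARD('d) \<le> (5 * ?M)\<^sup>2"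
      proof -
        assume "N ^ CARD('d) \<le> 25 * (num_weights \<A>)\<^sup>2"
        then have "real (N ^ CARD('d)) \<le> real (25 * (num_weights \<A>)\<^sup>2)" by (simp only: of_nat_le_iff)
        then show ?thesis by (simp add: power_mult_distrib)
      qed
      moreover have "(real N powr (?d / 2))\<^sup>2 = real N ^ CARD('d)"
        using N(1) by (simp add: power2_eq_square powr_realpow flip: powr_add)
      ultimately have "(real N powr (?d / 2))\<^sup>2 \<le> (5 * ?M)\<^sup>2" by simp
      then have "real N powr (?d / 2) \<le> 5 * ?M" by (rule power2_le_imp_le) simp
      moreover have "(r / 2) powr (?d / 2) \<le> real N powr (?d / 2)"
        using N r by (intro powr_mono2) auto
      ultimately show ?thesis by linarith
    qed
    moreover have "(r / 2) powr (?d / 2) = 2 powr (- ?d / 2) * (\<kappa> powr p * \<epsilon> powr (- p))"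
      using r by (simp add: powr_divide r_pow powr_minus_divide)
    ultimately show "?M \<ge> c * \<epsilon> powr (- (?d / (2 * (real n - real k))))"
      unfolding c_def p_def[symmetric] by simp
  qed
qed

end
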